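(* (a) If $T:\mathcal{M}_d(\mathbb{C})\to\mathcal{M}_d(\mathbb{C})$ is a trace-preserving completely positive linear map, then $\mu_k(\mathrm{spec}(T))\ge0$ for all $k\in\mathbb{N}$. (b) Conversely, let $\Lambda=\{\lambda_1,\dots,\lambda_n\}$ be a multiset of non-zero complex numbers such that $\max\{|\lambda|:\lambda\in\Lambda\}=1$ and this maximum is attained by exactly one element $\lambda_p$ of $\Lambda$ (counted with multiplicity). If for all $k,m\in\mathbb{N}$ one has $\mu_k(\Lambda)\ge0$, and $\mu_m(\Lambda)>0$ implies $\mu_{km}(\Lambda)>0$, then there exist $N\in\mathbb{N}$ and a primitive trace-preserving completely positive linear map $T$ on $\mathcal{M}_N(\mathbb{C})$ with $\mathrm{spec}(T)\setminus\{0\}=\Lambda$ (as multisets).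
   Context: For a multiset $\Lambda=\{\lambda_1,\dots,\lambda_n\}$ of complex numbers, its $k$-th moment is $\mu_k(\Lambda):=\sum_{j=1}^n\lambda_j^k$. $\mathrm{spec}(T)$ is the spectrum of $T$ as a linear operator on $\mathcal{M}_d(\mathbb{C})$, counted with algebraic multiplicity, and $\mathrm{spec}(T)\setminus\{0\}$ removes all copies of $0$. A positive linear map (mapping positive semidefinite matrices to positive semidefinite matrices) is irreducible if its spectral radius is a non-degenerate eigenvalue with a positive definite eigenvector, and primitive if it is irreducible and no other eigenvalue has modulus equal to the spectral radius. Completely positive: $T\otimes\mathrm{id}$ is positive; trace-preserving: $\mathrm{tr}[T(X)]=\mathrm{tr}[X]$. *)

theory Defs
  imports "Jordan_Normal_Form.Matrix" "Jordan_Normal_Form.Char_Poly"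
    "HOL-Computational_Algebra.Polynomial"
begin

definition psd_mat :: "nat \<Rightarrow> complex mat \<Rightarrow> bool" where
  "psd_mat n A \<longleftrightarrow> A \<in> carrier_mat n n \<and>
     (\<forall>v \<in> carrier_vec n. Im (conjugate v \<bullet> (A *\<^sub>v v)) = 0 \<and> Re (conjugate v \<bullet> (A *\<^sub>v v)) \<ge> 0)"

definition pd_mat :: "nat \<Rightarrow> complex mat \<Rightarrow> bool" where
  "pd_mat n A \<longleftrightarrow> A \<in> carrier_mat n n \<and>
     (\<forall>v \<in> carrier_vec n. v \<noteq> 0\<^sub>v n \<longrightarrow>
        Im (conjugate v \<bullet> (A *\<^sub>v v)) = 0 \<and> Re (conjugate v \<bullet> (A *\<^sub>v v)) > 0)"

definition linear_map_on :: "nat \<Rightarrow> (complex mat \<Rightarrow> complex mat) \<Rightarrow> bool" where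
  "linear_map_on d T \<longleftrightarrow>
     (\<forall>X \<in> carrier_mat d d. T X \<in> carrier_mat d d) \<and>
     (\<forall>X \<in> carrier_mat d d. \<forall>Y \<in> carrier_mat d d. T (X + Y) = T X + T Y) \<and>
     (\<forall>c. \<forall>X \<in> carrier_mat d d. T (c \<cdot>\<^sub>m X) = c \<cdot>\<^sub>m T X)"

definition positive_map :: "nat \<Rightarrow> (complex mat \<Rightarrow> complex mat) \<Rightarrow> bool" where
  "positive_map d T \<longleftrightarrow> (\<forall>X. psd_mat d X \<longrightarrow> psd_mat d (T X))"

(* T \<otimes> id on M_d \<otimes> M_k = M_{dk}, Kronecker index (a,b) \<mapsto> a*k+b with a<d, b<k;
   (T\<otimes>id)(X)_{(a,b),(a',b')} = T(X^{(b,b')})_{a,a'} where X^{(b,b')}_{a,a'} = X_{(a,b),(a',b')} *)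
definition tensor_id :: "nat \<Rightarrow> nat \<Rightarrow> (complex mat \<Rightarrow> complex mat) \<Rightarrow> complex mat \<Rightarrow> complex mat" where
  "tensor_id d k T X = mat (d * k) (d * k) (\<lambda>(i, j).
      T (mat d d (\<lambda>(a, a'). X $$ (a * k + i mod k, a' * k + j mod k))) $$ (i div k, j div k))"

definition completely_positive :: "nat \<Rightarrow> (complex mat \<Rightarrow> complex mat) \<Rightarrow> bool" where
  "completely_positive d T \<longleftrightarrow> (\<forall>k X. psd_mat (d * k) X \<longrightarrow> psd_mat (d * k) (tensor_id d k T X))"

definition mtrace :: "complex mat \<Rightarrow> complex" where
  "mtrace A = (\<Sum>i<dim_row A. A $$ (i, i))"

definition trace_preserving :: "nat \<Rightarrow> (complex mat \<Rightarrow> complex mat) \<Rightarrow> bool" where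
  "trace_preserving d T \<longleftrightarrow> (\<forall>X \<in> carrier_mat d d. mtrace (T X) = mtrace X)"

definition mat_unit :: "nat \<Rightarrow> nat \<Rightarrow> nat \<Rightarrow> complex mat" where
  "mat_unit d a b = mat d d (\<lambda>(x, y). if x = a \<and> y = b then 1 else 0)"

(* matrix of T w.r.t. the basis (E_{ab}), index (a,b) \<mapsto> a*d+b *)
definition op_matrix :: "nat \<Rightarrow> (complex mat \<Rightarrow> complex mat) \<Rightarrow> complex mat" where
  "op_matrix d T = mat (d * d) (d * d) (\<lambda>(i, j).
      T (mat_unit d (j div d) (j mod d)) $$ (i div d, i mod d))"

definition spec :: "nat \<Rightarrow> (complex mat \<Rightarrow> complex mat) \<Rightarrow> complex multiset" where
  "spec d T = proots (char_poly (op_matrix d T))"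

definition moment :: "nat \<Rightarrow> complex multiset \<Rightarrow> complex" where
  "moment k \<Lambda> = (\<Sum>x\<in>#\<Lambda>. x ^ k)"

definition spectral_radius_map :: "nat \<Rightarrow> (complex mat \<Rightarrow> complex mat) \<Rightarrow> real" where
  "spectral_radius_map d T = Max (insert 0 (cmod ` set_mset (spec d T)))"

definition irreducible_map :: "nat \<Rightarrow> (complex mat \<Rightarrow> complex mat) \<Rightarrow> bool" where
  "irreducible_map d T \<longleftrightarrow>
     (let r = spectral_radius_map d T in
       count (spec d T) (complex_of_real r) = 1 \<and>
       (\<exists>X. pd_mat d X \<and> T X = complex_of_real r \<cdot>\<^sub>m X))"

definition primitive_map :: "nat \<Rightarrow> (complex mat \<Rightarrow> complex mat) \<Rightarrow> bool" where
  "primitive_map d T \<longleftrightarrow> irreducible_map d T \<and>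
     (\<forall>x \<in># spec d T. cmod x = spectral_radius_map d T \<longrightarrow> x = complex_of_real (spectral_radius_map d T))"

end

theory Submission
  imports Defs "Jordan_Normal_Form.Schur_Decomposition" "HOL-Computational_Algebra.Polynomial_FPS"
begin

text \<open>
  Part (a): applying \<open>T \<otimes> id\<close> to the unnormalised maximally entangled state \<open>k\<close> times gives a
  positive semidefinite matrix which is a realignment of the \<open>k\<close>-th power of the matrix of \<open>T\<close>; its
  expectation in the maximally entangled vector is the trace of that power, that is, the \<open>k\<close>-th moment.

  Part (b) is the Boyle-Handelman theorem over the reals: a nonnegative matrix with a positive left
  and a positive right eigenvector for the eigenvalue 1 can be rescaled to a stochastic matrix, which
  acts as a quantum channel on diagonals. Put \<open>f(t) = \<Prod>(1 - \<lambda> t)\<close>; we look for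
  a nonnegative matrix \<open>A\<close> with \<open>det(1 - t A) = f(t)\<close>. All moments are positive from some index \<open>L\<close>
  on. Choose \<open>r = \<eta> t^L / (1 - (1 - \<eta>) t)\<close> with \<open>\<eta>\<close> so small that the
  moments of \<open>f / (1 - r)\<close> are nonnegative, with the same zeros as those of \<open>f\<close>. A product \<open>Q\<close> of
  factors \<open>1 - c t^j\<close> with tiny \<open>c > 0\<close> reproduces these moments up to a large degree \<open>D\<close> (here the
  closure of the positive moments under multiples is used), so \<open>1 - f / Q\<close> agrees with \<open>r\<close> up to
  degree \<open>D\<close>, while its later coefficients are bounded by \<open>C \<theta>'^k\<close> with \<open>C\<close> and \<open>\<theta>' < 1\<close> independent of \<open>D\<close>.
  Let \<open>p\<close> be a multiple of a truncation of \<open>r\<close> with \<open>2 p \<le> r\<close> and \<open>p(R) = 1\<close> for some \<open>R\<close> with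
  \<open>1 < R < 1 / \<theta>'\<close>. Then \<open>f = (1 - p) Q (1 - \<phi>)\<close> with \<open>\<phi> = (1 - f / Q - p) / (1 - p)\<close>,
  and since the coefficients of \<open>1 / (1 - p)\<close> are of exact order \<open>R^-k\<close>, they dominate the tail, so that \<open>\<phi>\<close> is a sum of
  nonnegative polynomials divided by partial products of the factors of \<open>(1 - p) Q\<close>. Such a sum is the
  total weight of the closed walks at one vertex of a network whose other vertices carry the loops
  \<open>p\<close> and \<open>c t^j\<close>, and the determinant of that network is \<open>(1 - p) Q (1 - \<phi>) = f\<close>.
\<close>

section \<open>Power series and their moments\<close>

text \<open>For \<open>A = \<Prod>(1 - \<lambda> X)\<close> the coefficients of \<open>a\<close> are the power sums of the \<open>\<lambda>\<close>;
  the equation is Newton's identities.\<close>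
definition has_moments :: "'a::comm_ring_1 fps \<Rightarrow> 'a fps \<Rightarrow> bool" where
  "has_moments A a \<longleftrightarrow> fps_nth A 0 = 1 \<and> - (fps_X * fps_deriv A) = A * a"

lemma fps_nth_X_deriv: "fps_nth (fps_X * fps_deriv A) k = of_nat k * fps_nth A k"
  by (cases k) simp_all

lemma has_moments_one: "has_moments 1 0"
  by (simp add: has_moments_def)

text \<open>\<open>a\<close> is \<open>- X A' / A\<close>, minus \<open>X\<close> times a
  logarithmic derivative, so moments add when series are multiplied. Writing the defining equation
  without division makes it meaningful over any commutative ring.\<close>

lemma has_moments_mult:
  assumes "has_moments A a" "has_moments B b"
  shows "has_moments (A * B) (a + b)"
proof -
  have "- (fps_X * fps_deriv (A * B)) = - (fps_X * fps_deriv A) * B + A * - (fps_X * fps_deriv B)"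
    by (simp add: algebra_simps)
  also have "\<dots> = A * B * (a + b)"
    using assms by (simp add: has_moments_def algebra_simps)
  finally show ?thesis
    using assms by (simp add: has_moments_def)
qed

lemma has_moments_inverse:
  fixes A :: "'a::field fps"
  assumes "has_moments A a"
  shows "has_moments (inverse A) (- a)"
proof -
  have A0: "fps_nth A 0 = 1" and A: "- (fps_X * fps_deriv A) = A * a"
    using assms by (simp_all add: has_moments_def)
  have inv: "inverse A * A = 1"
    by (rule inverse_mult_eq_1) (simp add: A0)
  have "- (fps_X * fps_deriv (inverse A)) = - (- (fps_X * fps_deriv A)) * (inverse A * inverse A)"
    by (simp add: fps_inverse_deriv A0 power2_eq_square algebra_simps)
  also have "\<dots> = (inverse A * A) * (inverse A * - a)"
    unfolding A by (simp add: algebra_simps)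
  finally show ?thesis
    using A0 by (simp add: has_moments_def inv)
qed

lemma has_moments_nth:
  assumes "has_moments A a"
  shows "of_nat k * fps_nth A k = - (\<Sum>j=0..k. fps_nth a j * fps_nth A (k - j))"
proof -
  have "fps_nth (- (fps_X * fps_deriv A)) k = fps_nth (a * A) k"
    using assms by (simp only: has_moments_def mult.commute)
  thus ?thesis
    unfolding fps_mult_nth[of a A] fps_neg_nth fps_nth_X_deriv by (metis minus_minus)
qed

lemma has_moments_nth_0:
  assumes "has_moments A a"
  shows "fps_nth a 0 = 0"
  using has_moments_nth[OF assms, of 0] assms by (simp add: has_moments_def)

lemma has_moments_nth':
  assumes "has_moments A a"
  shows "of_nat k * fps_nth A k = - (\<Sum>j=1..k. fps_nth a j * fps_nth A (k - j))"
  unfolding has_moments_nth[OF assms, of k]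
  by (simp add: sum.atLeast_Suc_atMost has_moments_nth_0[OF assms])

lemma has_momentsI:
  assumes "fps_nth A 0 = 1" "fps_nth a 0 = 0"
    "\<And>k. k \<ge> 1 \<Longrightarrow> of_nat k * fps_nth A k = - (\<Sum>j=1..k. fps_nth a j * fps_nth A (k - j))"
  shows "has_moments A a"
proof -
  have "- (fps_X * fps_deriv A) = a * A"
  proof (rule fps_ext)
    fix k
    show "fps_nth (- (fps_X * fps_deriv A)) k = fps_nth (a * A) k"
      unfolding fps_neg_nth fps_nth_X_deriv
      using assms(2) assms(3)[of k]
      by (cases "k = 0") (simp_all add: fps_mult_nth sum.atLeast_Suc_atMost)
  qed
  thus ?thesis using assms(1) by (simp add: has_moments_def mult.commute)
qed

text \<open>Newton's recursion computes coefficient \<open>k\<close> from the moments up to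
  \<open>k\<close> and the earlier coefficients; characteristic 0 allows the division by
  \<open>k\<close>. With its converse below it carries agreement up to degree \<open>D\<close> back
  and forth between moments and coefficients.\<close>

lemma has_moments_coeff_unique:
  fixes A B :: "'a::field_char_0 fps"
  assumes A: "has_moments A a" and B: "has_moments B b"
    and ab: "\<And>k. k \<le> D \<Longrightarrow> fps_nth a k = fps_nth b k"
  shows "k \<le> D \<Longrightarrow> fps_nth A k = fps_nth B k"
proof (induction k rule: less_induct)
  case (less k)
  show ?case
  proof (cases "k = 0")
    case True
    thus ?thesis using A B by (simp add: has_moments_def)
  next
    case False
    have "of_nat k * fps_nth A k = of_nat k * fps_nth B k"
      unfolding has_moments_nth'[OF A] has_moments_nth'[OF B]
      using less ab by (intro arg_cong[of _ _ uminus] sum.cong) auto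
    thus ?thesis using False by simp
  qed
qed

lemma has_moments_moment_unique:
  fixes A B :: "'a::field_char_0 fps"
  assumes A: "has_moments A a" and B: "has_moments B b"
    and AB: "\<And>k. k \<le> D \<Longrightarrow> fps_nth A k = fps_nth B k"
  shows "k \<le> D \<Longrightarrow> fps_nth a k = fps_nth b k"
proof (induction k rule: less_induct)
  case (less k)
  show ?case
  proof (cases "k = 0")
    case True
    thus ?thesis using A B has_moments_nth_0 by metis
  next
    case False
    hence k: "{1..k} = insert k {1..<k}" by auto
    have "(\<Sum>j=1..k. fps_nth a j * fps_nth A (k - j)) = (\<Sum>j=1..k. fps_nth b j * fps_nth B (k - j))"
      using has_moments_nth'[OF A, of k] has_moments_nth'[OF B, of k] AB[of k] less.prems by simp
    moreover have "(\<Sum>j\<in>{1..<k}. fps_nth a j * fps_nth A (k - j)) = (\<Sum>j\<in>{1..<k}. fps_nth b j * fps_nth B (k - j))"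
      using less AB by (intro sum.cong) auto
    ultimately show ?thesis
      unfolding k using A B by (simp add: has_moments_def)
  qed
qed

text \<open>Heuristically, the reciprocals of the roots of \<open>1 - c X^j\<close> are the
  \<open>j\<close>-th roots of \<open>c\<close>, whose \<open>k\<close>-th powers cancel unless
  \<open>j\<close> divides \<open>k\<close>. Comparing coefficients proves this over every
  commutative ring.\<close>

lemma has_moments_one_minus_monom:
  fixes c :: "'a::comm_ring_1"
  assumes "j \<ge> 1"
  shows "has_moments (1 - fps_const c * fps_X ^ j)
           (Abs_fps (\<lambda>k. if k > 0 \<and> j dvd k then of_nat j * c ^ (k div j) else 0))" (is "has_moments _ ?a")
proof -
  have e: "fps_nth (fps_const c * fps_X ^ j * a) k = (if k < j then 0 else c * fps_nth a (k - j))"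
    for k and a :: "'a fps"
    by (simp add: mult.assoc fps_X_power_mult_nth)
  have "- (fps_X * fps_deriv (1 - fps_const c * fps_X ^ j)) = (1 - fps_const c * fps_X ^ j) * ?a"
  proof (rule fps_ext)
    fix k
    have l: "fps_nth (- (fps_X * fps_deriv (1 - fps_const c * fps_X ^ j))) k = (if k = j then of_nat j * c else 0)"
      unfolding fps_neg_nth fps_nth_X_deriv using assms by simp
    have "fps_nth ((1 - fps_const c * fps_X ^ j) * ?a) k
            = fps_nth ?a k - (if k < j then 0 else c * fps_nth ?a (k - j))"
      unfolding left_diff_distrib fps_sub_nth e by simp
    also have "\<dots> = (if k = j then of_nat j * c else 0)"
    proof (cases "k > j \<and> j dvd k")
      case True
      then obtain i where ki: "k = j * i" by (elim conjE dvdE)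
      with True have "j * 1 < j * i" by simp
      hence "i > 1" by (simp only: mult_less_cancel1)
      hence i': "i = Suc (Suc (i - 2))" by simp
      define i' where "i' = i - 2"
      have ki: "k = j * Suc (Suc i')" using ki i' by (simp only: i'_def)
      have "k - j = j * Suc i'" "k div j = Suc (Suc i')"
        using ki assms by auto
      moreover from this have "(k - j) div j = Suc i'" using assms by simp
      ultimately show ?thesis using True assms by (simp add: mult.commute mult.left_commute)
    next
      case False
      thus ?thesis using assms
        by (auto dest: dvd_imp_le simp: dvd_minus_self)
    qed
    finally show "fps_nth (- (fps_X * fps_deriv (1 - fps_const c * fps_X ^ j))) k
      = fps_nth ((1 - fps_const c * fps_X ^ j) * ?a) k"
      using l by simp
  qed
  thus ?thesis using assms by (simp add: has_moments_def)
qed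

lemma has_moments_one_minus_X:
  fixes c :: "'a::comm_ring_1"
  shows "has_moments (1 - fps_const c * fps_X) (Abs_fps (\<lambda>k. if k > 0 then c ^ k else 0))"
  using has_moments_one_minus_monom[of 1 c] by (simp cong: if_cong)

text \<open>The coefficients \<open>e\<close> of \<open>1 / A\<close> satisfy
  \<open>k e_k = \<Sum> a_j e_(k-j)\<close>. A bound \<open>b \<theta>'^i\<close> on the earlier
  \<open>e_i\<close> makes the right side at most \<open>X b \<theta>'^k\<close> with
  \<open>X = m / (1 - \<theta> / \<theta>')\<close>, so for \<open>k \<ge> X\<close> division by
  \<open>k\<close> reproduces the bound. Only \<open>m\<close>, \<open>\<theta>\<close> and
  \<open>\<theta>'\<close> enter, hence one \<open>C\<close> serves all \<open>A\<close>.\<close>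

lemma has_moments_inverse_coeff_bound:
  fixes A :: "real fps"
  assumes m: "m \<ge> (0::real)" and th: "0 < \<theta>" "\<theta> < \<theta>'"
  shows "\<exists>C>0. \<forall>A a. has_moments A a \<longrightarrow> (\<forall>k. 0 \<le> fps_nth a k \<and> fps_nth a k \<le> m * \<theta> ^ k) \<longrightarrow>
           (\<forall>k. 0 \<le> fps_nth (inverse A) k \<and> fps_nth (inverse A) k \<le> C * \<theta>' ^ k)"
proof -
  define x where "x = \<theta> / \<theta>'"
  have x: "0 < x" "x < 1" using th by (auto simp: x_def)
  define X where "X = m * (1 / (1 - x))"
  define B where "B = max 1 X"
  obtain k1 :: nat where k1: "X \<le> real k1" using real_arch_simple by blast
  have B: "B \<ge> 1" "X \<le> B" by (auto simp: B_def)
  have X0: "X \<ge> 0" using x m by (simp add: X_def)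
  have geo: "(\<Sum>j=1..k. x ^ j) \<le> 1 / (1 - x)" for k
  proof -
    have "(\<Sum>j=1..k. x ^ j) \<le> (\<Sum>j. x ^ j)"
      by (rule sum_le_suminf) (use x in \<open>auto intro: summable_geometric\<close>)
    thus ?thesis using x by (simp add: suminf_geometric)
  qed
  show ?thesis
  proof (intro exI[of _ "B ^ k1"] conjI allI impI)
    show "B ^ k1 > 0" using B by simp
    fix A :: "real fps" and a and n :: nat
    assume A: "has_moments A a" and a: "\<forall>k. 0 \<le> fps_nth a k \<and> fps_nth a k \<le> m * \<theta> ^ k"
    let ?e = "fps_nth (inverse A)"
    have rec: "real k * ?e k = (\<Sum>j=1..k. fps_nth a j * ?e (k - j))" for k
      using has_moments_nth'[OF has_moments_inverse[OF A], of k] by (simp add: sum_negf)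
    have e0: "?e 0 = 1" using has_moments_inverse[OF A] by (simp add: has_moments_def)
    \<comment> \<open>The constant grows by a factor \<open>B\<close> during the first
      \<open>k1\<close> steps, where \<open>k\<close> may be too small to absorb \<open>X\<close>;
      the exponent \<open>min k k1\<close> freezes afterwards.\<close>
    have main: "0 \<le> ?e k \<and> ?e k \<le> B ^ min k k1 * \<theta>' ^ k" for k
    proof (induction k rule: less_induct)
      case (less k)
      show ?case
      proof (cases "k = 0")
        case True
        thus ?thesis using e0 by simp
      next
        case False
        have "0 \<le> real k * ?e k" unfolding rec
          using less a False by (intro sum_nonneg mult_nonneg_nonneg) auto
        hence nn: "0 \<le> ?e k" using False by (simp add: zero_le_mult_iff)
        have "real k * ?e k \<le> (\<Sum>j=1..k. (m * \<theta> ^ j) * (B ^ min (k - 1) k1 * \<theta>' ^ (k - j)))"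
          unfolding rec
        proof (intro sum_mono mult_mono)
          fix j assume j: "j \<in> {1..k}"
          have "?e (k - j) \<le> B ^ min (k - j) k1 * \<theta>' ^ (k - j)" using less[of "k - j"] j False by auto
          also have "\<dots> \<le> B ^ min (k - 1) k1 * \<theta>' ^ (k - j)"
            using j B th by (intro mult_right_mono power_increasing) auto
          finally show "?e (k - j) \<le> B ^ min (k - 1) k1 * \<theta>' ^ (k - j)" .
        qed (use a m th less in auto)
        also have "\<dots> = (\<Sum>j=1..k. (m * B ^ min (k - 1) k1 * \<theta>' ^ k) * x ^ j)"
        proof (intro sum.cong refl)
          fix j assume j: "j \<in> {1..k}"
          have "\<theta>' ^ k = \<theta>' ^ j * \<theta>' ^ (k - j)" using j by (simp flip: power_add)
          thus "m * \<theta> ^ j * (B ^ min (k - 1) k1 * \<theta>' ^ (k - j)) = (m * B ^ min (k - 1) k1 * \<theta>' ^ k) * x ^ j"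
            using th by (simp add: x_def field_simps)
        qed
        also have "\<dots> \<le> (m * B ^ min (k - 1) k1 * \<theta>' ^ k) * (1 / (1 - x))"
          unfolding sum_distrib_left[symmetric] using geo B th m
          by (intro mult_left_mono mult_nonneg_nonneg) auto
        also have "\<dots> = X * (B ^ min (k - 1) k1 * \<theta>' ^ k)" by (simp add: X_def)
        also have "\<dots> \<le> real k * (B ^ min k k1 * \<theta>' ^ k)"
        proof (cases "k \<le> k1")
          case True
          hence "min k k1 = Suc (min (k - 1) k1)" using False by auto
          hence "B ^ min k k1 = B * B ^ min (k - 1) k1" by (simp only: power_Suc)
          moreover have "X * (B ^ min (k - 1) k1 * \<theta>' ^ k) \<le> (real k * B) * (B ^ min (k - 1) k1 * \<theta>' ^ k)"
          proof (intro mult_right_mono)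
            have "1 * B \<le> real k * B" using False B by (intro mult_right_mono) auto
            thus "X \<le> real k * B" using B by linarith
          qed (use B th in auto)
          ultimately show ?thesis by simp
        next
          case False
          hence "min k k1 = min (k - 1) k1" by auto
          hence "B ^ min k k1 = B ^ min (k - 1) k1" by (simp only:)
          moreover have "X * (B ^ min (k - 1) k1 * \<theta>' ^ k) \<le> real k * (B ^ min (k - 1) k1 * \<theta>' ^ k)"
            using False k1 B th by (intro mult_right_mono) auto
          ultimately show ?thesis by simp
        qed
        finally show ?thesis using nn False by simp
      qed
    qed
    show "0 \<le> ?e n" using main by blast
    have "?e n \<le> B ^ min n k1 * \<theta>' ^ n" using main by blast
    also have "\<dots> \<le> B ^ k1 * \<theta>' ^ n"
      using B th by (intro mult_right_mono power_increasing) auto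
    finally show "?e n \<le> B ^ k1 * \<theta>' ^ n" .
  qed
qed

section \<open>The comparison series \<open>geo_tail\<close> and the moments of
  \<open>1 - geo_tail\<close>\<close>

definition geo_tail :: "real \<Rightarrow> nat \<Rightarrow> real fps" where
  "geo_tail \<eta> L = Abs_fps (\<lambda>k. if k < L then 0 else \<eta> * (1 - \<eta>) ^ (k - L))"

lemma fps_mult_one_minus_X_nth:
  fixes A :: "'a::comm_ring_1 fps"
  shows "fps_nth ((1 - fps_const c * fps_X) * A) k = fps_nth A k - (if k = 0 then 0 else c * fps_nth A (k - 1))"
proof -
  have "(1 - fps_const c * fps_X) * A = A - fps_const c * (fps_X * A)" by (simp add: algebra_simps)
  thus ?thesis by simp
qed

lemma has_moments_exists:
  fixes A :: "'a::field fps"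
  assumes "fps_nth A 0 = 1"
  shows "\<exists>a. has_moments A a"
proof
  have "A * inverse A = 1" using assms by (intro inverse_mult_eq_1') simp
  hence "A * (inverse A * - (fps_X * fps_deriv A)) = - (fps_X * fps_deriv A)"
    by (simp add: mult.assoc[symmetric])
  thus "has_moments A (inverse A * - (fps_X * fps_deriv A))"
    using assms by (simp add: has_moments_def)
qed

text \<open>Newton's recursion writes moment \<open>k\<close> as \<open>- k d_k\<close> minus
  \<open>\<eta>\<close> times at most \<open>L\<close> preceding moments. Going back fewer than
  \<open>L\<close> places costs at most a factor \<open>1 / \<rho>^L\<close>, and the value
  \<open>2 L / \<rho>^L\<close> of \<open>A\<close> makes each of the two contributions at most half
  of the claimed bound.\<close>

lemma moments_one_plus_geo:
  fixes \<delta> :: "real fps"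
  assumes d: "has_moments (Abs_fps (\<lambda>k. if k = 0 then 1 else if k < L then \<eta> else 0)) \<delta>"
    and rho: "0 < \<rho>" "\<rho> < 1" and A: "A = 2 * real L / \<rho> ^ L" and eta: "0 < \<eta>" "\<eta> * A \<le> 1" and k: "k \<ge> 1"
  shows "\<bar>fps_nth \<delta> k\<bar> \<le> A * \<eta> * \<rho> ^ k"
  using k
proof (induction k rule: less_induct)
  case (less k)
  let ?d = "\<lambda>k. if k = 0 then 1 else if k < L then \<eta> else (0::real)"
  have rL: "\<rho> ^ L > 0" using rho by simp
  have A0: "A \<ge> 0" using rL A by simp
  have set: "{1..k} = insert k {1..<k}" using less.prems by auto
  have "real k * ?d k = - (\<Sum>j=1..k. fps_nth \<delta> j * ?d (k - j))"
    using has_moments_nth'[OF d, of k] by simp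
  also have "(\<Sum>j=1..k. fps_nth \<delta> j * ?d (k - j)) = fps_nth \<delta> k + (\<Sum>j\<in>{1..<k}. fps_nth \<delta> j * ?d (k - j))"
    unfolding set by (subst sum.insert) auto
  finally have "fps_nth \<delta> k = - (real k * ?d k) - (\<Sum>j\<in>{1..<k}. fps_nth \<delta> j * ?d (k - j))" by linarith
  hence "\<bar>fps_nth \<delta> k\<bar> \<le> \<bar>real k * ?d k\<bar> + \<bar>\<Sum>j\<in>{1..<k}. fps_nth \<delta> j * ?d (k - j)\<bar>" by linarith
  also have "\<bar>real k * ?d k\<bar> \<le> A * \<eta> * \<rho> ^ k / 2"
  proof (cases "k < L")
    case True
    have "\<rho> ^ L \<le> \<rho> ^ k" using True rho by (intro power_decreasing) auto
    hence "real k * \<rho> ^ L \<le> real L * \<rho> ^ k" using True rho by (intro mult_mono) auto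
    hence "real k \<le> real L * \<rho> ^ k / \<rho> ^ L" using rL by (simp add: pos_le_divide_eq)
    hence "\<eta> * real k \<le> \<eta> * (real L * \<rho> ^ k / \<rho> ^ L)" using eta by (intro mult_left_mono) auto
    thus ?thesis using True less.prems eta by (simp add: A mult.commute mult.left_commute)
  next
    case False
    thus ?thesis using A0 eta rho less.prems by simp
  qed
  also have "\<bar>\<Sum>j\<in>{1..<k}. fps_nth \<delta> j * ?d (k - j)\<bar> \<le> (\<Sum>j\<in>{1..<k}. \<bar>fps_nth \<delta> j * ?d (k - j)\<bar>)"
    by (rule sum_abs)
  also have "\<dots> = (\<Sum>j\<in>{j\<in>{1..<k}. k < j + L}. \<bar>fps_nth \<delta> j\<bar> * \<eta>)"
    by (rule sum.mono_neutral_cong_right) (use eta in \<open>auto simp: abs_mult\<close>)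
  also have "\<dots> \<le> (\<Sum>j\<in>{j\<in>{1..<k}. k < j + L}. (A * \<eta> * (\<rho> ^ k / \<rho> ^ L)) * \<eta>)"
  proof (intro sum_mono mult_right_mono)
    fix j assume j: "j \<in> {j\<in>{1..<k}. k < j + L}"
    have "\<rho> ^ (j + L) \<le> \<rho> ^ k" using j rho by (intro power_decreasing) auto
    hence *: "\<rho> ^ j \<le> \<rho> ^ k / \<rho> ^ L" using rL by (simp add: pos_le_divide_eq power_add)
    have "\<bar>fps_nth \<delta> j\<bar> \<le> A * \<eta> * \<rho> ^ j" using less.IH j by auto
    also have "\<dots> \<le> A * \<eta> * (\<rho> ^ k / \<rho> ^ L)" using * A0 eta by (intro mult_left_mono) auto
    finally show "\<bar>fps_nth \<delta> j\<bar> \<le> A * \<eta> * (\<rho> ^ k / \<rho> ^ L)" .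
  qed (use eta in auto)
  also have "\<dots> = real (card {j\<in>{1..<k}. k < j + L}) * ((A * \<eta> * (\<rho> ^ k / \<rho> ^ L)) * \<eta>)" by simp
  also have "\<dots> \<le> real L * ((A * \<eta> * (\<rho> ^ k / \<rho> ^ L)) * \<eta>)"
  proof (intro mult_right_mono)
    have "card {j\<in>{1..<k}. k < j + L} \<le> card {k - L..<k}" by (intro card_mono) auto
    thus "real (card {j\<in>{1..<k}. k < j + L}) \<le> real L" by simp
  qed (use A0 eta rho in auto)
  also have "\<dots> = (\<eta> * A) * (A * \<eta> * \<rho> ^ k / 2)"
    using rL by (simp add: A field_simps)
  also have "\<dots> \<le> 1 * (A * \<eta> * \<rho> ^ k / 2)"
    using eta A0 rho by (intro mult_right_mono) auto
  finally show ?case by simp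
qed

text \<open>With \<open>\<theta> = 1 - \<eta>\<close> and
  \<open>d = 1 + \<eta> (X + ... + X^(L-1))\<close> one has
  \<open>1 - geo_tail = (1 - X) d / (1 - \<theta> X)\<close>, so
  \<open>\<epsilon>_k = 1 - \<theta>^k + \<delta>_k\<close> with tiny moments
  \<open>\<delta>\<close> of \<open>d\<close>. For large \<open>k\<close> the term
  \<open>\<theta>^k\<close> dominates \<open>s_k - \<epsilon>_k\<close>, because
  \<open>\<rho> < \<theta>\<close>; for the finitely many other \<open>k \<ge> L\<close> a small
  \<open>\<eta>\<close> keeps \<open>\<epsilon>_k\<close> below \<open>s_k\<close>.\<close>

lemma moments_one_minus_geo_tail:
  fixes \<rho> n :: real and s :: "nat \<Rightarrow> real"
  assumes rho: "0 < \<rho>" "\<rho> < 1" and n: "n \<ge> 0" and s: "\<And>k. k \<ge> 1 \<Longrightarrow> \<bar>s k - 1\<bar> \<le> n * \<rho> ^ k"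
    and L: "L \<ge> 1" and sL: "\<And>k. k \<ge> L \<Longrightarrow> s k > 0"
  shows "\<exists>\<eta> \<epsilon>. 0 < \<eta> \<and> \<eta> < 1 \<and> has_moments (1 - geo_tail \<eta> L) \<epsilon> \<and> (\<forall>k<L. fps_nth \<epsilon> k = 0) \<and>
           (\<forall>k\<ge>L. fps_nth \<epsilon> k < s k) \<and> (\<forall>k\<ge>1. s k - fps_nth \<epsilon> k \<le> (n + 2) * (1 - \<eta>) ^ k)"
proof -
  define \<rho>1 where "\<rho>1 = (1 + \<rho>) / 2"
  have rho1: "\<rho> < \<rho>1" "\<rho>1 < 1" "0 < \<rho>1" using rho by (auto simp: \<rho>1_def)
  define A where "A = 2 * real L / \<rho> ^ L"
  have rL: "\<rho> ^ L > 0" "\<rho> ^ L \<le> 1" using rho by (auto intro: power_le_one)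
  have "2 * 1 \<le> A"
  proof -
    have "2 * \<rho> ^ L \<le> 2 * real L" using rL L by linarith
    thus ?thesis using rL by (simp add: A_def pos_le_divide_eq)
  qed
  hence A2: "A \<ge> 2" by simp
  have "(\<lambda>k. (\<rho> / \<rho>1) ^ k) \<longlonglongrightarrow> 0" using rho rho1 by (intro LIMSEQ_realpow_zero) auto
  hence "eventually (\<lambda>k. (\<rho> / \<rho>1) ^ k < 1 / (n + 1)) sequentially"
    using n by (intro order_tendstoD) auto
  then obtain k0 where k0: "\<And>k. k \<ge> k0 \<Longrightarrow> (\<rho> / \<rho>1) ^ k < 1 / (n + 1)"
    by (auto simp: eventually_sequentially)
  define c where "c = Min (insert 1 (s ` {L..<k0}))"
  have c: "c > 0" "\<And>k. k \<in> {L..<k0} \<Longrightarrow> c \<le> s k"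
    unfolding c_def using sL by (simp add: Min_gr_iff, intro Min_le) auto
  \<comment> \<open>The bound \<open>1 / A\<close> serves the estimate of \<open>\<delta>\<close>,
    \<open>(1 - \<rho>) / 2\<close> gives \<open>\<rho>1 \<le> \<theta>\<close>, and the third bound
    makes \<open>\<epsilon>\<close> smaller than \<open>c\<close>, hence than \<open>s\<close>, at
    the indices from \<open>L\<close> up to \<open>k0\<close>.\<close>
  define \<eta> where "\<eta> = Min {1 / A, (1 - \<rho>) / 2, c / (2 * (real k0 + A))}"
  have eta: "0 < \<eta>" "\<eta> \<le> 1 / A" "\<eta> \<le> (1 - \<rho>) / 2" "\<eta> \<le> c / (2 * (real k0 + A))"
    unfolding \<eta>_def using A2 c rho by (simp add: field_simps, (intro Min_le; simp)+)
  have etaA: "\<eta> * A \<le> 1" using eta(2) A2 by (simp add: field_simps)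
  have "\<eta> * (2 * (real k0 + A)) \<le> c" using eta(4) A2 by (subst (asm) pos_le_divide_eq) auto
  hence etac: "\<eta> * (real k0 + A) < c" using c by (simp add: algebra_simps)
  have eta1: "\<eta> < 1" using eta(3) rho by (simp add: field_simps)
  define \<theta> where "\<theta> = 1 - \<eta>"
  have th: "\<rho>1 \<le> \<theta>" "\<theta> < 1" "0 < \<theta>" using eta rho1 by (auto simp: \<theta>_def \<rho>1_def field_simps)
  define d :: "real fps" where "d = Abs_fps (\<lambda>k. if k = 0 then 1 else if k < L then \<eta> else 0)"
  obtain \<delta> where \<delta>: "has_moments d \<delta>" using has_moments_exists[of d] by (auto simp: d_def)
  have db: "\<bar>fps_nth \<delta> k\<bar> \<le> A * \<eta> * \<rho> ^ k" if "k \<ge> 1" for k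
    by (rule moments_one_plus_geo[OF \<delta>[unfolded d_def] rho A_def eta(1) etaA that])
  \<comment> \<open>cancelling the common zero at 1 turns the moments into \<open>1 - \<theta> ^ k\<close> plus those of \<open>d\<close>, which are small\<close>
  have id: "(1 - fps_const \<theta> * fps_X) * (1 - geo_tail \<eta> L) = (1 - fps_const 1 * fps_X) * d"
  proof (rule fps_ext)
    fix k
    have geo: "fps_nth ((1 - fps_const \<theta> * fps_X) * geo_tail \<eta> L) k = (if k = L then \<eta> else 0)"
    proof -
      consider "k < L" | "k = L" | "k > L" by linarith
      thus ?thesis
      proof cases
        case 3
        hence "k - L = Suc (k - 1 - L)" by simp
        thus ?thesis unfolding fps_mult_one_minus_X_nth using 3 by (simp add: geo_tail_def \<theta>_def)
      qed (use L in \<open>simp_all add: fps_mult_one_minus_X_nth geo_tail_def\<close>)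
    qed
    have "fps_nth ((1 - fps_const \<theta> * fps_X) * (1 - geo_tail \<eta> L)) k
        = fps_nth ((1 - fps_const \<theta> * fps_X) * 1) k - (if k = L then \<eta> else 0)"
      unfolding right_diff_distrib[of _ 1 "geo_tail \<eta> L"] fps_sub_nth geo by simp
    also have "\<dots> = fps_nth ((1 - fps_const 1 * fps_X) * d) k"
      unfolding fps_mult_one_minus_X_nth using L by (auto simp: d_def \<theta>_def)
    finally show "fps_nth ((1 - fps_const \<theta> * fps_X) * (1 - geo_tail \<eta> L)) k = fps_nth ((1 - fps_const 1 * fps_X) * d) k" .
  qed
  define g :: "real \<Rightarrow> real fps" where "g = (\<lambda>c. Abs_fps (\<lambda>k. if k > 0 then c ^ k else 0))"
  define \<epsilon> where "\<epsilon> = g 1 + \<delta> + - g \<theta>"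
  have inv: "inverse (1 - fps_const \<theta> * fps_X) * (1 - fps_const \<theta> * fps_X) = 1"
    by (rule inverse_mult_eq_1) simp
  have "1 - geo_tail \<eta> L = (inverse (1 - fps_const \<theta> * fps_X) * (1 - fps_const \<theta> * fps_X)) * (1 - geo_tail \<eta> L)"
    unfolding inv by simp
  also have "\<dots> = (1 - fps_const 1 * fps_X) * d * inverse (1 - fps_const \<theta> * fps_X)"
    unfolding id[symmetric] by (simp only: mult.assoc mult.commute mult.left_commute)
  finally have eps: "has_moments (1 - geo_tail \<eta> L) \<epsilon>"
    unfolding \<epsilon>_def g_def
    by (simp only: has_moments_mult has_moments_inverse has_moments_one_minus_X \<delta>)
  have epsk: "fps_nth \<epsilon> k = 1 + fps_nth \<delta> k - \<theta> ^ k" if "k \<ge> 1" for k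
    using that by (simp add: \<epsilon>_def g_def)
  have 1: "fps_nth \<epsilon> k = 0" if "k < L" for k
  proof -
    have "fps_nth \<epsilon> k = fps_nth 0 k"
      by (rule has_moments_moment_unique[OF eps has_moments_one, of "L - 1"])
         (use L that in \<open>auto simp: geo_tail_def\<close>)
    thus ?thesis by simp
  qed
  have 2: "s k - fps_nth \<epsilon> k \<le> (n + 2) * \<theta> ^ k" if "k \<ge> 1" for k
  proof -
    have r: "\<rho> ^ k \<le> \<theta> ^ k" using rho rho1 th by (intro power_mono) auto
    have "A * \<eta> * \<rho> ^ k \<le> 1 * \<rho> ^ k" using etaA rho by (intro mult_right_mono) (auto simp: mult.commute)
    hence "s k - fps_nth \<epsilon> k \<le> n * \<rho> ^ k + \<theta> ^ k + \<rho> ^ k"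
      using s[OF that] db[OF that] epsk[OF that] by linarith
    also have "\<dots> \<le> n * \<theta> ^ k + \<theta> ^ k + \<theta> ^ k" using r n by (intro add_mono mult_left_mono) auto
    finally show ?thesis by (simp add: algebra_simps)
  qed
  have 3: "fps_nth \<epsilon> k < s k" if "k \<ge> L" for k
  proof (cases "k \<ge> k0")
    case True
    have k1: "k \<ge> 1" using that L by simp
    have "A * \<eta> * \<rho> ^ k \<le> 1 * \<rho> ^ k" using etaA rho by (intro mult_right_mono) (auto simp: mult.commute)
    hence "s k - fps_nth \<epsilon> k \<ge> \<theta> ^ k - n * \<rho> ^ k - \<rho> ^ k"
      using s[OF k1] db[OF k1] epsk[OF k1] by linarith
    moreover have "(n + 1) * \<rho> ^ k < \<rho>1 ^ k"
      using k0[OF True] rho1 n by (simp add: power_divide field_simps)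
    moreover have "\<rho>1 ^ k \<le> \<theta> ^ k" using rho1 th by (intro power_mono) auto
    ultimately show ?thesis by (simp add: algebra_simps)
  next
    case False
    have k1: "k \<ge> 1" using that L by simp
    have "c \<le> s k" using c(2)[of k] False that by simp
    moreover have "1 - real k * \<eta> \<le> \<theta> ^ k"
      using Bernoulli_inequality[of "-\<eta>" k] eta1 by (simp add: \<theta>_def)
    moreover have "real k * \<eta> \<le> real k0 * \<eta>" using False eta by (intro mult_right_mono) auto
    moreover have "A * \<eta> * \<rho> ^ k \<le> A * \<eta> * 1" using A2 eta rho by (intro mult_left_mono power_le_one) auto
    ultimately show ?thesis using db[OF k1] epsk[OF k1] etac by (simp add: algebra_simps)
  qed
  show ?thesis
    using eta(1) eta1 eps 1 2 3 by (intro exI[of _ \<eta>] exI[of _ \<epsilon>]) (auto simp: \<theta>_def)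
qed

section \<open>Geometric domination\<close>

text \<open>By the renewal equation, \<open>h k * R ^ k\<close> is a convex combination of its predecessors, so a positive
  lower bound on one window persists.\<close>
lemma renewal_bounds:
  fixes p :: "real poly"
  assumes p0: "\<And>k. 0 \<le> coeff p k" and pL: "\<And>k. k < L \<Longrightarrow> coeff p k = 0"
    and pK: "\<And>k. k \<in> {L..K} \<Longrightarrow> 0 < coeff p k" and deg: "degree p \<le> K"
    and L: "L \<ge> 1" and K: "2 * L \<le> K" and R: "R > 0" and pR: "poly p R = 1"
  defines "h \<equiv> inverse (1 - fps_of_poly p)"
  shows "\<exists>y>0. \<forall>k. 0 \<le> fps_nth h k \<and> fps_nth h k * R ^ k \<le> 1 \<and> (L \<le> k \<longrightarrow> y \<le> fps_nth h k * R ^ k)"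
proof -
  have p00: "coeff p 0 = 0" using pL L by simp
  have "h * (1 - fps_of_poly p) = 1"
    unfolding h_def by (rule inverse_mult_eq_1) (simp add: p00)
  hence "h - fps_of_poly p * h = 1" by (simp add: algebra_simps)
  hence "fps_nth (h - fps_of_poly p * h) k = fps_nth 1 k" for k by (rule arg_cong)
  hence rec0: "fps_nth h k = fps_nth 1 k + (\<Sum>i=0..k. coeff p i * fps_nth h (k - i))" for k
    unfolding fps_sub_nth fps_mult_nth fps_of_poly_nth diff_eq_eq by blast
  have h0: "fps_nth h 0 = 1" using p00 by (simp add: h_def)
  have rec: "fps_nth h k = (\<Sum>i=1..k. coeff p i * fps_nth h (k - i))" if "k \<ge> 1" for k
    unfolding rec0[of k] using that p00 by (simp add: sum.atLeast_Suc_atMost)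
  have pR': "(\<Sum>i=1..K. coeff p i * R ^ i) = 1"
  proof -
    have "poly p R = (\<Sum>i\<le>K. coeff p i * R ^ i)"
      unfolding poly_altdef by (rule sum.mono_neutral_left) (use deg in \<open>auto intro: coeff_eq_0\<close>)
    also have "\<dots> = (\<Sum>i=1..K. coeff p i * R ^ i)"
      by (rule sum.mono_neutral_right) (use p00 in \<open>auto simp: not_less_eq_eq\<close>)
    finally show ?thesis using pR by simp
  qed
  have nn: "0 \<le> fps_nth h k" for k
  proof (induction k rule: less_induct)
    case (less k)
    show ?case using h0 rec[of k] less p0 by (cases "k = 0") (auto intro!: sum_nonneg mult_nonneg_nonneg)
  qed
  have rec': "fps_nth h k * R ^ k = (\<Sum>i=1..k. (coeff p i * R ^ i) * (fps_nth h (k - i) * R ^ (k - i)))" if "k \<ge> 1" for k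
    unfolding rec[OF that] sum_distrib_right
    by (rule sum.cong) (auto simp: power_add[symmetric])
  have le1: "fps_nth h k * R ^ k \<le> 1" for k
  proof (induction k rule: less_induct)
    case (less k)
    show ?case
    proof (cases "k = 0")
      case False
      hence "fps_nth h k * R ^ k = (\<Sum>i=1..k. (coeff p i * R ^ i) * (fps_nth h (k - i) * R ^ (k - i)))"
        using rec' by simp
      also have "\<dots> \<le> (\<Sum>i=1..k. (coeff p i * R ^ i) * 1)"
        by (intro sum_mono mult_left_mono) (use less False R p0 in auto)
      also have "\<dots> \<le> (\<Sum>i\<in>{1..k} \<union> {1..K}. (coeff p i * R ^ i) * 1)"
        by (rule sum_mono2) (use R p0 in auto)
      also have "\<dots> = (\<Sum>i=1..K. coeff p i * R ^ i)"
        by (rule sum.mono_neutral_cong_right) (use deg in \<open>auto intro: coeff_eq_0\<close>)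
      finally show ?thesis using pR' by simp
    qed (use h0 in simp)
  qed
  \<comment> \<open>One positive summand of the renewal sum suffices: \<open>p_k h_0\<close> while
    \<open>k \<le> K\<close>, and \<open>p_L h_(k-L)\<close> afterwards, where
    \<open>K \<ge> 2 L\<close> ensures \<open>k - L \<ge> L\<close>.\<close>
  have pos: "fps_nth h k > 0" if "k \<ge> L" for k
    using that
  proof (induction k rule: less_induct)
    case (less k)
    have k1: "k \<ge> 1" using less.prems L by simp
    have ex: "fps_nth h k > 0" if "i \<in> {1..k}" "coeff p i * fps_nth h (k - i) > 0" for i
    proof -
      have "coeff p i * fps_nth h (k - i) \<le> (\<Sum>i=1..k. coeff p i * fps_nth h (k - i))"
        using that by (intro member_le_sum) (auto simp: nn p0)
      thus ?thesis using rec[OF k1] that by simp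
    qed
    show ?case
    proof (cases "k \<le> K")
      case True
      show ?thesis by (rule ex[of k]) (use k1 pK True less.prems h0 in auto)
    next
      case False
      show ?thesis by (rule ex[of L]) (use less.IH[of "k - L"] k1 L K False pK[of L] in auto)
    qed
  qed
  \<comment> \<open>Beyond this window all \<open>K\<close> predecessors used by the recursion have
    index at least \<open>L\<close>, so the induction hypothesis applies to each of them.\<close>
  define y where "y = Min ((\<lambda>k. fps_nth h k * R ^ k) ` {L..L+K})"
  have y0: "y > 0" unfolding y_def using pos R by (subst Min_gr_iff) auto
  have "y \<le> fps_nth h k * R ^ k" if "k \<ge> L" for k
    using that
  proof (induction k rule: less_induct)
    case (less k)
    show ?case
    proof (cases "k \<le> L + K")
      case True
      thus ?thesis unfolding y_def using less.prems by (intro Min_le) auto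
    next
      case False
      have "y = (\<Sum>i=1..K. (coeff p i * R ^ i) * y)" unfolding sum_distrib_right[symmetric] pR' by simp
      also have "\<dots> \<le> (\<Sum>i=1..K. (coeff p i * R ^ i) * (fps_nth h (k - i) * R ^ (k - i)))"
        by (intro sum_mono mult_left_mono less.IH) (use False R p0 in auto)
      also have "\<dots> \<le> (\<Sum>i=1..k. (coeff p i * R ^ i) * (fps_nth h (k - i) * R ^ (k - i)))"
        by (rule sum_mono2) (use False R p0 nn in auto)
      also have "\<dots> = fps_nth h k * R ^ k" using rec'[of k] False by simp
      finally show ?thesis .
    qed
  qed
  thus ?thesis using y0 nn le1 by blast
qed

text \<open>Since \<open>R (1 - \<eta>) = 1 - \<eta> / 4\<close>, the full series has the value
  \<open>4 R^L > 4\<close> at \<open>R\<close>. A long truncation still has a value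
  \<open>S \<ge> 2\<close>, and dividing it by \<open>S\<close> gives value 1 at \<open>R\<close>
  and leaves at most half of each coefficient.\<close>

lemma dominated_poly_exists:
  fixes \<eta> :: real
  assumes eta: "0 < \<eta>" "\<eta> < 1" and L: "L \<ge> 1"
  defines "R \<equiv> (1 - \<eta> / 4) / (1 - \<eta>)"
  shows "R > 1 \<and> R * (1 - \<eta>) < 1 \<and>
    (\<exists>p K. 2 * L \<le> K \<and> degree p \<le> K \<and> (\<forall>k. 0 \<le> coeff p k) \<and> (\<forall>k<L. coeff p k = 0) \<and>
       (\<forall>k\<in>{L..K}. 0 < coeff p k) \<and> (\<forall>k. 2 * coeff p k \<le> fps_nth (geo_tail \<eta> L) k) \<and> poly p R = 1)"
proof -
  have R: "R > 1" "R * (1 - \<eta>) = 1 - \<eta> / 4" using eta by (auto simp: R_def field_simps)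
  define x where "x = 1 - \<eta> / 4"
  have x: "0 < x" "x < 1" using eta by (auto simp: x_def)
  have "(\<lambda>k. x ^ k) \<longlonglongrightarrow> 0" using x by (intro LIMSEQ_realpow_zero) auto
  hence "eventually (\<lambda>k. x ^ k < 1 / 2) sequentially" by (intro order_tendstoD) auto
  then obtain M0 where M0: "\<And>k. k \<ge> M0 \<Longrightarrow> x ^ k < 1 / 2" by (auto simp: eventually_sequentially)
  \<comment> \<open>\<open>M0\<close> keeps more than half of the geometric sum in the truncation,
    and \<open>L + 1\<close> gives \<open>K \<ge> 2 L\<close>, as required by
    \<open>renewal_bounds\<close>.\<close>
  define M where "M = max M0 (L + 1)"
  define K where "K = L + M - 1"
  have K: "2 * L \<le> K" by (auto simp: K_def M_def)
  define r where "r = (\<lambda>k. fps_nth (geo_tail \<eta> L) k)"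
  have r0: "r k \<ge> 0" "k \<ge> L \<Longrightarrow> r k > 0" "k < L \<Longrightarrow> r k = 0" for k
    using eta by (auto simp: r_def geo_tail_def)
  define S where "S = (\<Sum>k=L..K. r k * R ^ k)"
  have "S = (\<Sum>i<M. r (i + L) * R ^ (i + L))"
    unfolding S_def
    by (rule sum.reindex_bij_witness[of _ "\<lambda>i. i + L" "\<lambda>i. i - L"]) (auto simp: K_def M_def)
  also have "\<dots> = (\<Sum>i<M. \<eta> * R ^ L * x ^ i)"
    by (intro sum.cong refl)
       (simp add: r_def geo_tail_def power_add power_mult_distrib R(2)[folded x_def, symmetric] mult_ac)
  also have "\<dots> = \<eta> * R ^ L * ((1 - x ^ M) / (1 - x))"
    using x by (simp add: sum_distrib_left[symmetric] sum_gp_strict)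
  also have "\<dots> = 4 * (R ^ L * (1 - x ^ M))" using eta by (simp add: x_def field_simps)
  also have "\<dots> \<ge> 4 * (1 * (1 / 2))"
    using M0[of M] R by (intro mult_left_mono mult_mono one_le_power) (auto simp: M_def)
  finally have S: "S \<ge> 2" by simp
  define p where "p = (\<Sum>k=L..K. monom (r k / S) k)"
  have cp: "coeff p k = (if k \<in> {L..K} then r k / S else 0)" for k
    by (simp add: p_def coeff_sum)
  have "poly p R = 1"
    using S unfolding p_def poly_sum poly_monom S_def by (simp add: sum_divide_distrib[symmetric])
  moreover have "degree p \<le> K" unfolding p_def
    by (rule degree_sum_le) (auto intro: order_trans[OF degree_monom_le])
  moreover have "2 * coeff p k \<le> r k" for k
  proof (cases "k \<in> {L..K}")
    case True
    have "2 * (r k / S) = r k * (2 / S)" by simp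
    also have "\<dots> \<le> r k * 1" using S r0 by (intro mult_left_mono) auto
    finally show ?thesis using True cp by simp
  next
    case False
    thus ?thesis unfolding cp using r0(1)[of k] by (simp only: if_False)
  qed
  ultimately show ?thesis
    using R x K cp r0 S unfolding x_def[symmetric] r_def
    by (intro conjI exI[of _ p] exI[of _ K]) auto
qed

section \<open>Products of factors \<open>1 - c X^j\<close> with prescribed moments\<close>

definition monom_prod :: "(real \<times> nat) list \<Rightarrow> real poly" where
  "monom_prod qs = (\<Prod>(c, j)\<leftarrow>qs. 1 - monom c j)"

lemma monom_prod_simps [simp]:
  "monom_prod [] = 1"
  "monom_prod ((c, j) # qs) = (1 - monom c j) * monom_prod qs"
  "monom_prod (qs @ qs') = monom_prod qs * monom_prod qs'"
  by (simp_all add: monom_prod_def)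

lemma has_moments_replicate:
  assumes "j \<ge> 1"
  shows "has_moments (fps_of_poly (monom_prod (replicate N (c, j))))
           (Abs_fps (\<lambda>k. if k > 0 \<and> j dvd k then real N * (real j * c ^ (k div j)) else 0))"
proof (induction N)
  case 0
  have "Abs_fps (\<lambda>k. if k > 0 \<and> j dvd k then real 0 * (real j * c ^ (k div j)) else 0) = (0 :: real fps)"
    by (rule fps_ext) simp
  thus ?case by (simp only: replicate_0 monom_prod_simps fps_of_poly_1 has_moments_one)
next
  case (Suc N)
  have *: "fps_of_poly (1 - monom c j) = 1 - fps_const c * fps_X ^ j"
    by (simp add: fps_of_poly_diff fps_of_poly_monom)
  have "has_moments (fps_of_poly (monom_prod (replicate (Suc N) (c, j))))
     (Abs_fps (\<lambda>k. if k > 0 \<and> j dvd k then real j * c ^ (k div j) else 0)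
      + Abs_fps (\<lambda>k. if k > 0 \<and> j dvd k then real N * (real j * c ^ (k div j)) else 0))"
    unfolding replicate_Suc monom_prod_simps fps_of_poly_mult *
    by (rule has_moments_mult[OF has_moments_one_minus_monom[OF assms] Suc])
  also have "Abs_fps (\<lambda>k. if k > 0 \<and> j dvd k then real j * c ^ (k div j) else 0)
      + Abs_fps (\<lambda>k. if k > 0 \<and> j dvd k then real N * (real j * c ^ (k div j)) else 0)
    = Abs_fps (\<lambda>k. if k > 0 \<and> j dvd k then real (Suc N) * (real j * c ^ (k div j)) else 0)"
    by (rule fps_ext) (simp add: algebra_simps)
  finally show ?case .
qed

text \<open>\<open>N\<close> equal factors have moment \<open>N j c\<close> at \<open>j\<close> and
  \<open>N j c^i\<close> at \<open>i j\<close>. With \<open>N j c = \<omega>\<close> fixed, a large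
  \<open>N\<close> makes \<open>c\<close> small, and all moments beyond \<open>j\<close> become as
  small as desired.\<close>

lemma monom_prod_with_moments_step:
  fixes \<omega> \<epsilon> \<theta> c0 :: real
  assumes j: "j \<ge> 1" and w: "\<omega> > 0" and e: "0 < \<epsilon>" "\<epsilon> \<le> 1" and th: "0 < \<theta>" "\<theta> < 1" and c0: "c0 > 0"
  shows "\<exists>N c a. 0 < c \<and> c \<le> c0 \<and> has_moments (fps_of_poly (monom_prod (replicate N (c, j)))) a \<and>
     fps_nth a j = \<omega> \<and> (\<forall>k. 0 \<le> fps_nth a k) \<and> (\<forall>k. \<not> j dvd k \<longrightarrow> fps_nth a k = 0) \<and>
     (\<forall>k>j. fps_nth a k \<le> \<epsilon> * \<theta> ^ k) \<and> (\<forall>k<j. fps_nth a k = 0)"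
proof -
  \<comment> \<open>The second bound yields both
    \<open>\<omega> c \<le> \<epsilon> \<theta>^(2 j)\<close> and \<open>c \<le> \<theta>^j\<close>;
    together they bound the moment \<open>\<omega> c c^i'\<close> at
    \<open>j (i' + 2)\<close>.\<close>
  define c1 where "c1 = min c0 (\<epsilon> * \<theta> ^ (2 * j) / (1 + \<omega>))"
  have c1: "c1 > 0" "c1 \<le> c0" "c1 \<le> \<epsilon> * \<theta> ^ (2 * j) / (1 + \<omega>)" unfolding c1_def using assms by auto
  obtain N0 :: nat where N0: "\<omega> / (real j * c1) \<le> real N0" using real_arch_simple by blast
  define N where "N = Suc N0"
  define c where "c = \<omega> / (real N * real j)"
  have cpos: "c > 0" using w j by (simp add: c_def N_def)
  have "\<omega> / (real j * c1) \<le> real N" using N0 by (simp add: N_def)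
  hence "\<omega> \<le> real N * (real j * c1)" using c1 j by (subst (asm) pos_divide_le_eq) auto
  hence cc1: "c \<le> c1" unfolding c_def using j by (subst pos_divide_le_eq) (auto simp: N_def mult_ac)
  have Nc: "real N * (real j * c) = \<omega>" using j by (simp add: c_def N_def del: of_nat_Suc)
  define a where "a = Abs_fps (\<lambda>k. if k > 0 \<and> j dvd k then real N * (real j * c ^ (k div j)) else 0)"
  have a: "has_moments (fps_of_poly (monom_prod (replicate N (c, j)))) a"
    unfolding a_def by (rule has_moments_replicate[OF j])
  have wc: "\<omega> * c \<le> \<epsilon> * \<theta> ^ (2 * j)"
  proof -
    have "\<omega> * c \<le> (1 + \<omega>) * c" using cpos by simp
    also have "\<dots> \<le> (1 + \<omega>) * (\<epsilon> * \<theta> ^ (2 * j) / (1 + \<omega>))" using c1 cc1 w by (intro mult_left_mono) auto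
    finally show ?thesis using w by simp
  qed
  have cth: "c \<le> \<theta> ^ j"
  proof -
    have "c \<le> \<epsilon> * \<theta> ^ (2 * j) / (1 + \<omega>)" using c1 cc1 by simp
    also have "\<dots> \<le> \<epsilon> * \<theta> ^ (2 * j) / 1" using w e th by (intro divide_left_mono) auto
    also have "\<dots> \<le> 1 * \<theta> ^ (2 * j)" using e th by simp
    also have "\<dots> \<le> \<theta> ^ j" using th by (simp add: power_decreasing)
    finally show ?thesis .
  qed
  have big: "fps_nth a k \<le> \<epsilon> * \<theta> ^ k" if k: "k > j" for k
  proof (cases "j dvd k")
    case True
    then obtain i where i: "k = j * i" by (elim dvdE)
    with k have "j * 1 < j * i" by simp
    hence "i > 1" by (simp only: mult_less_cancel1)
    then obtain i' where i': "i = i' + 2" by (metis less_iff_succ_less_eq le_add_diff_inverse2 one_add_one)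
    have "fps_nth a k = (real N * (real j * c)) * c * c ^ i'"
      using j k True i by (simp add: a_def i')
    also have "\<dots> \<le> (\<epsilon> * \<theta> ^ (2 * j)) * (\<theta> ^ j) ^ i'"
      unfolding Nc
      by (rule mult_mono[OF wc power_mono[OF cth]]) (use cpos e th in auto)
    also have "\<dots> = \<epsilon> * \<theta> ^ (2 * j + j * i')" by (simp add: power_mult[symmetric] power_add)
    also have "2 * j + j * i' = k" by (simp add: i i')
    finally show ?thesis .
  qed (use e th in \<open>simp add: a_def\<close>)
  show ?thesis
    using cpos cc1 c1(2) a big Nc j
    by (intro exI[of _ N] exI[of _ c] exI[of _ a]) (auto simp: a_def dest: dvd_imp_le)
qed

text \<open>The moments are corrected greedily from degree 1 to \<open>D\<close>. Earlier factors
  contribute less than the smallest positive prescribed value, so a positive deficit remains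
  wherever \<open>\<sigma> j > 0\<close>; where \<open>\<sigma> k = 0\<close>, closure under
  multiples excludes every factor whose degree divides \<open>k\<close>.\<close>

lemma monom_prod_with_moments:
  fixes \<sigma> :: "nat \<Rightarrow> real" and c0 :: "nat \<Rightarrow> real"
  assumes sig: "\<And>k. k \<in> {1..D} \<Longrightarrow> \<sigma> k \<ge> 0"
    and mult: "\<And>j k. 1 \<le> j \<Longrightarrow> j dvd k \<Longrightarrow> k \<in> {1..D} \<Longrightarrow> \<sigma> j > 0 \<Longrightarrow> \<sigma> k > 0"
    and th: "0 < \<theta>" "\<theta> < 1" and c0: "\<And>j. c0 j > 0"
  shows "\<exists>qs a. has_moments (fps_of_poly (monom_prod qs)) a \<and> (\<forall>(c, j)\<in>set qs. 0 < c \<and> c \<le> c0 j \<and> 1 \<le> j) \<and>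
     (\<forall>k\<in>{1..D}. fps_nth a k = \<sigma> k) \<and> (\<forall>k. 0 \<le> fps_nth a k) \<and> (\<forall>k>D. fps_nth a k \<le> \<theta> ^ k)"
proof -
  define m where "m = Min (insert 1 (\<sigma> ` {k\<in>{1..D}. \<sigma> k > 0}))"
  have m: "m > 0" "m \<le> 1" "\<And>k. k \<in> {1..D} \<Longrightarrow> \<sigma> k > 0 \<Longrightarrow> m \<le> \<sigma> k"
  proof -
    show "m > 0" unfolding m_def by (subst Min_gr_iff) auto
    show "m \<le> 1" unfolding m_def by (rule Min_le) auto
    show "m \<le> \<sigma> k" if "k \<in> {1..D}" "\<sigma> k > 0" for k unfolding m_def by (rule Min_le) (use that in auto)
  qed
  \<comment> \<open>Each stage spills at most \<open>\<epsilon> \<theta>^k\<close> into a higher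
    degree \<open>k\<close>, so all \<open>D\<close> stages together spill less than
    \<open>m\<close>.\<close>
  define \<epsilon> where "\<epsilon> = m / (real D + 1)"
  have e: "0 < \<epsilon>" "\<epsilon> \<le> 1" using m by (auto simp: \<epsilon>_def field_simps)
  have De: "real D * \<epsilon> < m" using m by (simp add: \<epsilon>_def field_simps)
  have "\<exists>qs a. has_moments (fps_of_poly (monom_prod qs)) a \<and> (\<forall>(c, j)\<in>set qs. 0 < c \<and> c \<le> c0 j \<and> 1 \<le> j) \<and>
     (\<forall>k\<in>{1..d}. fps_nth a k = \<sigma> k) \<and> (\<forall>k. 0 \<le> fps_nth a k) \<and> (\<forall>k>d. fps_nth a k \<le> real d * \<epsilon> * \<theta> ^ k) \<and>
     (\<forall>k\<in>{1..D}. \<sigma> k = 0 \<longrightarrow> fps_nth a k = 0)" if "d \<le> D" for d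
    using that
  proof (induction d)
    case 0
    show ?case by (intro exI[of _ "[]"] exI[of _ "0 :: real fps"]) (auto simp: has_moments_one)
  next
    case (Suc d)
    then obtain qs a where IH: "has_moments (fps_of_poly (monom_prod qs)) a"
      "\<forall>(c, j)\<in>set qs. 0 < c \<and> c \<le> c0 j \<and> 1 \<le> j" "\<forall>k\<in>{1..d}. fps_nth a k = \<sigma> k" "\<forall>k. 0 \<le> fps_nth a k"
      "\<forall>k>d. fps_nth a k \<le> real d * \<epsilon> * \<theta> ^ k" "\<forall>k\<in>{1..D}. \<sigma> k = 0 \<longrightarrow> fps_nth a k = 0" by auto
    have j: "Suc d \<in> {1..D}" using Suc.prems by auto
    have mono: "real d * \<epsilon> * \<theta> ^ k \<le> real (Suc d) * \<epsilon> * \<theta> ^ k" for k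
      using e th by (intro mult_right_mono) auto
    show ?case
    proof (cases "\<sigma> (Suc d) = 0")
      case True
      hence "\<forall>k\<in>{1..Suc d}. fps_nth a k = \<sigma> k" using IH(3,6) j by (auto simp: le_Suc_eq)
      moreover have "\<forall>k>Suc d. fps_nth a k \<le> real (Suc d) * \<epsilon> * \<theta> ^ k"
        using IH(5) mono by (meson Suc_lessD order_trans)
      ultimately show ?thesis using IH by blast
    next
      case False
      define \<omega> where "\<omega> = \<sigma> (Suc d) - fps_nth a (Suc d)"
      have pos: "\<sigma> (Suc d) > 0" using False sig[OF j] by simp
      have "fps_nth a (Suc d) \<le> real d * \<epsilon> * \<theta> ^ Suc d" using IH(5) by blast
      also have "\<dots> \<le> real D * \<epsilon> * 1" using Suc.prems e th by (intro mult_mono power_le_one) auto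
      also have "\<dots> < \<sigma> (Suc d)" using De m(3)[OF j pos] by simp
      finally have w: "\<omega> > 0" by (simp add: \<omega>_def)
      obtain N c b where b: "0 < c" "c \<le> c0 (Suc d)"
        "has_moments (fps_of_poly (monom_prod (replicate N (c, Suc d)))) b"
        "fps_nth b (Suc d) = \<omega>" "\<forall>k. 0 \<le> fps_nth b k" "\<forall>k. \<not> Suc d dvd k \<longrightarrow> fps_nth b k = 0"
        "\<forall>k>Suc d. fps_nth b k \<le> \<epsilon> * \<theta> ^ k" "\<forall>k<Suc d. fps_nth b k = 0"
        using monom_prod_with_moments_step[of "Suc d" \<omega> \<epsilon> \<theta> "c0 (Suc d)"] w e th c0 by auto
      have "has_moments (fps_of_poly (monom_prod (qs @ replicate N (c, Suc d)))) (a + b)"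
        unfolding monom_prod_simps fps_of_poly_mult by (rule has_moments_mult[OF IH(1) b(3)])
      moreover have "\<forall>(c, j)\<in>set (qs @ replicate N (c, Suc d)). 0 < c \<and> c \<le> c0 j \<and> 1 \<le> j"
        using IH(2) b(1,2) by auto
      moreover have "\<forall>k\<in>{1..Suc d}. fps_nth (a + b) k = \<sigma> k"
        using IH(3) b(4,8) by (auto simp: le_Suc_eq \<omega>_def)
      moreover have "\<forall>k. 0 \<le> fps_nth (a + b) k" using IH(4) b(5) by simp
      moreover have "\<forall>k>Suc d. fps_nth (a + b) k \<le> real (Suc d) * \<epsilon> * \<theta> ^ k"
      proof (intro allI impI)
        fix k assume k: "k > Suc d"
        have "fps_nth a k \<le> real d * \<epsilon> * \<theta> ^ k" using IH(5) k by simp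
        moreover have "fps_nth b k \<le> \<epsilon> * \<theta> ^ k" using b(7) k by simp
        ultimately show "fps_nth (a + b) k \<le> real (Suc d) * \<epsilon> * \<theta> ^ k" by (simp add: algebra_simps)
      qed
      moreover have "\<forall>k\<in>{1..D}. \<sigma> k = 0 \<longrightarrow> fps_nth (a + b) k = 0"
      proof (intro ballI impI)
        fix k assume k: "k \<in> {1..D}" "\<sigma> k = 0"
        hence "\<not> Suc d dvd k" using mult[of "Suc d" k] pos by auto
        thus "fps_nth (a + b) k = 0" using IH(6) b(6) k by simp
      qed
      ultimately show ?thesis by blast
    qed
  qed
  from this[of D] obtain qs a where *: "has_moments (fps_of_poly (monom_prod qs)) a"
      "\<forall>(c, j)\<in>set qs. 0 < c \<and> c \<le> c0 j \<and> 1 \<le> j" "\<forall>k\<in>{1..D}. fps_nth a k = \<sigma> k" "\<forall>k. 0 \<le> fps_nth a k"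
      "\<forall>k>D. fps_nth a k \<le> real D * \<epsilon> * \<theta> ^ k" by auto
  have "fps_nth a k \<le> \<theta> ^ k" if "k > D" for k
  proof -
    have "fps_nth a k \<le> real D * \<epsilon> * \<theta> ^ k" using * that by blast
    also have "\<dots> \<le> 1 * \<theta> ^ k" using De m th by (intro mult_right_mono) auto
    finally show ?thesis by simp
  qed
  with * show ?thesis by blast
qed

section \<open>Network fractions\<close>

definition X_poly :: "real poly" where
  "X_poly = monom 1 1"

lemma coeff_X_poly_mult: "coeff (X_poly * f) k = (if k = 0 then 0 else coeff f (k - 1))"
  unfolding X_poly_def coeff_monom_mult by simp

lemma coeff_X_poly_power_mult: "coeff (X_poly ^ m * f) k = (if k < m then 0 else coeff f (k - m))"
  by (simp add: X_poly_def monom_power coeff_monom_mult)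

lemma poly_X_poly [simp]: "poly X_poly t = t"
  by (simp add: X_poly_def poly_monom)

definition nonneg_poly :: "real poly \<Rightarrow> bool" where
  "nonneg_poly f \<longleftrightarrow> (\<forall>k. 0 \<le> coeff f k)"

lemma nonneg_poly_0 [simp]: "nonneg_poly 0"
  and nonneg_poly_1 [simp]: "nonneg_poly 1"
  and nonneg_poly_monom [simp]: "nonneg_poly (monom c k) \<longleftrightarrow> 0 \<le> c"
  and nonneg_poly_X [simp]: "nonneg_poly X_poly"
  by (auto simp: nonneg_poly_def X_poly_def)

lemma nonneg_poly_add [intro]: "nonneg_poly f \<Longrightarrow> nonneg_poly g \<Longrightarrow> nonneg_poly (f + g)"
  by (simp add: nonneg_poly_def)

lemma nonneg_poly_mult [intro]: "nonneg_poly f \<Longrightarrow> nonneg_poly g \<Longrightarrow> nonneg_poly (f * g)"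
  by (auto simp: nonneg_poly_def coeff_mult intro!: sum_nonneg)

lemma nonneg_poly_power [intro]: "nonneg_poly f \<Longrightarrow> nonneg_poly (f ^ n)"
  by (induction n) auto

lemma nonneg_poly_sum [intro]: "(\<And>i. i \<in> A \<Longrightarrow> nonneg_poly (f i)) \<Longrightarrow> nonneg_poly (sum f A)"
  by (auto simp: nonneg_poly_def coeff_sum intro!: sum_nonneg)

lemma nonneg_poly_2 [simp]: "nonneg_poly 2"
  using nonneg_poly_add[OF nonneg_poly_1 nonneg_poly_1] by simp

lemma nonneg_poly_power_diff:
  assumes "nonneg_poly g" "nonneg_poly (f - g)"
  shows "nonneg_poly (f ^ n - g ^ n)"
proof (induction n)
  case (Suc n)
  have "nonneg_poly (g + (f - g))" using assms by (intro nonneg_poly_add)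
  hence f: "nonneg_poly f" by simp
  have "f ^ Suc n - g ^ Suc n = f * (f ^ n - g ^ n) + (f - g) * g ^ n" by (simp add: algebra_simps)
  thus ?case using Suc assms f by (auto simp del: power_Suc)
qed simp

text \<open>\<open>cone p qs w \<nu>\<close> expresses that \<open>\<nu> / ((1 - p) \<Prod>(1 - q))\<close>, with \<open>q\<close> ranging over the monomials
  \<open>c X^j\<close> listed in \<open>qs\<close>, has the form \<open>h + X u / (1 - p) + X / (1 - q) * (\<dots>)\<close> with the same
  form inside the parentheses for the tail of \<open>qs\<close>. The innermost \<open>u\<close> is \<open>w\<close>; it is recorded because
  \<open>w \<noteq> 0\<close> makes every vertex of the network below reachable.\<close>
fun cone :: "real poly \<Rightarrow> (real \<times> nat) list \<Rightarrow> real poly \<Rightarrow> real poly \<Rightarrow> bool" where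
  "cone p [] w \<nu> \<longleftrightarrow> (\<exists>h. nonneg_poly h \<and> coeff h 0 = 0 \<and> nonneg_poly w \<and> coeff w 0 = 0 \<and> \<nu> = (1 - p) * h + X_poly * w)"
| "cone p (q # qs) w \<nu> \<longleftrightarrow> (\<exists>h u \<nu>'. nonneg_poly h \<and> coeff h 0 = 0 \<and> nonneg_poly u \<and> coeff u 0 = 0 \<and> cone p qs w \<nu>' \<and>
     \<nu> = ((1 - p) * h + X_poly * u) * monom_prod (q # qs) + X_poly * \<nu>')"

lemma cone_ConsI:
  assumes "nonneg_poly h" "coeff h 0 = 0" "nonneg_poly u" "coeff u 0 = 0" "cone p qs w \<nu>'"
    and "\<nu> = ((1 - p) * h + X_poly * u) * monom_prod (q # qs) + X_poly * \<nu>'"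
  shows "cone p (q # qs) w \<nu>"
  using assms unfolding cone.simps by blast

lemma cone_add:
  "cone p qs w \<nu> \<Longrightarrow> cone p qs w' \<nu>' \<Longrightarrow> cone p qs (w + w') (\<nu> + \<nu>')"
proof (induction qs arbitrary: \<nu> \<nu>')
  case Nil
  then obtain h h' where "nonneg_poly h" "coeff h 0 = 0" "\<nu> = (1 - p) * h + X_poly * w"
    "nonneg_poly h'" "coeff h' 0 = 0" "\<nu>' = (1 - p) * h' + X_poly * w'" by auto
  moreover from this have "\<nu> + \<nu>' = (1 - p) * (h + h') + X_poly * (w + w')" by (simp add: algebra_simps)
  ultimately show ?case using Nil by (auto intro!: exI[of _ "h + h'"] simp del: right_diff_distrib)
next
  case (Cons q qs)
  then obtain h u \<mu> h' u' \<mu>' where *: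
    "nonneg_poly h" "coeff h 0 = 0" "nonneg_poly u" "coeff u 0 = 0" "cone p qs w \<mu>"
    "\<nu> = ((1 - p) * h + X_poly * u) * monom_prod (q # qs) + X_poly * \<mu>"
    "nonneg_poly h'" "coeff h' 0 = 0" "nonneg_poly u'" "coeff u' 0 = 0" "cone p qs w' \<mu>'"
    "\<nu>' = ((1 - p) * h' + X_poly * u') * monom_prod (q # qs) + X_poly * \<mu>'" by auto
  have "\<nu> + \<nu>' = ((1 - p) * (h + h') + X_poly * (u + u')) * monom_prod (q # qs) + X_poly * (\<mu> + \<mu>')"
    unfolding *(6,12) by (simp add: algebra_simps)
  moreover have "cone p qs (w + w') (\<mu> + \<mu>')" using Cons.IH * by blast
  ultimately show ?case using * by (intro cone_ConsI[of "h + h'" "u + u'"]) auto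
qed

lemma cone_mult:
  assumes g: "nonneg_poly g"
  shows "cone p qs w \<nu> \<Longrightarrow> cone p qs (g * w) (g * \<nu>)"
proof (induction qs arbitrary: \<nu>)
  case Nil
  then obtain h where h: "nonneg_poly h" "coeff h 0 = 0" "\<nu> = (1 - p) * h + X_poly * w" by auto
  have "g * \<nu> = (1 - p) * (g * h) + X_poly * (g * w)" unfolding h(3) by (simp add: algebra_simps)
  with h show ?case using Nil g by (auto intro!: exI[of _ "g * h"] simp: coeff_mult_0)
next
  case (Cons q qs)
  then obtain h u \<mu> where *:
    "nonneg_poly h" "coeff h 0 = 0" "nonneg_poly u" "coeff u 0 = 0" "cone p qs w \<mu>"
    "\<nu> = ((1 - p) * h + X_poly * u) * monom_prod (q # qs) + X_poly * \<mu>" by auto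
  have "g * \<nu> = ((1 - p) * (g * h) + X_poly * (g * u)) * monom_prod (q # qs) + X_poly * (g * \<mu>)"
    unfolding *(6) by (simp add: algebra_simps)
  moreover have "cone p qs (g * w) (g * \<mu>)" using Cons.IH * by blast
  moreover have "nonneg_poly (g * h)" "coeff (g * h) 0 = 0" "nonneg_poly (g * u)" "coeff (g * u) 0 = 0"
    using g * by (auto simp: coeff_mult_0)
  ultimately show ?case unfolding cone.simps by blast
qed

lemma cone_zero: "cone p qs 0 0"
proof (induction qs)
  case Nil
  show ?case by (auto intro: exI[of _ 0])
next
  case (Cons q qs)
  thus ?case by (intro cone_ConsI[of 0 0]) auto
qed

text \<open>The fraction passes through every new factor as \<open>X / (1 - q)\<close> with
  \<open>h = u = 0\<close>, which multiplies its numerator by one \<open>X\<close> per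
  factor.\<close>

lemma cone_prepend: "cone p qs w \<nu> \<Longrightarrow> cone p (qs' @ qs) w (X_poly ^ length qs' * \<nu>)"
proof (induction qs')
  case (Cons q qs')
  thus ?case unfolding append_Cons by (intro cone_ConsI[of 0 0]) auto
qed simp

lemma cone_top:
  assumes "nonneg_poly h" "coeff h 0 = 0" "nonneg_poly u" "coeff u 0 = 0"
  shows "\<exists>w. cone p qs w (((1 - p) * h + X_poly * u) * monom_prod qs)"
proof (cases qs)
  case Nil
  thus ?thesis using assms by auto
next
  case (Cons q qs')
  show ?thesis unfolding Cons
    by (rule exI[of _ 0], rule cone_ConsI[OF assms cone_zero]) simp
qed

text \<open>Numerator and denominator are both multiplied by \<open>1 - q\<close>, so the fraction
  is the same; the former innermost \<open>w\<close> becomes the \<open>u\<close> of the new level,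
  whose tail is zero.\<close>

lemma cone_append_factor:
  "cone p qs w \<nu> \<Longrightarrow> cone p (qs @ [q]) 0 (\<nu> * monom_prod [q])"
proof (induction qs arbitrary: \<nu>)
  case Nil
  then obtain h where h: "nonneg_poly h" "coeff h 0 = 0" "\<nu> = (1 - p) * h + X_poly * w" by auto
  have "cone p [] 0 0" by (rule cone_zero)
  moreover have "nonneg_poly w" "coeff w 0 = 0" using Nil by auto
  moreover have "\<nu> * monom_prod [q] = ((1 - p) * h + X_poly * w) * monom_prod [q] + X_poly * 0"
    using h by simp
  ultimately show ?case unfolding append_Nil cone.simps(2) using h(1,2) by blast
next
  case (Cons q' qs)
  then obtain h u \<mu> where *:
    "nonneg_poly h" "coeff h 0 = 0" "nonneg_poly u" "coeff u 0 = 0" "cone p qs w \<mu>"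
    "\<nu> = ((1 - p) * h + X_poly * u) * monom_prod (q' # qs) + X_poly * \<mu>" by auto
  have IH: "cone p (qs @ [q]) 0 (\<mu> * monom_prod [q])" using Cons.IH * by blast
  have "monom_prod (q' # qs @ [q]) = monom_prod (q' # qs) * monom_prod [q]"
    using monom_prod_simps(3)[of "q' # qs" "[q]"] by simp
  hence "\<nu> * monom_prod [q] = ((1 - p) * h + X_poly * u) * monom_prod (q' # qs @ [q])
      + X_poly * (\<mu> * monom_prod [q])"
    unfolding *(6) by (simp only: distrib_right mult.assoc)
  with IH *(1-4) show ?case unfolding append_Cons cone.simps by blast
qed

text \<open>A small negative term \<open>- b / ((1 - p) \<Prod>(1 - q))\<close> is absorbed by \<open>b V / (1 - p)\<close>. One factor at a
  time: with \<open>P = p^j - 2 q^L \<ge> 0\<close> divide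
  \<open>- 1 = (1 + p + \<dots> + p^(j-1)) (1 - p) - 2 (1 - q^L) + P\<close> by \<open>(1 - p) (1 - q)\<close>; the only
  negative term left no longer contains \<open>1 - q\<close> in its denominator.\<close>
lemma cone_absorb:
  assumes p: "nonneg_poly p" and L: "L \<ge> 1"
    and qs: "\<And>c j. (c, j) \<in> set qs \<Longrightarrow> 0 < c \<and> 2 * c ^ L \<le> coeff p L ^ j"
  shows "\<exists>V. nonneg_poly V \<and> (\<forall>b. nonneg_poly b \<longrightarrow>
     (\<exists>w. cone p qs w (X_poly ^ (length qs + 2) * (b * V * monom_prod qs - b))))"
  using qs
proof (induction qs rule: rev_induct)
  case Nil
  show ?case by (rule exI[of _ 1]) (auto intro!: exI[of _ 0] simp: cone_zero simp del: cone.simps)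
next
  case (snoc a qs)
  obtain c j where a: "a = (c, j)" by (cases a)
  have c: "0 < c" "2 * c ^ L \<le> coeff p L ^ j" using snoc.prems[of c j] by (auto simp: a)
  obtain V where V: "nonneg_poly V" "\<And>b. nonneg_poly b \<Longrightarrow>
     \<exists>w. cone p qs w (X_poly ^ (length qs + 2) * (b * V * monom_prod qs - b))"
    using snoc.IH snoc.prems by (auto simp del: cone.simps)
  define q where "q = monom c j"
  define J where "J = (\<Sum>i<j. p ^ i)"
  define I where "I = (\<Sum>i<L. q ^ i)"
  define P where "P = p ^ j - 2 * q ^ L"
  have q: "nonneg_poly q" using c by (simp add: q_def)
  have J: "nonneg_poly J" "J * (1 - p) = 1 - p ^ j" using p
    unfolding J_def by (auto simp: one_diff_power_eq mult.commute)
  have I: "nonneg_poly I" "I * (1 - q) = 1 - q ^ L" using q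
    unfolding I_def by (auto simp: one_diff_power_eq mult.commute)
  \<comment> \<open>\<open>p^j\<close> dominates the power \<open>(p_L X^L)^j\<close> of one of its
    terms, and \<open>2 q^L\<close> is a monomial of the same degree \<open>L j\<close> with a
    coefficient that is no larger.\<close>
  have "nonneg_poly (p ^ j - monom (coeff p L) L ^ j)"
    using p by (intro nonneg_poly_power_diff) (auto simp: nonneg_poly_def)
  hence P: "nonneg_poly P"
  proof -
    assume *: "nonneg_poly (p ^ j - monom (coeff p L) L ^ j)"
    have "monom (coeff p L) L ^ j - 2 * q ^ L = monom (coeff p L ^ j - 2 * c ^ L) (L * j)"
      by (simp add: q_def monom_power mult.commute[of j L] numeral_poly smult_monom diff_monom)
    moreover have "P = (p ^ j - monom (coeff p L) L ^ j) + (monom (coeff p L) L ^ j - 2 * q ^ L)"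
      by (simp add: P_def)
    ultimately have "P = (p ^ j - monom (coeff p L) L ^ j) + monom (coeff p L ^ j - 2 * c ^ L) (L * j)" by metis
    also have "nonneg_poly \<dots>" using c * by (intro nonneg_poly_add) auto
    finally show ?thesis .
  qed
  have mp: "monom_prod [a] = 1 - q" by (simp add: a q_def)
  show ?case
  \<comment> \<open>Cancelling \<open>1 - q\<close> in \<open>- 2 b I (1 - q)\<close> leaves
    \<open>- b'\<close> with \<open>b' = 2 b I\<close> over the remaining factors; the induction
    hypothesis absorbs it at the price \<open>b' V\<close>.\<close>
  proof (rule exI[of _ "2 * I * V"], intro conjI allI impI)
    show "nonneg_poly (2 * I * V)" using I V by (intro nonneg_poly_mult nonneg_poly_2)
    fix b assume b: "nonneg_poly b"
    define b' where "b' = 2 * b * I"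
    have b': "nonneg_poly b'" unfolding b'_def using b I by (intro nonneg_poly_mult nonneg_poly_2)
    obtain w where w: "cone p qs w (X_poly ^ (length qs + 2) * (b' * V * monom_prod qs - b'))" using V b' by blast
    have 1: "cone p (qs @ [a]) 0 (X_poly * (X_poly ^ (length qs + 2) * (b' * V * monom_prod qs - b')) * (1 - q))"
      using cone_append_factor[OF cone_mult[OF nonneg_poly_X w], of a] by (simp add: mp)
    \<comment> \<open>The two powers of \<open>X\<close> beyond one per factor make
      \<open>X^2 b J\<close> and the innermost \<open>w = X b P\<close> vanish at 0.\<close>
    have "cone p [] (X_poly * (b * P)) ((1 - p) * (X_poly ^ 2 * b * J) + X_poly * (X_poly * (b * P)))"
      unfolding cone.simps using b J P by (intro exI[of _ "X_poly ^ 2 * b * J"] conjI nonneg_poly_mult nonneg_poly_power)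
         (simp_all add: coeff_X_poly_mult power2_eq_square mult.assoc)
    from cone_prepend[OF this, of "qs @ [a]"]
    have 2: "cone p (qs @ [a]) (X_poly * (b * P))
       (X_poly ^ length (qs @ [a]) * ((1 - p) * (X_poly ^ 2 * b * J) + X_poly * (X_poly * (b * P))))" by simp
    have "X_poly ^ (length (qs @ [a]) + 2) * (b * (2 * I * V) * monom_prod (qs @ [a]) - b)
      = X_poly * (X_poly ^ (length qs + 2) * (b' * V * monom_prod qs - b')) * (1 - q)
       + X_poly ^ length (qs @ [a]) * ((1 - p) * (X_poly ^ 2 * b * J) + X_poly * (X_poly * (b * P)))"
    proof -
      define Y where "Y = X_poly ^ length (qs @ [a])"
      have e1: "X_poly ^ (length (qs @ [a]) + 2) = Y * X_poly ^ 2"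
        unfolding Y_def by (rule power_add)
      have e2: "X_poly * (X_poly ^ (length qs + 2) * z) = Y * X_poly ^ 2 * z" for z
        unfolding Y_def by (simp add: power2_eq_square mult.assoc)
      have e3: "b * (2 * I * V) * monom_prod (qs @ [a]) - b
        = (b' * V * monom_prod qs - b') * (1 - q) + (1 - p) * (b * J) + b * P"
      proof -
        have "- b = b * (J * (1 - p)) - 2 * b * (I * (1 - q)) + b * P"
          unfolding J I P_def by (simp add: algebra_simps)
        thus ?thesis unfolding monom_prod_simps(3) mp b'_def by (simp add: algebra_simps)
      qed
      show ?thesis unfolding e1 e2 e3 Y_def[symmetric] by (simp add: algebra_simps power2_eq_square)
    qed
    with cone_add[OF 1 2] show "\<exists>w. cone p (qs @ [a]) w (X_poly ^ (length (qs @ [a]) + 2) * (b * (2 * I * V) * monom_prod (qs @ [a]) - b))"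
      by metis
  qed
qed

text \<open>Take for \<open>h\<close> the expansion of \<open>N / (1 - p)\<close>, cut off beyond
  the degree of \<open>N\<close>. Then \<open>N - (1 - p) h\<close> has no low terms, and its higher
  coefficients are those of \<open>p h\<close>, hence nonnegative.\<close>

lemma nonneg_quotient_decomp:
  fixes p N :: "real poly"
  assumes p: "nonneg_poly p" and p0: "coeff p 0 = 0" and N0: "coeff N 0 = 0"
    and G: "\<And>k. 0 \<le> fps_nth (fps_of_poly N * inverse (1 - fps_of_poly p)) k"
  shows "\<exists>h u. nonneg_poly h \<and> coeff h 0 = 0 \<and> nonneg_poly u \<and> coeff u 0 = 0 \<and> N = (1 - p) * h + X_poly * u"
proof -
  let ?h = "inverse (1 - fps_of_poly p)"
  define g where "g = fps_of_poly N * ?h"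
  \<comment> \<open>The extra 1 leaves at least two factors \<open>X\<close> in the remainder, one
    for the explicit \<open>X\<close> and one for the zero constant term of
    \<open>u\<close>.\<close>
  define M where "M = degree N + 1"
  define h where "h = (\<Sum>k\<le>M. monom (fps_nth g k) k)"
  have ch: "coeff h k = (if k \<le> M then fps_nth g k else 0)" for k by (simp add: h_def coeff_sum)
  have "?h * (1 - fps_of_poly p) = 1" by (rule inverse_mult_eq_1) (simp add: p0)
  hence gN: "g * (1 - fps_of_poly p) = fps_of_poly N" by (simp add: g_def mult.assoc)
  have Nk: "coeff N k = fps_nth g k - (\<Sum>i=0..k. coeff p i * fps_nth g (k - i))" for k
  proof -
    have "coeff N k = fps_nth (g * (1 - fps_of_poly p)) k" unfolding gN by simp
    also have "g * (1 - fps_of_poly p) = g - fps_of_poly p * g" by (simp add: algebra_simps)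
    finally show ?thesis by (simp add: fps_mult_nth)
  qed
  define r where "r = N - (1 - p) * h"
  have cr: "coeff r k = coeff N k - (coeff h k - (\<Sum>i=0..k. coeff p i * coeff h (k - i)))" for k
    unfolding r_def left_diff_distrib mult_1 coeff_diff coeff_mult atLeast0AtMost by (rule refl)
  have r0: "coeff r k = 0" if "k < M + 1" for k
  proof -
    have "(\<Sum>i=0..k. coeff p i * coeff h (k - i)) = (\<Sum>i=0..k. coeff p i * fps_nth g (k - i))"
      using that by (intro sum.cong) (auto simp: ch)
    thus ?thesis unfolding cr Nk using that by (simp add: ch)
  qed
  have rpos: "nonneg_poly r"
    unfolding nonneg_poly_def
  proof
    fix k
    show "0 \<le> coeff r k"
    proof (cases "k < M + 1")
      case False
      have "coeff N k = 0" using False by (intro coeff_eq_0) (simp add: M_def)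
      moreover have "0 \<le> (\<Sum>i=0..k. coeff p i * coeff h (k - i))"
        using p G by (intro sum_nonneg mult_nonneg_nonneg) (auto simp: nonneg_poly_def ch g_def)
      ultimately show ?thesis unfolding cr using False by (simp add: ch)
    qed (simp add: r0)
  qed
  have h: "nonneg_poly h" "coeff h 0 = 0"
    using G N0 by (auto simp: nonneg_poly_def ch g_def fps_mult_nth_0)
  have "r = X_poly ^ (M + 1) * poly_shift (M + 1) r"
    by (rule poly_eqI, unfold coeff_X_poly_power_mult coeff_poly_shift) (use r0 in auto)
  hence "r = X_poly * (X_poly ^ M * poly_shift (M + 1) r)" by (simp only: power_add power_one_right mult.assoc mult.commute mult.left_commute)
  moreover have "nonneg_poly (X_poly ^ M * poly_shift (M + 1) r)"
    by (intro nonneg_poly_mult nonneg_poly_power nonneg_poly_X)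
       (use rpos in \<open>simp add: nonneg_poly_def coeff_poly_shift\<close>)
  moreover have "coeff (X_poly ^ M * poly_shift (M + 1) r) 0 = 0"
    unfolding coeff_X_poly_power_mult by (simp add: M_def)
  moreover have "N = (1 - p) * h + r" by (simp add: r_def)
  ultimately show ?thesis using h by metis
qed

text \<open>Since \<open>p / (1 - p) = h - 1\<close>, coefficient \<open>k > 0\<close> of
  \<open>N h\<close> is at least \<open>h_k - \<Sum> \<sigma>_i h_(k-i)\<close>. Up to
  \<open>D\<close> nothing is subtracted. Beyond \<open>D\<close>, after multiplication by
  \<open>R^k\<close>, the subtracted sum is at most
  \<open>\<Sum> \<sigma>_i R^i \<le> y \<le> h_k R^k\<close>.\<close>

lemma numerator_nonneg:
  fixes p N :: "real poly" and \<sigma> :: "nat \<Rightarrow> real"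
  defines "h \<equiv> inverse (1 - fps_of_poly p)"
  assumes p: "nonneg_poly p" and p0: "coeff p 0 = 0" and R: "R > 0"
    and h: "\<And>k. 0 \<le> fps_nth h k" "\<And>k. fps_nth h k * R ^ k \<le> 1" "\<And>k. k > D \<Longrightarrow> y \<le> fps_nth h k * R ^ k"
    and sig: "\<And>k. 0 \<le> \<sigma> k" "\<And>k. k \<le> D \<Longrightarrow> \<sigma> k = 0" "\<And>k. (\<Sum>i=0..k. \<sigma> i * R ^ i) \<le> y"
    and N: "\<And>k. coeff p k - \<sigma> k \<le> coeff N k"
  shows "0 \<le> fps_nth (fps_of_poly N * h) k"
proof -
  have ge: "(\<Sum>i=0..k. coeff p i * fps_nth h (k - i)) - (\<Sum>i=0..k. \<sigma> i * fps_nth h (k - i)) \<le> fps_nth (fps_of_poly N * h) k"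
  proof -
    have "(\<Sum>i=0..k. coeff p i * fps_nth h (k - i)) - (\<Sum>i=0..k. \<sigma> i * fps_nth h (k - i))
      = (\<Sum>i=0..k. (coeff p i - \<sigma> i) * fps_nth h (k - i))"
      by (simp add: sum_subtractf left_diff_distrib)
    also have "\<dots> \<le> (\<Sum>i=0..k. coeff N i * fps_nth h (k - i))"
      using N h(1) by (intro sum_mono mult_right_mono) auto
    finally show ?thesis by (simp add: fps_mult_nth)
  qed
  show ?thesis
  proof (cases "k \<le> D")
    case True
    have "(\<Sum>i=0..k. \<sigma> i * fps_nth h (k - i)) = 0" using True sig(2) by (intro sum.neutral) auto
    moreover have "0 \<le> (\<Sum>i=0..k. coeff p i * fps_nth h (k - i))"
      using p h(1) by (intro sum_nonneg) (auto simp: nonneg_poly_def)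
    ultimately show ?thesis using ge by linarith
  next
    case False
    have "h * (1 - fps_of_poly p) = 1"
      unfolding h_def by (rule inverse_mult_eq_1) (simp add: p0)
    hence "fps_of_poly p * h = h - 1" by (simp add: algebra_simps)
    hence "fps_nth (fps_of_poly p * h) k = fps_nth (h - 1) k" by (rule arg_cong)
    hence ph: "(\<Sum>i=0..k. coeff p i * fps_nth h (k - i)) = fps_nth h k"
      using False by (simp add: fps_mult_nth)
    have "(\<Sum>i=0..k. \<sigma> i * fps_nth h (k - i)) * R ^ k = (\<Sum>i=0..k. (\<sigma> i * R ^ i) * (fps_nth h (k - i) * R ^ (k - i)))"
      unfolding sum_distrib_right by (rule sum.cong) (auto simp: power_add[symmetric])
    also have "\<dots> \<le> (\<Sum>i=0..k. (\<sigma> i * R ^ i) * 1)"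
      using sig h R by (intro sum_mono mult_left_mono) auto
    also have "\<dots> \<le> y" using sig(3)[of k] by simp
    also have "\<dots> \<le> fps_nth h k * R ^ k" using h(3) False by simp
    finally have "(\<Sum>i=0..k. \<sigma> i * fps_nth h (k - i)) \<le> fps_nth h k" using R by simp
    thus ?thesis using ge ph by linarith
  qed
qed

lemma poly_lt_of_nonneg:
  assumes p: "nonneg_poly p" and L: "L \<ge> 1" "coeff p L > 0" and R: "R > 1" "poly p R = 1"
  shows "poly p 1 < 1"
proof -
  have Ld: "L \<le> degree p" using L by (intro le_degree) auto
  have "poly p 1 = (\<Sum>i\<le>degree p. coeff p i * 1 ^ i)" by (simp add: poly_altdef)
  also have "\<dots> < (\<Sum>i\<le>degree p. coeff p i * R ^ i)"
  proof (rule sum_strict_mono_ex1)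
    show "\<forall>i\<in>{..degree p}. coeff p i * 1 ^ i \<le> coeff p i * R ^ i"
    proof (intro ballI mult_left_mono)
      fix i show "(1 :: real) ^ i \<le> R ^ i" using R by simp
      show "0 \<le> coeff p i" using p by (simp add: nonneg_poly_def)
    qed
    have "1 < R ^ L" using R L by (intro one_less_power) auto
    thus "\<exists>i\<in>{..degree p}. coeff p i * 1 ^ i < coeff p i * R ^ i" using L Ld by (intro bexI[of _ L]) auto
  qed simp
  also have "\<dots> = 1" using R by (simp add: poly_altdef)
  finally show ?thesis .
qed

text \<open>Multiplication by the polynomial \<open>f\<close> costs only the factor
  \<open>\<Sum> |f_i| / \<theta>'^i\<close>. As \<open>C\<close> is chosen before \<open>A\<close>,
  the bound is uniform over all products \<open>Q\<close>, whatever the degree \<open>D\<close> up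
  to which they are tuned.\<close>

lemma quotient_coeff_bound:
  fixes f :: "real poly" and m \<theta> \<theta>' :: real
  assumes m: "m \<ge> 0" and th: "0 < \<theta>" "\<theta> < \<theta>'" and f0: "coeff f 0 = 1"
  shows "\<exists>C>0. \<forall>A a. has_moments A a \<longrightarrow> (\<forall>k. 0 \<le> fps_nth a k \<and> fps_nth a k \<le> m * \<theta> ^ k) \<longrightarrow>
           (\<forall>k. \<bar>fps_nth (fps_of_poly f * inverse A) k\<bar> \<le> C * \<theta>' ^ k)"
proof -
  obtain C where C: "C > 0" "\<And>A a k. has_moments A a \<Longrightarrow> (\<forall>k. 0 \<le> fps_nth a k \<and> fps_nth a k \<le> m * \<theta> ^ k) \<Longrightarrow>
           0 \<le> fps_nth (inverse A) k \<and> fps_nth (inverse A) k \<le> C * \<theta>' ^ k"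
    using has_moments_inverse_coeff_bound[OF m th] by blast
  define F where "F = (\<Sum>i\<le>degree f. \<bar>coeff f i\<bar> / \<theta>' ^ i)"
  have "\<bar>coeff f 0\<bar> / \<theta>' ^ 0 \<le> F" unfolding F_def using th
    by (intro member_le_sum) auto
  hence F: "F > 0" using f0 by simp
  show ?thesis
  proof (intro exI[of _ "C * F"] conjI allI impI)
    show "0 < C * F" using C F by simp
    fix A :: "real fps" and a k assume A: "has_moments A a" "\<forall>k. 0 \<le> fps_nth a k \<and> fps_nth a k \<le> m * \<theta> ^ k"
    have "\<bar>fps_nth (fps_of_poly f * inverse A) k\<bar> \<le> (\<Sum>i=0..k. \<bar>coeff f i * fps_nth (inverse A) (k - i)\<bar>)"
      unfolding fps_mult_nth fps_of_poly_nth by (rule sum_abs)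
    also have "\<dots> \<le> (\<Sum>i=0..k. (\<bar>coeff f i\<bar> / \<theta>' ^ i) * (C * \<theta>' ^ k))"
    proof (intro sum_mono)
      fix i assume i: "i \<in> {0..k}"
      have "\<bar>coeff f i * fps_nth (inverse A) (k - i)\<bar> \<le> \<bar>coeff f i\<bar> * (C * \<theta>' ^ (k - i))"
        unfolding abs_mult using C(2)[OF A, of "k - i"] by (intro mult_left_mono) auto
      also have "\<theta>' ^ (k - i) = \<theta>' ^ k / \<theta>' ^ i" using i th by (simp add: power_diff)
      finally show "\<bar>coeff f i * fps_nth (inverse A) (k - i)\<bar> \<le> (\<bar>coeff f i\<bar> / \<theta>' ^ i) * (C * \<theta>' ^ k)" by simp
    qed
    also have "\<dots> = (\<Sum>i=0..k. \<bar>coeff f i\<bar> / \<theta>' ^ i) * (C * \<theta>' ^ k)" by (simp add: sum_distrib_right)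
    also have "\<dots> \<le> F * (C * \<theta>' ^ k)"
    proof (intro mult_right_mono)
      have "(\<Sum>i=0..k. \<bar>coeff f i\<bar> / \<theta>' ^ i) \<le> (\<Sum>i\<in>{0..k} \<union> {..degree f}. \<bar>coeff f i\<bar> / \<theta>' ^ i)"
        using th by (intro sum_mono2) auto
      also have "\<dots> = F" unfolding F_def
        by (rule sum.mono_neutral_right) (auto intro: coeff_eq_0)
      finally show "(\<Sum>i=0..k. \<bar>coeff f i\<bar> / \<theta>' ^ i) \<le> F" .
    qed (use C th in auto)
    finally show "\<bar>fps_nth (fps_of_poly f * inverse A) k\<bar> \<le> C * F * \<theta>' ^ k" by (simp add: mult_ac)
  qed
qed

text \<open>The order of choices matters: \<open>L\<close>, \<open>\<eta>\<close>, \<open>p\<close>,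
  \<open>R\<close>, \<open>y\<close> and \<open>C\<close> depend on the given data only; then
  \<open>D\<close> is taken large against \<open>C\<close> and \<open>y\<close>; then
  \<open>qs\<close> is built for this \<open>D\<close>; and last comes the cut-off \<open>m\<close>,
  large against \<open>Q\<close> and \<open>V\<close>, which depend on \<open>qs\<close>.\<close>

theorem network_decomposition:
  fixes f :: "real poly" and s :: "nat \<Rightarrow> real" and \<rho> n :: real
  assumes f: "has_moments (fps_of_poly f) (Abs_fps (\<lambda>k. if k = 0 then 0 else s k))"
    and rho: "0 < \<rho>" "\<rho> < 1" and n: "n \<ge> 0" and sb: "\<And>k. k \<ge> 1 \<Longrightarrow> \<bar>s k - 1\<bar> \<le> n * \<rho> ^ k"
    and s0: "\<And>k. k \<ge> 1 \<Longrightarrow> 0 \<le> s k"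
    and smult: "\<And>j k. 1 \<le> j \<Longrightarrow> j dvd k \<Longrightarrow> 1 \<le> k \<Longrightarrow> 0 < s j \<Longrightarrow> 0 < s k"
  shows "\<exists>p qs w \<nu>. nonneg_poly p \<and> coeff p 0 = 0 \<and> poly p 1 < 1 \<and> (\<forall>(c, j)\<in>set qs. 0 < c \<and> c < 1 \<and> 1 \<le> j) \<and>
     w \<noteq> 0 \<and> cone p qs w \<nu> \<and> f = (1 - p) * monom_prod qs - \<nu>"
proof -
  have f0: "coeff f 0 = 1" using f by (simp add: has_moments_def)
  have "(\<lambda>k. n * \<rho> ^ k) \<longlonglongrightarrow> n * 0" using rho by (intro tendsto_intros LIMSEQ_realpow_zero) auto
  hence "eventually (\<lambda>k. n * \<rho> ^ k < 1) sequentially" by (intro order_tendstoD) auto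
  then obtain L0 where L0: "\<And>k. k \<ge> L0 \<Longrightarrow> n * \<rho> ^ k < 1" by (auto simp: eventually_sequentially)
  define L where "L = max L0 1"
  have L: "L \<ge> 1" by (simp add: L_def)
  have sL: "s k > 0" if "k \<ge> L" for k
    using sb[of k] L0[of k] that by (auto simp: L_def)
  obtain \<eta> \<epsilon> where eta: "0 < \<eta>" "\<eta> < 1" and eps: "has_moments (1 - geo_tail \<eta> L) \<epsilon>"
    and eps0: "\<And>k. k < L \<Longrightarrow> fps_nth \<epsilon> k = 0" and epsL: "\<And>k. k \<ge> L \<Longrightarrow> fps_nth \<epsilon> k < s k"
    and sigb: "\<And>k. k \<ge> 1 \<Longrightarrow> s k - fps_nth \<epsilon> k \<le> (n + 2) * (1 - \<eta>) ^ k"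
    using moments_one_minus_geo_tail[OF rho n sb L sL] by blast
  define R where "R = (1 - \<eta> / 4) / (1 - \<eta>)"
  obtain p K where R: "R > 1" "R * (1 - \<eta>) < 1" and K: "2 * L \<le> K" and dp: "degree p \<le> K"
    and p0: "\<And>k. 0 \<le> coeff p k" and pL: "\<And>k. k < L \<Longrightarrow> coeff p k = 0"
    and pK: "\<And>k. k \<in> {L..K} \<Longrightarrow> 0 < coeff p k"
    and pr: "\<And>k. 2 * coeff p k \<le> fps_nth (geo_tail \<eta> L) k" and pR: "poly p R = 1"
    using dominated_poly_exists[OF eta L, folded R_def] by blast
  have p: "nonneg_poly p" using p0 by (simp add: nonneg_poly_def)
  have p00: "coeff p 0 = 0" using pL L by simp
  have R0: "R > 0" using R by simp
  define h where "h = inverse (1 - fps_of_poly p)"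
  obtain y where y: "y > 0" and h: "\<And>k. 0 \<le> fps_nth h k" "\<And>k. fps_nth h k * R ^ k \<le> 1"
    "\<And>k. L \<le> k \<Longrightarrow> y \<le> fps_nth h k * R ^ k"
    using renewal_bounds[OF p0 pL pK dp L K R0 pR, folded h_def] by blast
  have pLpos: "coeff p L > 0" using pK K by simp
  define \<theta> where "\<theta> = 1 - \<eta>"
  have th: "0 < \<theta>" "\<theta> < 1" using eta by (auto simp: \<theta>_def)
  \<comment> \<open>Above \<open>\<theta>\<close>, as the coefficient bound requires, and below
    \<open>1 / R\<close>, so that \<open>z = \<theta>' R < 1\<close> and tails weighted with
    \<open>R^k\<close> are summable.\<close>
  define \<theta>' where "\<theta>' = (\<theta> + 1 / R) / 2"
  have "\<theta> < 1 / R" using R by (simp add: \<theta>_def field_simps)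
  hence th': "\<theta> < \<theta>'" "\<theta>' < 1 / R" by (auto simp: \<theta>'_def)
  define z where "z = \<theta>' * R"
  have z: "0 < z" "z < 1" using th th' R by (auto simp: z_def field_simps)
  have "1 / R < 1" using R by simp
  hence th'1: "\<theta>' < 1" using th' by linarith
  obtain C where C: "C > 0" "\<And>A a k. has_moments A a \<Longrightarrow> (\<forall>k. 0 \<le> fps_nth a k \<and> fps_nth a k \<le> (n + 2) * \<theta> ^ k) \<Longrightarrow>
           \<bar>fps_nth (fps_of_poly f * inverse A) k\<bar> \<le> C * \<theta>' ^ k"
    using quotient_coeff_bound[of "n + 2" \<theta> \<theta>' f] n th th' f0 by auto
  have zlim: "(\<lambda>k. c * z ^ k) \<longlonglongrightarrow> 0" for c
  proof -
    have "(\<lambda>k. c * z ^ k) \<longlonglongrightarrow> c * 0" using z by (intro tendsto_intros LIMSEQ_realpow_zero) auto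
    thus ?thesis by simp
  qed
  have zsmall: "\<exists>k0. \<forall>k\<ge>k0. c * z ^ k < e" if "e > 0" for c e
    using order_tendstoD(2)[OF zlim that] by (auto simp: eventually_sequentially)
  \<comment> \<open>One half of \<open>y\<close> is reserved for the coefficients of
    \<open>1 - f / Q\<close> between \<open>D\<close> and \<open>m\<close>, the other half for the
    cost of absorbing \<open>- b\<close>.\<close>
  obtain D0 where D0: "\<And>k. k \<ge> D0 \<Longrightarrow> C / (1 - z) * z ^ k < y / 2" using zsmall[of "y / 2"] y by (metis half_gt_zero)
  define D where "D = max D0 (max K L)"
  have D: "D \<ge> K" "D \<ge> L" "C / (1 - z) * z ^ D < y / 2" using D0 by (auto simp: D_def)
  \<comment> \<open>The root provides the condition \<open>2 c^L \<le> p_L^j\<close> of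
    \<open>cone_absorb\<close>; \<open>1 / 2\<close> keeps \<open>c\<close> below 1.\<close>
  define c0 where "c0 = (\<lambda>j. min (1 / 2) (root L (coeff p L ^ j / 2)))"
  have c0: "c0 j > 0" for j using pLpos L by (simp add: c0_def)
  \<comment> \<open>From index 1 on these are the moments of
    \<open>f / (1 - geo_tail \<eta> L)\<close>, which \<open>Q\<close> has to reproduce. They are
    positive exactly where those of \<open>f\<close> are, so the closure under multiples carries
    over.\<close>
  define \<sigma> where "\<sigma> = (\<lambda>k. s k - fps_nth \<epsilon> k)"
  have sigpos: "\<sigma> k > 0 \<longleftrightarrow> s k > 0" if "k \<ge> 1" for k
    using eps0[of k] epsL[of k] sL[of k] by (cases "k < L") (auto simp: \<sigma>_def)
  have signn: "\<sigma> k \<ge> 0" if "k \<ge> 1" for k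
    using eps0[of k] epsL[of k] s0[OF that] by (cases "k < L") (auto simp: \<sigma>_def)
  obtain qs a where a: "has_moments (fps_of_poly (monom_prod qs)) a"
    and qs: "\<forall>(c, j)\<in>set qs. 0 < c \<and> c \<le> c0 j \<and> 1 \<le> j"
    and aD: "\<And>k. k \<in> {1..D} \<Longrightarrow> fps_nth a k = \<sigma> k" and a0: "\<And>k. 0 \<le> fps_nth a k"
    and aD': "\<And>k. k > D \<Longrightarrow> fps_nth a k \<le> \<theta> ^ k"
  proof -
    have "\<exists>qs a. has_moments (fps_of_poly (monom_prod qs)) a \<and> (\<forall>(c, j)\<in>set qs. 0 < c \<and> c \<le> c0 j \<and> 1 \<le> j) \<and>
     (\<forall>k\<in>{1..D}. fps_nth a k = \<sigma> k) \<and> (\<forall>k. 0 \<le> fps_nth a k) \<and> (\<forall>k>D. fps_nth a k \<le> \<theta> ^ k)"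
    proof (rule monom_prod_with_moments)
      show "\<sigma> k > 0" if "1 \<le> j" "j dvd k" "k \<in> {1..D}" "\<sigma> j > 0" for j k
        using smult[of j k] sigpos[of j] sigpos[of k] that by simp
    qed (use signn th c0 in auto)
    thus ?thesis using that by blast
  qed
  define Q where "Q = monom_prod qs"
  have a_le: "fps_nth a k \<le> (n + 2) * \<theta> ^ k" for k
  proof -
    consider "k = 0" | "k \<in> {1..D}" | "k > D" by fastforce
    thus ?thesis
    proof cases
      case 1
      thus ?thesis using has_moments_nth_0[OF a] n by simp
    next
      case 2
      thus ?thesis using aD sigb by (auto simp: \<sigma>_def \<theta>_def)
    next
      case 3
      have "fps_nth a k \<le> 1 * \<theta> ^ k" using aD' 3 by simp
      also have "\<dots> \<le> (n + 2) * \<theta> ^ k" using n th by (intro mult_right_mono) auto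
      finally show ?thesis .
    qed
  qed
  define FQ where "FQ = fps_of_poly f * inverse (fps_of_poly Q)"
  have FQb: "\<bar>fps_nth FQ k\<bar> \<le> C * \<theta>' ^ k" for k
    unfolding FQ_def Q_def using C(2)[OF a] a0 a_le by blast
  \<comment> \<open>Up to \<open>D\<close> the moments of \<open>f / Q\<close> are
    \<open>s - a = s - \<sigma> = \<epsilon>\<close>, those of
    \<open>1 - geo_tail \<eta> L\<close>.\<close>
  have FQD: "fps_nth FQ k = fps_nth (1 - geo_tail \<eta> L) k" if "k \<le> D" for k
  proof (rule has_moments_coeff_unique[OF _ eps _ that])
    show "has_moments FQ (Abs_fps (\<lambda>k. if k = 0 then 0 else s k) + - a)"
      unfolding FQ_def Q_def by (intro has_moments_mult f has_moments_inverse a)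
    show "fps_nth (Abs_fps (\<lambda>k. if k = 0 then 0 else s k) + - a) k = fps_nth \<epsilon> k" if "k \<le> D" for k
      using aD[of k] that has_moments_nth_0[OF a] has_moments_nth_0[OF eps] by (cases "k = 0") (auto simp: \<sigma>_def)
  qed
  define r where "r = (\<lambda>k. fps_nth (1 - FQ) k)"
  have rD: "r k = fps_nth (geo_tail \<eta> L) k" if "k \<le> D" for k
    using FQD[OF that] by (simp add: r_def)
  have rD': "\<bar>r k\<bar> \<le> C * \<theta>' ^ k" if "k > D" for k
    using FQb[of k] that by (simp add: r_def)
  have Q0: "coeff Q 0 = 1" using a by (simp add: Q_def has_moments_def)
  have rQ: "fps_of_poly Q * (1 - FQ) = fps_of_poly (Q - f)"
  proof -
    have "fps_of_poly Q * inverse (fps_of_poly Q) = 1" using Q0 by (intro inverse_mult_eq_1') simp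
    hence "fps_of_poly Q * FQ = fps_of_poly f"
      unfolding FQ_def by (metis mult.assoc mult.commute mult.right_neutral)
    thus ?thesis by (simp add: right_diff_distrib fps_of_poly_diff)
  qed
  have rQk: "(\<Sum>i=0..k. coeff Q i * r (k - i)) = coeff Q k - coeff f k" for k
  proof -
    have "fps_nth (fps_of_poly Q * (1 - FQ)) k = fps_nth (fps_of_poly (Q - f)) k" unfolding rQ ..
    thus ?thesis by (simp add: fps_mult_nth r_def)
  qed
  obtain V where V: "nonneg_poly V" "\<And>b. nonneg_poly b \<Longrightarrow>
      \<exists>w. cone p qs w (X_poly ^ (length qs + 2) * (b * V * Q - b))"
  proof -
    have "0 < c \<and> 2 * c ^ L \<le> coeff p L ^ j" if "(c, j) \<in> set qs" for c j
    proof -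
      have c: "0 < c" "c \<le> root L (coeff p L ^ j / 2)" using qs that by (auto simp: c0_def)
      have "c ^ L \<le> root L (coeff p L ^ j / 2) ^ L" using c by (intro power_mono) auto
      also have "\<dots> = coeff p L ^ j / 2" using L pLpos by (intro real_root_pow_pos2) auto
      finally show ?thesis using c by simp
    qed
    from cone_absorb[OF p L this] show ?thesis using that unfolding Q_def by blast
  qed
  define dq where "dq = degree Q"
  \<comment> \<open>All ones up to the degree of \<open>Q\<close>, which is the range where the
    remainder \<open>B\<close> below can have coefficients; a multiple of \<open>J\<close> will
    dominate it.\<close>
  define J where "J = (\<Sum>k\<le>dq. monom (1 :: real) k)"
  have J: "nonneg_poly J" unfolding J_def by (intro nonneg_poly_sum) simp
  define W where "W = J * V"
  have W: "nonneg_poly W" using J V by (auto simp: W_def)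
  define Qn where "Qn = (\<Sum>i\<le>dq. \<bar>coeff Q i\<bar>)"
  have Qn: "Qn \<ge> 1"
  proof -
    have "\<bar>coeff Q 0\<bar> \<le> Qn" unfolding Qn_def by (intro member_le_sum) auto
    thus ?thesis using Q0 by simp
  qed
  obtain m0 where m0: "\<And>k. k \<ge> m0 \<Longrightarrow> 2 * Qn * C * poly W R * z ^ k < y / 2"
    using zsmall[of "y / 2"] y by (metis half_gt_zero)
  \<comment> \<open>\<open>m0\<close> makes the cost of absorption small, \<open>D\<close> puts all
    degrees beyond \<open>m\<close> into the range of the tail bound, \<open>degree f\<close> serves
    the degree of \<open>B\<close>, and \<open>length qs + 2\<close> leaves enough powers of
    \<open>X\<close> for the cone lemmas.\<close>
  define m where "m = max m0 (max D (max (degree f) (length qs + 2)))"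
  have m: "m \<ge> m0" "m \<ge> D" "m \<ge> degree f" "m \<ge> length qs + 2" by (auto simp: m_def)
  define \<beta> where "\<beta> = 2 * Qn * C * \<theta>' ^ (m + 1)"
  have beta: "\<beta> > 0" using Qn C th th' by (simp add: \<beta>_def)
  \<comment> \<open>\<open>B\<close> has no definite sign: \<open>B = (B + b) - b\<close> with both parts nonnegative, and \<open>- b\<close> is absorbed\<close>
  define b where "b = Polynomial.smult \<beta> J"
  have b: "nonneg_poly b" using J beta by (auto simp: b_def nonneg_poly_def)
  \<comment> \<open>\<open>T\<close> truncates the series \<open>1 - f / Q\<close> at degree
    \<open>m\<close>. \<open>Y\<close> is the rest times \<open>Q\<close>: a polynomial of the form
    \<open>X^(m + 1) B\<close> with \<open>B\<close> of degree at most \<open>dq\<close>.\<close>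
  define T where "T = (\<Sum>k\<le>m. monom (r k) k)"
  have cT: "coeff T k = (if k \<le> m then r k else 0)" for k by (simp add: T_def coeff_sum)
  define Y where "Y = Q - f - T * Q"
  have cY: "coeff Y k = (\<Sum>i=0..k. coeff Q i * (r (k - i) - coeff T (k - i)))" for k
  proof -
    have "coeff (Q * T) k = (\<Sum>i=0..k. coeff Q i * coeff T (k - i))"
      by (simp add: coeff_mult atLeast0AtMost)
    thus ?thesis using rQk[of k] by (simp add: Y_def mult.commute[of T] right_diff_distrib sum_subtractf)
  qed
  define B where "B = poly_shift (m + 1) Y"
  have YB: "Y = X_poly ^ (m + 1) * B"
  proof (rule poly_eqI)
    fix k
    show "coeff Y k = coeff (X_poly ^ (m + 1) * B) k"
      unfolding coeff_X_poly_power_mult B_def coeff_poly_shift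
      by (auto simp: cY cT intro!: sum.neutral)
  qed
  have Bdeg: "coeff B j = 0" if "j > dq" for j
  proof -
    have "degree (T * Q) \<le> m + dq"
    proof -
      have "degree T \<le> m" unfolding T_def by (rule degree_sum_le) (auto intro: order_trans[OF degree_monom_le])
      thus ?thesis using degree_mult_le[of T Q] by (simp add: dq_def)
    qed
    hence "coeff (T * Q) (j + (m + 1)) = 0" using that by (intro coeff_eq_0) simp
    moreover have "coeff Q (j + (m + 1)) = 0" using that by (intro coeff_eq_0) (simp add: dq_def)
    moreover have "coeff f (j + (m + 1)) = 0" using m by (intro coeff_eq_0) simp
    ultimately show ?thesis by (simp add: B_def coeff_poly_shift Y_def)
  qed
  have Bb: "\<bar>coeff B j\<bar> \<le> Qn * C * \<theta>' ^ (m + 1)" for j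
  proof -
    have "\<bar>coeff B j\<bar> \<le> (\<Sum>i=0..j + (m + 1). \<bar>coeff Q i * (r (j + (m + 1) - i) - coeff T (j + (m + 1) - i))\<bar>)"
      unfolding B_def coeff_poly_shift cY by (rule sum_abs)
    also have "\<dots> \<le> (\<Sum>i=0..j + (m + 1). \<bar>coeff Q i\<bar> * (C * \<theta>' ^ (m + 1)))"
    proof (intro sum_mono)
      fix i assume i: "i \<in> {0..j + (m + 1)}"
      let ?k = "j + (m + 1) - i"
      have "\<bar>r ?k - coeff T ?k\<bar> \<le> C * \<theta>' ^ (m + 1)"
      proof (cases "?k \<le> m")
        case True
        thus ?thesis using C th th' by (simp add: cT)
      next
        case False
        hence "\<bar>r ?k - coeff T ?k\<bar> \<le> C * \<theta>' ^ ?k" using rD' m by (simp add: cT)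
        also have "\<dots> \<le> C * \<theta>' ^ (m + 1)"
          using False C th th' th'1 by (intro mult_left_mono power_decreasing) auto
        finally show ?thesis .
      qed
      thus "\<bar>coeff Q i * (r ?k - coeff T ?k)\<bar> \<le> \<bar>coeff Q i\<bar> * (C * \<theta>' ^ (m + 1))"
        unfolding abs_mult by (intro mult_left_mono) auto
    qed
    also have "\<dots> = (\<Sum>i=0..j + (m + 1). \<bar>coeff Q i\<bar>) * (C * \<theta>' ^ (m + 1))" by (rule sum_distrib_right[symmetric])
    also have "\<dots> \<le> Qn * (C * \<theta>' ^ (m + 1))"
    proof (intro mult_right_mono)
      have "(\<Sum>i=0..j + (m + 1). \<bar>coeff Q i\<bar>) \<le> (\<Sum>i\<in>{0..j + (m + 1)} \<union> {..dq}. \<bar>coeff Q i\<bar>)"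
        by (intro sum_mono2) auto
      also have "\<dots> = Qn" unfolding Qn_def
        by (rule sum.mono_neutral_right) (auto simp: dq_def intro: coeff_eq_0)
      finally show "(\<Sum>i=0..j + (m + 1). \<bar>coeff Q i\<bar>) \<le> Qn" .
    qed (use C th th' in auto)
    finally show ?thesis by (simp add: mult_ac)
  qed
  have cJ: "coeff J k = (if k \<le> dq then 1 else 0)" for k by (simp add: J_def coeff_sum)
  have Bb_pos: "coeff (B + b) j > 0" if "j \<le> dq" for j
  proof -
    have "Qn * C * \<theta>' ^ (m + 1) < \<beta>" using Qn C th th' by (simp add: \<beta>_def)
    thus ?thesis using Bb[of j] that by (simp add: b_def cJ)
  qed
  have Bb_nn: "nonneg_poly (B + b)"
    unfolding nonneg_poly_def
  proof
    fix j show "0 \<le> coeff (B + b) j"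
    proof (cases "j \<le> dq")
      case True
      thus ?thesis using Bb_pos[of j] by linarith
    next
      case False
      thus ?thesis using Bdeg[of j] by (simp add: b_def cJ)
    qed
  qed
  \<comment> \<open>The subtracted \<open>X^(m + 1) b V\<close> is what absorbing \<open>- b\<close>
    costs; multiplied by \<open>Q\<close> it is given back by the summand with
    \<open>b V Q - b\<close> in the decomposition of \<open>\<nu>\<close>.\<close>
  define N where "N = T - p - X_poly ^ (m + 1) * (b * V)"
  have bV: "coeff (b * V) k = \<beta> * coeff W k" for k by (simp add: b_def W_def)
  \<comment> \<open>Bounds how far \<open>N\<close> may fall short of \<open>p\<close>: not at all
    up to \<open>D\<close>, where \<open>2 p \<le> r\<close> gives \<open>T - p \<ge> p\<close>; by
    the coefficient bound from there to \<open>m\<close>; by the cost of absorption beyond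
    \<open>m\<close>.\<close>
  define \<tau> where "\<tau> = (\<lambda>k. (if D < k \<and> k \<le> m then C * \<theta>' ^ k else 0) + (if k < m + 1 then 0 else \<beta> * coeff W (k - (m + 1))))"
  have Nnn: "0 \<le> fps_nth (fps_of_poly N * h) k" for k
  proof (rule numerator_nonneg[where \<sigma> = \<tau> and D = D and y = y, OF p p00 R0, folded h_def])
    show "0 \<le> fps_nth h k" "fps_nth h k * R ^ k \<le> 1" for k using h by auto
    show "y \<le> fps_nth h k * R ^ k" if "k > D" for k using h(3) D that by simp
    show "0 \<le> \<tau> k" for k using C th th' beta W by (auto simp: \<tau>_def nonneg_poly_def)
    show "\<tau> k = 0" if "k \<le> D" for k using that m by (auto simp: \<tau>_def)
    show "coeff p k - \<tau> k \<le> coeff N k" for k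
    proof -
      have cN: "coeff N k = coeff T k - coeff p k - (if k < m + 1 then 0 else \<beta> * coeff W (k - (m + 1)))"
        unfolding N_def coeff_diff coeff_X_poly_power_mult bV ..
      have pz: "coeff p k = 0" if "k > D" using that dp D by (intro coeff_eq_0) simp
      consider "k \<le> D" | "D < k" "k \<le> m" | "k > m" by linarith
      thus ?thesis
      proof cases
        case 1
        thus ?thesis using pr[of k] m by (simp add: cN \<tau>_def cT rD)
      next
        case 2
        thus ?thesis using rD'[of k] pz by (simp add: cN \<tau>_def cT)
      next
        case 3
        thus ?thesis using pz m by (simp add: cN \<tau>_def cT)
      qed
    qed
    show "(\<Sum>i=0..k. \<tau> i * R ^ i) \<le> y" for k
    proof -
      have "(\<Sum>i=0..k. (if D < i \<and> i \<le> m then C * \<theta>' ^ i else 0) * R ^ i) \<le> y / 2"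
      proof -
        have "(\<Sum>i=0..k. (if D < i \<and> i \<le> m then C * \<theta>' ^ i else 0) * R ^ i)
          \<le> (\<Sum>i=0..k. (if D < i then C * z ^ i else 0))"
          using C(1) th th' R0 by (intro sum_mono) (auto simp: z_def power_mult_distrib)
        also have "\<dots> = (\<Sum>i\<in>{D<..k}. C * z ^ i)"
          by (rule sum.mono_neutral_cong_right) auto
        also have "\<dots> = (\<Sum>i<k - D. C * z ^ (i + (D + 1)))"
          by (rule sum.reindex_bij_witness[of _ "\<lambda>i. i + (D + 1)" "\<lambda>i. i - (D + 1)"]) auto
        also have "\<dots> = (\<Sum>i<k - D. C * z ^ (D + 1) * z ^ i)"
          by (simp only: power_add mult.assoc mult.commute mult.left_commute)
        also have "\<dots> = C * z ^ (D + 1) * ((1 - z ^ (k - D)) / (1 - z))"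
          using z by (simp add: sum_distrib_left[symmetric] sum_gp_strict)
        also have "\<dots> \<le> C * z ^ D * (1 / (1 - z))"
          using z C by (intro mult_mono divide_right_mono power_decreasing) (auto simp: power_le_one mult_le_one)
        also have "\<dots> = C / (1 - z) * z ^ D" by simp
        finally show ?thesis using D(3) by linarith
      qed
      moreover have "(\<Sum>i=0..k. (if i < m + 1 then 0 else \<beta> * coeff W (i - (m + 1))) * R ^ i) \<le> y / 2"
      proof -
        have "(\<Sum>i=0..k. (if i < m + 1 then 0 else \<beta> * coeff W (i - (m + 1))) * R ^ i)
          = (\<Sum>i\<in>{m + 1..k}. \<beta> * coeff W (i - (m + 1)) * R ^ i)"
          by (rule sum.mono_neutral_cong_right) auto
        also have "\<dots> = (\<Sum>i<k - m. \<beta> * coeff W i * R ^ (i + (m + 1)))"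
          by (rule sum.reindex_bij_witness[of _ "\<lambda>i. i + (m + 1)" "\<lambda>i. i - (m + 1)"]) auto
        also have "\<dots> = (\<Sum>i<k - m. \<beta> * R ^ (m + 1) * (coeff W i * R ^ i))"
          by (simp only: power_add mult.assoc mult.commute mult.left_commute)
        also have "\<dots> = \<beta> * R ^ (m + 1) * (\<Sum>i<k - m. coeff W i * R ^ i)" by (simp add: sum_distrib_left)
        also have "\<dots> \<le> \<beta> * R ^ (m + 1) * poly W R"
        proof (intro mult_left_mono)
          have "(\<Sum>i<k - m. coeff W i * R ^ i) \<le> (\<Sum>i\<in>{..<k - m} \<union> {..degree W}. coeff W i * R ^ i)"
            using W R by (intro sum_mono2) (auto simp: nonneg_poly_def)
          also have "\<dots> = poly W R" unfolding poly_altdef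
            by (rule sum.mono_neutral_right) (auto intro: coeff_eq_0)
          finally show "(\<Sum>i<k - m. coeff W i * R ^ i) \<le> poly W R" .
        qed (use beta R in auto)
        also have "\<dots> = 2 * Qn * C * poly W R * z ^ (m + 1)"
          by (simp add: \<beta>_def z_def power_mult_distrib)
        also have "\<dots> < y / 2" using m0[of "m + 1"] m by simp
        finally show ?thesis by simp
      qed
      ultimately show ?thesis unfolding \<tau>_def distrib_right sum.distrib by linarith
    qed
  qed
  have r0: "r 0 = 0" using rD[of 0] L by (simp add: geo_tail_def)
  have N0: "coeff N 0 = 0"
    unfolding N_def coeff_diff coeff_X_poly_power_mult using r0 p00 by (simp add: cT)
  obtain g u where g: "nonneg_poly g" "coeff g 0 = 0" "nonneg_poly u" "coeff u 0 = 0" "N = (1 - p) * g + X_poly * u"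
    using nonneg_quotient_decomp[OF p p00 N0] Nnn unfolding h_def by blast
  obtain w1 where w1: "cone p qs w1 (N * Q)"
    using cone_top[OF g(1-4), of p qs] unfolding g(5) Q_def by blast
  \<comment> \<open>Its lowest coefficient is that of \<open>B + b\<close>, which is strictly
    positive; as \<open>w1\<close> and \<open>w3\<close> are nonnegative nothing cancels, so the
    final \<open>w\<close> is nonzero.\<close>
  define w2 where "w2 = X_poly ^ (m - length qs) * (B + b)"
  have w2: "nonneg_poly w2" "coeff w2 0 = 0" "w2 \<noteq> 0"
  proof -
    show "nonneg_poly w2" unfolding w2_def using Bb_nn by (intro nonneg_poly_mult nonneg_poly_power nonneg_poly_X)
    show "coeff w2 0 = 0" using m by (simp add: w2_def coeff_X_poly_power_mult)
    have "coeff w2 (m - length qs) = coeff (B + b) 0" unfolding w2_def coeff_X_poly_power_mult by simp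
    thus "w2 \<noteq> 0" using Bb_pos[of 0] by (metis coeff_0 less_irrefl le0)
  qed
  have "cone p [] w2 (X_poly * w2)" using w2 by (auto intro!: exI[of _ 0])
  from cone_prepend[OF this, of qs] have c2: "cone p qs w2 (X_poly ^ (m + 1) * (B + b))"
  proof -
    assume *: "cone p (qs @ []) w2 (X_poly ^ length qs * (X_poly * w2))"
    have "X_poly ^ (m + 1) = X_poly ^ length qs * (X_poly * X_poly ^ (m - length qs))"
      using m by (simp add: power_add[symmetric] flip: power_Suc)
    hence "X_poly ^ (m + 1) * (B + b) = X_poly ^ length qs * (X_poly * w2)" by (simp only: w2_def mult.assoc)
    thus ?thesis using * by (simp only: append_Nil2)
  qed
  obtain w3 where w3: "cone p qs w3 (X_poly ^ (m + 1) * (b * V * Q - b))"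
  proof -
    obtain w where w: "cone p qs w (X_poly ^ (length qs + 2) * (b * V * Q - b))" using V b by blast
    have "nonneg_poly (X_poly ^ (m + 1 - (length qs + 2)))" by auto
    from cone_mult[OF this w] have "cone p qs (X_poly ^ (m + 1 - (length qs + 2)) * w)
      (X_poly ^ (m + 1 - (length qs + 2)) * X_poly ^ (length qs + 2) * (b * V * Q - b))" by (simp only: mult.assoc)
    also have "X_poly ^ (m + 1 - (length qs + 2)) * X_poly ^ (length qs + 2) = X_poly ^ (m + 1)"
      unfolding power_add[symmetric] using m by simp
    finally show ?thesis using that by blast
  qed
  define \<nu> where "\<nu> = (1 - p) * Q - f"
  have nu: "\<nu> = N * Q + X_poly ^ (m + 1) * (B + b) + X_poly ^ (m + 1) * (b * V * Q - b)"
  proof -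
    have "Q - f = T * Q + X_poly ^ (m + 1) * B" using YB by (simp add: Y_def)
    hence "\<nu> = T * Q + X_poly ^ (m + 1) * B - p * Q" by (simp add: \<nu>_def left_diff_distrib)
    thus ?thesis unfolding N_def by (simp add: algebra_simps)
  qed
  define w where "w = w1 + w2 + w3"
  have cone: "cone p qs w \<nu>"
    unfolding w_def nu using cone_add[OF cone_add[OF w1 c2] w3] .
  have w: "w \<noteq> 0"
  proof
    have cone_w: "nonneg_poly w'" if "cone p qs' w' \<nu>'" for qs' w' \<nu>'
      using that by (induction qs' arbitrary: \<nu>') auto
    have "nonneg_poly w1" "nonneg_poly w3" using cone_w w1 w3 by blast+
    moreover obtain i where "coeff w2 i \<noteq> 0" using w2 by (metis leading_coeff_0_iff)
    moreover from this have "coeff w2 i > 0" using w2(1) by (auto simp: nonneg_poly_def order_less_le)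
    ultimately have "coeff w i > 0" unfolding w_def nonneg_poly_def coeff_add
      by (meson add_nonneg_pos add_pos_nonneg)
    moreover assume "w = 0"
    ultimately show False by simp
  qed
  have "poly p 1 < 1" by (rule poly_lt_of_nonneg[OF p L pLpos R(1) pR])
  moreover have "\<forall>(c, j)\<in>set qs. 0 < c \<and> c < 1 \<and> 1 \<le> j" using qs by (auto simp: c0_def)
  moreover have "f = (1 - p) * monom_prod qs - \<nu>" by (simp add: \<nu>_def Q_def)
  ultimately show ?thesis using p p00 w cone by blast
qed

section \<open>From networks to nonnegative matrices\<close>

text \<open>Column operations clear the lower left block and turn the upper left one into the Schur
  complement of the scalar block.\<close>

lemma det_four_block_scalar:
  fixes A :: "'a::field mat"
  assumes A: "A \<in> carrier_mat m m" and B: "B \<in> carrier_mat m n" and C: "C \<in> carrier_mat n m" and d: "d \<noteq> 0"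
  shows "det (four_block_mat A B C (d \<cdot>\<^sub>m 1\<^sub>m n)) = d ^ n * det (A - inverse d \<cdot>\<^sub>m (B * C))"
proof -
  let ?M = "four_block_mat A B C (d \<cdot>\<^sub>m 1\<^sub>m n)"
  let ?E = "four_block_mat (1\<^sub>m m) (0\<^sub>m m n) (- inverse d \<cdot>\<^sub>m C) (1\<^sub>m n)"
  have E: "?E \<in> carrier_mat (m + n) (m + n)" and M: "?M \<in> carrier_mat (m + n) (m + n)"
    using A by (auto intro!: four_block_carrier_mat)
  have "?M * ?E = four_block_mat (A * 1\<^sub>m m + B * (- inverse d \<cdot>\<^sub>m C)) (A * 0\<^sub>m m n + B * 1\<^sub>m n)
      (C * 1\<^sub>m m + (d \<cdot>\<^sub>m 1\<^sub>m n) * (- inverse d \<cdot>\<^sub>m C)) (C * 0\<^sub>m m n + (d \<cdot>\<^sub>m 1\<^sub>m n) * 1\<^sub>m n)"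
    by (rule mult_four_block_mat) (use A B C in auto)
  also have "A * 1\<^sub>m m + B * (- inverse d \<cdot>\<^sub>m C) = A - inverse d \<cdot>\<^sub>m (B * C)"
    using A B C by (auto intro!: eq_matI simp: mult_smult_distrib)
  also have "A * 0\<^sub>m m n + B * 1\<^sub>m n = B" using A B by (auto intro!: eq_matI)
  also have "C * 1\<^sub>m m + (d \<cdot>\<^sub>m 1\<^sub>m n) * (- inverse d \<cdot>\<^sub>m C) = 0\<^sub>m n m"
    using C d by (auto intro!: eq_matI simp: mult_smult_distrib mult_smult_assoc_mat)
  also have "C * 0\<^sub>m m n + (d \<cdot>\<^sub>m 1\<^sub>m n) * 1\<^sub>m n = d \<cdot>\<^sub>m 1\<^sub>m n"
    using C by (auto intro!: eq_matI)
  also have "det (four_block_mat (A - inverse d \<cdot>\<^sub>m (B * C)) B (0\<^sub>m n m) (d \<cdot>\<^sub>m 1\<^sub>m n))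
      = det (A - inverse d \<cdot>\<^sub>m (B * C)) * det (d \<cdot>\<^sub>m 1\<^sub>m n)"
    by (rule det_four_block_mat_lower_left_zero) (use A B C in auto)
  also have "det (d \<cdot>\<^sub>m 1\<^sub>m n) = d ^ n" by simp
  finally have "det (?M * ?E) = d ^ n * det (A - inverse d \<cdot>\<^sub>m (B * C))" by simp
  moreover have "det ?E = 1"
    by (subst det_four_block_mat_upper_right_zero[of _ m _ n]) (use C in auto)
  ultimately show ?thesis using det_mult[OF M E] by simp
qed

section \<open>Eliminating and restoring a single vertex\<close>

definition one_minus_mat :: "nat \<Rightarrow> (nat \<Rightarrow> nat \<Rightarrow> real) \<Rightarrow> real mat" where
  "one_minus_mat s M = mat s s (\<lambda>(i, j). (if i = j then 1 else 0) - M i j)"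

text \<open>Eliminating the last vertex of the bordered matrix adds \<open>c i * r j / (1 - q)\<close> to the entry \<open>(i, j)\<close>.\<close>
definition border :: "nat \<Rightarrow> (nat \<Rightarrow> nat \<Rightarrow> 'a) \<Rightarrow> (nat \<Rightarrow> 'a) \<Rightarrow> (nat \<Rightarrow> 'a) \<Rightarrow> 'a \<Rightarrow> nat \<Rightarrow> nat \<Rightarrow> 'a" where
  "border s M c r q = (\<lambda>i j. if i < s then (if j < s then M i j else c i) else (if j < s then r j else q))"

text \<open>Stands in for irreducibility: the two vectors are carried through every bordering step
  and finally give the rescaling to a stochastic matrix and its positive fixed point.\<close>

definition positive_fixed :: "nat \<Rightarrow> (nat \<Rightarrow> nat \<Rightarrow> real) \<Rightarrow> bool" where
  "positive_fixed s M \<longleftrightarrow> (\<exists>y z. (\<forall>i<s. 0 < y i \<and> 0 < z i) \<and> (\<forall>i<s. (\<Sum>j<s. M i j * y j) = y i) \<and>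
     (\<forall>j<s. (\<Sum>i<s. z i * M i j) = z j))"

lemma one_minus_mat_cong:
  "(\<And>i j. i < s \<Longrightarrow> j < s \<Longrightarrow> M i j = M' i j) \<Longrightarrow> one_minus_mat s M = one_minus_mat s M'"
  by (auto simp: one_minus_mat_def intro!: cong_mat)

lemma positive_fixed_cong:
  assumes "\<And>i j. i < s \<Longrightarrow> j < s \<Longrightarrow> M i j = M' i j"
  shows "positive_fixed s M = positive_fixed s M'"
proof -
  have "(\<Sum>j<s. M i j * y j) = (\<Sum>j<s. M' i j * y j)" if "i < s" for i and y :: "nat \<Rightarrow> real"
    using assms that by (intro sum.cong) auto
  moreover have "(\<Sum>i<s. z i * M i j) = (\<Sum>i<s. z i * M' i j)" if "j < s" for j and z :: "nat \<Rightarrow> real"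
    using assms that by (intro sum.cong) auto
  ultimately show ?thesis unfolding positive_fixed_def by (simp cong: conj_cong)
qed

lemma det_border:
  assumes q: "q \<noteq> 1"
  shows "det (one_minus_mat (Suc s) (border s M c r q))
       = (1 - q) * det (one_minus_mat s (\<lambda>i j. M i j + c i * r j / (1 - q)))"
proof -
  let ?B = "mat s 1 (\<lambda>(i, j). - c i)" and ?C = "mat 1 s (\<lambda>(i, j). - r j)"
  have "one_minus_mat (Suc s) (border s M c r q) = four_block_mat (one_minus_mat s M) ?B ?C ((1 - q) \<cdot>\<^sub>m 1\<^sub>m 1)"
    by (rule eq_matI) (auto simp: one_minus_mat_def border_def four_block_mat_def Let_def less_Suc_eq)
  also have "det \<dots> = (1 - q) ^ 1 * det (one_minus_mat s M - inverse (1 - q) \<cdot>\<^sub>m (?B * ?C))"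
    by (rule det_four_block_scalar[of _ s]) (use q in \<open>auto simp: one_minus_mat_def\<close>)
  also have "one_minus_mat s M - inverse (1 - q) \<cdot>\<^sub>m (?B * ?C) = one_minus_mat s (\<lambda>i j. M i j + c i * r j / (1 - q))"
    by (rule eq_matI) (auto simp: one_minus_mat_def scalar_prod_def field_simps)
  finally show ?thesis by simp
qed

text \<open>The equations of the new vertex force its entries
  \<open>(\<Sum> r_j y_j) / (1 - q)\<close> and \<open>(\<Sum> z_i c_i) / (1 - q)\<close>;
  substituted into the other equations they restore the terms \<open>c_i r_j / (1 - q)\<close>. They
  are positive because some \<open>c_i\<close> and some \<open>r_j\<close> are.\<close>

lemma positive_fixed_border:
  assumes fixed: "positive_fixed s (\<lambda>i j. M i j + c i * r j / (1 - q))"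
    and q: "q < 1" and c: "\<And>i. i < s \<Longrightarrow> 0 \<le> c i" and r: "\<And>j. j < s \<Longrightarrow> 0 \<le> r j"
    and i0: "i0 < s" "0 < c i0" and j0: "j0 < s" "0 < r j0"
  shows "positive_fixed (Suc s) (border s M c r q)"
proof -
  obtain y z where yz: "\<And>i. i < s \<Longrightarrow> 0 < y i" "\<And>i. i < s \<Longrightarrow> 0 < z i"
    and y: "\<And>i. i < s \<Longrightarrow> (\<Sum>j<s. (M i j + c i * r j / (1 - q)) * y j) = y i"
    and z: "\<And>j. j < s \<Longrightarrow> (\<Sum>i<s. z i * (M i j + c i * r j / (1 - q))) = z j"
    using fixed unfolding positive_fixed_def by blast
  define ys where "ys = (\<Sum>j<s. r j * y j) / (1 - q)"
  define zs where "zs = (\<Sum>i<s. z i * c i) / (1 - q)"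
  define y' where "y' = (\<lambda>i. if i < s then y i else ys)"
  define z' where "z' = (\<lambda>i. if i < s then z i else zs)"
  have "0 < (\<Sum>j<s. r j * y j)"
    by (rule sum_pos2[of _ j0]) (use j0 r yz in \<open>auto simp: less_imp_le\<close>)
  hence ys: "ys > 0" using q by (simp add: ys_def)
  have "0 < (\<Sum>i<s. z i * c i)"
    by (rule sum_pos2[of _ i0]) (use i0 c yz in \<open>auto simp: less_imp_le\<close>)
  hence zs: "zs > 0" using q by (simp add: zs_def)
  have ys': "(\<Sum>j<s. r j * y j) + q * ys = ys" and zs': "(\<Sum>i<s. z i * c i) + zs * q = zs"
    using q by (simp_all add: ys_def zs_def field_simps)
  have 1: "(\<Sum>j<Suc s. border s M c r q i j * y' j) = y' i" if "i < Suc s" for i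
  proof (cases "i < s")
    case True
    have "(\<Sum>j<Suc s. border s M c r q i j * y' j) = (\<Sum>j<s. M i j * y j) + c i * ys"
      using True by (simp add: border_def y'_def)
    also have "\<dots> = (\<Sum>j<s. (M i j + c i * r j / (1 - q)) * y j)"
      by (simp add: ys_def distrib_right sum.distrib sum_distrib_left sum_divide_distrib mult.assoc)
    finally show ?thesis using y[OF True] True by (simp add: y'_def)
  next
    case False
    thus ?thesis using ys' that by (simp add: border_def y'_def)
  qed
  have 2: "(\<Sum>i<Suc s. z' i * border s M c r q i j) = z' j" if "j < Suc s" for j
  proof (cases "j < s")
    case True
    have "(\<Sum>i<Suc s. z' i * border s M c r q i j) = (\<Sum>i<s. z i * M i j) + zs * r j"
      using True by (simp add: border_def z'_def)
    also have "\<dots> = (\<Sum>i<s. z i * (M i j + c i * r j / (1 - q)))"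
      by (simp add: zs_def distrib_left sum.distrib sum_distrib_right sum_divide_distrib mult.assoc)
    finally show ?thesis using z[OF True] True by (simp add: z'_def)
  next
    case False
    thus ?thesis using zs' that by (simp add: border_def z'_def)
  qed
  show ?thesis unfolding positive_fixed_def
    using 1 2 yz ys zs by (intro exI[of _ y'] exI[of _ z']) (auto simp: y'_def z'_def)
qed

text \<open>The exponent of the variable is the length of an edge, so entries have no constant term.
  The determinant is prescribed as a function on \<open>[0, 1]\<close> only, where the denominators
  \<open>1 - q\<close> of the eliminations are positive.\<close>

definition poly_realizable :: "nat \<Rightarrow> (nat \<Rightarrow> nat \<Rightarrow> real poly) \<Rightarrow> (real \<Rightarrow> real) \<Rightarrow> bool" where
  "poly_realizable s m F \<longleftrightarrow> (\<forall>i<s. \<forall>j<s. nonneg_poly (m i j) \<and> coeff (m i j) 0 = 0) \<and>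
     (\<forall>t. 0 \<le> t \<and> t \<le> 1 \<longrightarrow> det (one_minus_mat s (\<lambda>i j. poly (m i j) t)) = F t) \<and>
     positive_fixed s (\<lambda>i j. poly (m i j) 1)"

lemma poly_border: "poly (border s m c r q i j) t = border s (\<lambda>i j. poly (m i j) t) (\<lambda>i. poly (c i) t) (\<lambda>j. poly (r j) t) (poly q t) i j"
  by (simp add: border_def)

lemma poly_nonneg: "nonneg_poly f \<Longrightarrow> 0 \<le> t \<Longrightarrow> 0 \<le> poly f t"
  by (auto simp: nonneg_poly_def poly_altdef intro!: sum_nonneg)

lemma poly_one_pos:
  assumes "nonneg_poly f" "f \<noteq> 0"
  shows "0 < poly f 1"
proof -
  have "0 < (\<Sum>i\<le>degree f. coeff f i)"
    by (rule sum_pos2[of _ "degree f"]) (use assms in \<open>auto simp: nonneg_poly_def order_less_le\<close>)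
  thus ?thesis by (simp add: poly_altdef)
qed

lemma poly_le_poly_one:
  assumes "nonneg_poly f" "0 \<le> t" "t \<le> 1"
  shows "poly f t \<le> poly f 1"
  unfolding poly_altdef using assms
  by (intro sum_mono mult_left_mono) (auto simp: nonneg_poly_def power_le_one)

lemma border_poly_realizable:
  assumes m: "\<And>i j. i < s \<Longrightarrow> j < s \<Longrightarrow> nonneg_poly (m i j) \<and> coeff (m i j) 0 = 0"
    and c: "\<And>i. i < s \<Longrightarrow> nonneg_poly (c i) \<and> coeff (c i) 0 = 0"
    and r: "\<And>j. j < s \<Longrightarrow> nonneg_poly (r j) \<and> coeff (r j) 0 = 0"
    and q: "nonneg_poly q" "coeff q 0 = 0" "poly q 1 < 1"
    and k: "k < s" "c k \<noteq> 0" and l: "l < s" "r l \<noteq> 0"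
    and det: "\<And>t. 0 \<le> t \<Longrightarrow> t \<le> 1 \<Longrightarrow>
      det (one_minus_mat s (\<lambda>i j. poly (m i j) t + poly (c i) t * poly (r j) t / (1 - poly q t))) = F t"
    and fixed: "positive_fixed s (\<lambda>i j. poly (m i j) 1 + poly (c i) 1 * poly (r j) 1 / (1 - poly q 1))"
  shows "poly_realizable (Suc s) (border s m c r q) (\<lambda>t. (1 - poly q t) * F t)"
  unfolding poly_realizable_def
proof (intro conjI allI impI)
  show "nonneg_poly (border s m c r q i j)" "coeff (border s m c r q i j) 0 = 0" if "i < Suc s" "j < Suc s" for i j
    using that m c r q by (auto simp: border_def)
  show "det (one_minus_mat (Suc s) (\<lambda>i j. poly (border s m c r q i j) t)) = (1 - poly q t) * F t" if "0 \<le> t \<and> t \<le> 1" for t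
  proof -
    have "poly q t \<noteq> 1" using poly_le_poly_one[OF q(1), of t] q(3) that by auto
    thus ?thesis unfolding poly_border using det_border det that by simp
  qed
  show "positive_fixed (Suc s) (\<lambda>i j. poly (border s m c r q i j) 1)"
    unfolding poly_border
    by (rule positive_fixed_border[OF fixed q(3), of k l])
       (use c r k l in \<open>auto intro: poly_nonneg poly_one_pos\<close>)
qed

lemma poly_monom_prod_pos:
  assumes "\<forall>(c, j)\<in>set qs. 0 < c \<and> c < 1 \<and> 1 \<le> j" "0 \<le> t" "t \<le> 1"
  shows "0 < poly (monom_prod qs) t"
  using assms(1)
proof (induction qs)
  case (Cons q qs)
  obtain c j where q: "q = (c, j)" by (cases q)
  have c: "0 < c" "c < 1" using Cons.prems by (auto simp: q)
  have "c * t ^ j \<le> c" using c assms by (simp add: mult_left_le power_le_one)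
  hence "c * t ^ j < 1" using c by linarith
  thus ?case using Cons by (simp add: q poly_monom)
qed simp

lemma cone_poly_one_pos:
  assumes p: "poly p 1 < 1" and w: "w \<noteq> 0" and qs: "\<forall>(c, j)\<in>set qs. 0 < c \<and> c < 1 \<and> 1 \<le> j"
  shows "cone p qs w \<nu> \<Longrightarrow> 0 < poly \<nu> 1"
  using qs
proof (induction qs arbitrary: \<nu>)
  case Nil
  then obtain h where "nonneg_poly h" "nonneg_poly w" "\<nu> = (1 - p) * h + X_poly * w" by auto
  thus ?case using p w poly_nonneg[of h 1] poly_one_pos[of w] by (simp add: add_nonneg_pos)
next
  case (Cons q qs)
  then obtain h u \<mu> where *: "nonneg_poly h" "nonneg_poly u" "cone p qs w \<mu>"
    "\<nu> = ((1 - p) * h + X_poly * u) * monom_prod (q # qs) + X_poly * \<mu>" by auto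
  have "0 < poly (monom_prod (q # qs)) 1" using poly_monom_prod_pos[OF Cons.prems(2)] by simp
  moreover have "0 < poly \<mu> 1" using Cons * by simp
  ultimately show ?case using p * poly_nonneg[of h 1] poly_nonneg[of u 1]
    by (auto simp add: add_nonneg_pos)
qed

lemma network_fraction_step:
  fixes a b :: "'a::field"
  assumes "a \<noteq> 0" "b \<noteq> 0" "Q \<noteq> 0"
  shows "((a * h + t * v) * (b * Q) + t * \<mu>) / (a * (b * Q)) = h + t * v / a + t * (\<mu> / (a * Q)) / b"
  using assms by (simp add: add_divide_distrib)

text \<open>\<open>M\<close> is a network with some vertices eliminated: from each vertex
  \<open>k\<close> an edge \<open>u k\<close> leads to the vertex with loop \<open>p\<close>, which
  returns to 0 by an edge \<open>X\<close>, and from \<open>i\<close> a cone fraction leads back to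
  0. Each induction step restores the vertex of one factor \<open>1 - q\<close>, and the base case
  the vertex with loop \<open>p\<close>.\<close>

lemma network_step:
  fixes p :: "real poly"
  assumes p: "nonneg_poly p" "coeff p 0 = 0" "poly p 1 < 1" and w: "w \<noteq> 0"
  shows "\<lbrakk>\<forall>(c, j)\<in>set qs. 0 < c \<and> c < 1 \<and> 1 \<le> j; cone p qs w \<nu>; i < s;
    \<And>i j. i < s \<Longrightarrow> j < s \<Longrightarrow> nonneg_poly (m i j) \<and> coeff (m i j) 0 = 0;
    \<And>i. i < s \<Longrightarrow> nonneg_poly (u i) \<and> coeff (u i) 0 = 0;
    M = (\<lambda>t k j. poly (m k j) t + (if j = 0 then poly (u k) t * t / (1 - poly p t) +
          (if k = i then poly \<nu> t / ((1 - poly p t) * poly (monom_prod qs) t) else 0) else 0));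
    \<And>t. 0 \<le> t \<Longrightarrow> t \<le> 1 \<Longrightarrow> det (one_minus_mat s (M t)) = F t; positive_fixed s (M 1)\<rbrakk>
   \<Longrightarrow> \<exists>s' m'. poly_realizable s' m' (\<lambda>t. (1 - poly p t) * (poly (monom_prod qs) t * F t))"
proof (induction qs arbitrary: \<nu> i s m u M F)
  case Nil
  obtain h where h: "nonneg_poly h" "coeff h 0 = 0" "nonneg_poly w" "coeff w 0 = 0" "\<nu> = (1 - p) * h + X_poly * w"
    using Nil.prems(2) by auto
  \<comment> \<open>The fraction left at \<open>i\<close> is \<open>h + X w / (1 - p)\<close>:
    \<open>h\<close> becomes a direct edge to 0, and \<open>w\<close> joins the edges
    \<open>u\<close> into the vertex with loop \<open>p\<close>.\<close>
  define m1 where "m1 = (\<lambda>k j. m k j + (if k = i \<and> j = 0 then h else 0))"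
  define c where "c = (\<lambda>k. u k + (if k = i then w else 0))"
  define r where "r = (\<lambda>j :: nat. if j = 0 then X_poly else 0)"
  have X: "X_poly \<noteq> 0" by (simp add: X_poly_def)
  have p1: "poly p t < 1" if "0 \<le> t" "t \<le> 1" for t
    using poly_le_poly_one[OF p(1) that] p(3) by simp
  have M: "M t k j = poly (m1 k j) t + poly (c k) t * poly (r j) t / (1 - poly p t)" if "0 \<le> t" "t \<le> 1" for t k j
  proof -
    have "poly \<nu> t / ((1 - poly p t) * poly (monom_prod []) t) = poly h t + t * poly w t / (1 - poly p t)"
      using p1[OF that] unfolding h(5) by (simp add: add_divide_distrib)
    thus ?thesis unfolding Nil.prems(6) m1_def c_def r_def by (auto simp: algebra_simps add_divide_distrib)
  qed
  have "poly_realizable (Suc s) (border s m1 c r p) (\<lambda>t. (1 - poly p t) * F t)"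
  proof (rule border_poly_realizable[OF _ _ _ p Nil.prems(3), where l = 0])
    show "c i \<noteq> 0"
    proof -
      have "0 < poly (c i) 1"
        using poly_one_pos[OF h(3) w] poly_nonneg[of "u i" 1] Nil.prems(3,5) by (simp add: c_def)
      thus ?thesis by auto
    qed
    show "0 < s" "r 0 \<noteq> 0" using Nil.prems(3) X by (auto simp: r_def)
    show "det (one_minus_mat s (\<lambda>i j. poly (m1 i j) t + poly (c i) t * poly (r j) t / (1 - poly p t))) = F t"
      if "0 \<le> t" "t \<le> 1" for t
      using Nil.prems(7)[OF that] M[OF that] by (metis (mono_tags, lifting) one_minus_mat_cong)
    show "positive_fixed s (\<lambda>i j. poly (m1 i j) 1 + poly (c i) 1 * poly (r j) 1 / (1 - poly p 1))"
      using Nil.prems(8) M[of 1] by (metis (mono_tags, lifting) positive_fixed_cong zero_le_one order_refl)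
  qed (use Nil.prems(4,5) h in \<open>auto simp: m1_def c_def r_def X_poly_def\<close>)
  thus ?case by auto
next
  case (Cons a qs)
  obtain d k where a: "a = (d, k)" by (cases a)
  have d: "0 < d" "d < 1" "1 \<le> k" using Cons.prems(1) by (auto simp: a)
  have qs: "\<forall>(c, j)\<in>set qs. 0 < c \<and> c < 1 \<and> 1 \<le> j" using Cons.prems(1) by auto
  define q where "q = monom d k"
  obtain h v \<mu> where h: "nonneg_poly h" "coeff h 0 = 0" "nonneg_poly v" "coeff v 0 = 0" "cone p qs w \<mu>"
    "\<nu> = ((1 - p) * h + X_poly * v) * monom_prod (a # qs) + X_poly * \<mu>"
    using Cons.prems(2) by auto
  have i: "i < s" by (rule Cons.prems(3))
  define Z where "Z = (\<lambda>t. poly \<mu> t / ((1 - poly p t) * poly (monom_prod qs) t))"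
  define m1 where "m1 = (\<lambda>k j. m k j + (if k = i \<and> j = 0 then h else 0))"
  define u1 where "u1 = (\<lambda>k. u k + (if k = i then v else 0))"
  define B where "B = (\<lambda>t k j. poly (m1 k j) t + (if j = 0 then poly (u1 k) t * t / (1 - poly p t) else 0))"
  define c where "c = (\<lambda>t k. if k = i then t else (0::real))"
  define r where "r = (\<lambda>t j. if j = (0::nat) then Z t else 0)"
  have p1: "poly p t < 1" if "0 \<le> t" "t \<le> 1" for t
    using poly_le_poly_one[OF p(1) that] p(3) by simp
  have q1: "poly q t < 1" if "0 \<le> t" "t \<le> 1" for t
  proof -
    have "d * t ^ k \<le> d" using d that by (simp add: mult_left_le power_le_one)
    hence "d * t ^ k < 1" using d(2) by (rule le_less_trans)
    thus ?thesis by (simp add: q_def poly_monom)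
  qed
  have M: "M t k j = B t k j + c t k * r t j / (1 - poly q t)" if t: "0 \<le> t" "t \<le> 1" for t k j
  proof -
    have Q: "poly (monom_prod qs) t > 0" by (rule poly_monom_prod_pos[OF qs t])
    have Qa: "poly (monom_prod (a # qs)) t = (1 - poly q t) * poly (monom_prod qs) t"
      by (simp add: a q_def)
    have "poly \<nu> t / ((1 - poly p t) * poly (monom_prod (a # qs)) t)
      = poly h t + t * poly v t / (1 - poly p t) + t * Z t / (1 - poly q t)"
      using network_fraction_step[of "1 - poly p t" "1 - poly q t" "poly (monom_prod qs) t"] Q p1[OF t] q1[OF t]
      unfolding h(6) poly_add poly_diff poly_1 poly_mult poly_X_poly Qa Z_def by simp
    thus ?thesis unfolding Cons.prems(6) B_def c_def r_def m1_def u1_def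
      by (auto simp: algebra_simps add_divide_distrib)
  qed
  \<comment> \<open>The new vertex \<open>s\<close> has the loop \<open>q\<close> and is entered
    from \<open>i\<close> by an edge \<open>X\<close>; the rest \<open>Z\<close> of the fraction now
    starts at \<open>s\<close>, which takes the place of \<open>i\<close> in the induction
    hypothesis.\<close>
  define m' where "m' = border s m1 (\<lambda>k. if k = i then X_poly else 0) (\<lambda>_. 0) q"
  define u' where "u' = (\<lambda>k. if k < s then u1 k else 0)"
  define M' where "M' = (\<lambda>t k j. poly (m' k j) t + (if j = 0 then poly (u' k) t * t / (1 - poly p t) +
          (if k = s then Z t else 0) else 0))"
  have M': "M' t k j = border s (B t) (c t) (r t) (poly q t) k j" if "k < Suc s" "j < Suc s" for t k j
    using that i unfolding M'_def m'_def u'_def B_def c_def r_def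
    by (auto simp: border_def less_Suc_eq)
  have "\<exists>s' m'. poly_realizable s' m' (\<lambda>t. (1 - poly p t) * (poly (monom_prod qs) t * ((1 - poly q t) * F t)))"
  proof (rule Cons.IH[OF qs h(5), of s "Suc s" m' u' M'])
    show "M' = (\<lambda>t k j. poly (m' k j) t + (if j = 0 then poly (u' k) t * t / (1 - poly p t) +
          (if k = s then poly \<mu> t / ((1 - poly p t) * poly (monom_prod qs) t) else 0) else 0))"
      unfolding M'_def Z_def ..
    show "nonneg_poly (m' k j) \<and> coeff (m' k j) 0 = 0" if "k < Suc s" "j < Suc s" for k j
      using that Cons.prems(4) h d by (auto simp: m'_def border_def m1_def X_poly_def q_def)
    show "nonneg_poly (u' k) \<and> coeff (u' k) 0 = 0" if "k < Suc s" for k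
      using that Cons.prems(5) h by (auto simp: u'_def u1_def)
    show "det (one_minus_mat (Suc s) (M' t)) = (1 - poly q t) * F t" if t: "0 \<le> t" "t \<le> 1" for t
    proof -
      have "one_minus_mat (Suc s) (M' t) = one_minus_mat (Suc s) (border s (B t) (c t) (r t) (poly q t))"
        by (rule one_minus_mat_cong) (rule M')
      moreover have "poly q t \<noteq> 1" using q1[OF t] by simp
      moreover have "one_minus_mat s (M t) = one_minus_mat s (\<lambda>k j. B t k j + c t k * r t j / (1 - poly q t))"
        by (rule one_minus_mat_cong) (rule M[OF t])
      ultimately show ?thesis using det_border[of "poly q t"] Cons.prems(7)[OF t] by simp
    qed
    \<comment> \<open>Here \<open>w \<noteq> 0\<close> enters: the way from the new vertex back to 0
      must have positive weight for its entry in the right eigenvector to be positive.\<close>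
    have "0 < poly \<mu> 1" by (rule cone_poly_one_pos[OF p(3) w qs h(5)])
    hence Z1: "Z 1 > 0" unfolding Z_def using p(3) poly_monom_prod_pos[OF qs, of 1] by simp
    have "positive_fixed s (\<lambda>k j. B 1 k j + c 1 k * r 1 j / (1 - poly q 1))"
      using Cons.prems(8) positive_fixed_cong[of s "M 1", OF M[of 1]] by simp
    hence "positive_fixed (Suc s) (border s (B 1) (c 1) (r 1) (poly q 1))"
      by (rule positive_fixed_border[of _ _ _ _ _ i 0]) (use i Z1 q1[of 1] in \<open>auto simp: c_def r_def\<close>)
    thus "positive_fixed (Suc s) (M' 1)"
      using positive_fixed_cong[of "Suc s" "M' 1", OF M'] by simp
  qed simp
  moreover have "poly (monom_prod (a # qs)) t = (1 - poly q t) * poly (monom_prod qs) t" for t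
    by (simp add: a q_def)
  ultimately show ?case by (simp add: mult_ac)
qed

text \<open>The start is a single vertex with loop \<open>\<phi> = \<nu> / ((1 - p) Q)\<close>,
  where \<open>Q = monom_prod qs\<close> and \<open>f = (1 - p) Q (1 - \<phi>)\<close>. As
  \<open>f\<close> vanishes at 1, the loop has weight 1 there and fixes the constant vector.\<close>

theorem network_realizable:
  fixes p f :: "real poly"
  assumes p: "nonneg_poly p" "coeff p 0 = 0" "poly p 1 < 1" and w: "w \<noteq> 0"
    and qs: "\<forall>(c, j)\<in>set qs. 0 < c \<and> c < 1 \<and> 1 \<le> j" and cone: "cone p qs w \<nu>"
    and f: "f = (1 - p) * monom_prod qs - \<nu>" and f1: "poly f 1 = 0"
  shows "\<exists>s m. poly_realizable s m (poly f)"
proof -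
  define Z where "Z = (\<lambda>t. poly \<nu> t / ((1 - poly p t) * poly (monom_prod qs) t))"
  define M where "M = (\<lambda>t (k :: nat) (j :: nat). poly 0 t + (if j = 0 then poly 0 t * t / (1 - poly p t) +
          (if k = 0 then poly \<nu> t / ((1 - poly p t) * poly (monom_prod qs) t) else 0) else 0))"
  have M: "M t k j = Z t" if "k < 1" "j < 1" for t k j using that by (simp add: M_def Z_def)
  have "\<exists>s' m'. poly_realizable s' m' (\<lambda>t. (1 - poly p t) * (poly (monom_prod qs) t * (1 - Z t)))"
  proof (rule network_step[OF p w qs cone, of 0 1 "\<lambda>_ _. 0" "\<lambda>_. 0" M])
    show "det (one_minus_mat 1 (M t)) = 1 - Z t" for t
    proof -
      have "one_minus_mat 1 (M t) = mat 1 1 (\<lambda>(i, j). 1 - Z t)"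
        by (rule eq_matI) (auto simp: one_minus_mat_def M)
      thus ?thesis by (simp add: det_single)
    qed
    have "poly \<nu> 1 = (1 - poly p 1) * poly (monom_prod qs) 1" using f1 f by simp
    hence "Z 1 = 1" using p poly_monom_prod_pos[OF qs, of 1] by (simp add: Z_def)
    thus "positive_fixed 1 (M 1)" unfolding positive_fixed_def
      by (intro exI[of _ "\<lambda>_. 1"]) (simp add: M)
  qed (simp_all add: M_def)
  then obtain s m where sm: "poly_realizable s m (\<lambda>t. (1 - poly p t) * (poly (monom_prod qs) t * (1 - Z t)))" by blast
  have "(1 - poly p t) * (poly (monom_prod qs) t * (1 - Z t)) = poly f t" if "0 \<le> t" "t \<le> 1" for t
  proof -
    have "poly (monom_prod qs) t > 0" by (rule poly_monom_prod_pos[OF qs that])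
    moreover have "poly p t < 1" using poly_le_poly_one[OF p(1) that] p(3) by simp
    ultimately show ?thesis by (simp add: Z_def f field_simps)
  qed
  with sm have "poly_realizable s m (poly f)" by (auto simp: poly_realizable_def)
  thus ?thesis by blast
qed

text \<open>Long edges are subdivided: an entry \<open>f = f_1 X + X b\<close> becomes the edge
  \<open>f_1 X\<close> and a path through a new vertex with weights \<open>b\<close> and
  \<open>X\<close>. The induction is on the sum of \<open>degree - 1\<close>, truncated at 0, which
  drops because \<open>b\<close> has smaller degree than \<open>f\<close>.\<close>

lemma poly_realizable_linear:
  "poly_realizable s m F \<Longrightarrow> \<exists>s A. (\<forall>i<s. \<forall>j<s. 0 \<le> A i j) \<and>
     (\<forall>t. 0 \<le> t \<and> t \<le> 1 \<longrightarrow> det (one_minus_mat s (\<lambda>i j. A i j * t)) = F t) \<and> positive_fixed s A"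
proof (induction "\<Sum>i<s. \<Sum>j<s. degree (m i j) - 1" arbitrary: s m rule: less_induct)
  case less
  note real = less.prems[unfolded poly_realizable_def]
  show ?case
  proof (cases "\<forall>i<s. \<forall>j<s. degree (m i j) \<le> 1")
    case True
    have m: "poly (m i j) t = coeff (m i j) 1 * t" if "i < s" "j < s" for i j t
    proof -
      have "poly (m i j) t = (\<Sum>k\<le>1. coeff (m i j) k * t ^ k)"
        unfolding poly_altdef by (rule sum.mono_neutral_left) (use True that in \<open>auto intro: coeff_eq_0\<close>)
      thus ?thesis using real that by simp
    qed
    show ?thesis
    proof (intro exI[of _ s] exI[of _ "\<lambda>i j. coeff (m i j) 1"] conjI allI impI)
      show "0 \<le> coeff (m i j) 1" if "i < s" "j < s" for i j
        using real that by (auto simp: nonneg_poly_def)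
      show "det (one_minus_mat s (\<lambda>i j. coeff (m i j) 1 * t)) = F t" if "0 \<le> t \<and> t \<le> 1" for t
      proof -
        have "one_minus_mat s (\<lambda>i j. poly (m i j) t) = one_minus_mat s (\<lambda>i j. coeff (m i j) 1 * t)"
          by (rule one_minus_mat_cong) (rule m)
        thus ?thesis using real that by metis
      qed
      have "positive_fixed s (\<lambda>i j. poly (m i j) 1) = positive_fixed s (\<lambda>i j. coeff (m i j) 1)"
        by (rule positive_fixed_cong) (simp add: m)
      thus "positive_fixed s (\<lambda>i j. coeff (m i j) 1)" using real by blast
    qed
  next
    case False
    then obtain i0 j0 where ij: "i0 < s" "j0 < s" "degree (m i0 j0) \<ge> 2" by (auto simp: not_le)
    define f where "f = m i0 j0"
    have f: "nonneg_poly f" "coeff f 0 = 0" "degree f \<ge> 2" using real ij by (auto simp: f_def)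
    define b where "b = X_poly * poly_shift 2 f"
    have fb: "f = monom (coeff f 1) 1 + X_poly * b"
    proof (rule poly_eqI)
      fix k
      consider "k = 0" | "k = 1" | k' where "k = Suc (Suc k')" by (metis One_nat_def not0_implies_Suc)
      thus "coeff f k = coeff (monom (coeff f 1) 1 + X_poly * b) k"
        using f(2) by cases (auto simp: b_def coeff_X_poly_mult coeff_poly_shift numeral_2_eq_2)
    qed
    have b: "nonneg_poly b" "coeff b 0 = 0" 
      using f(1) by (auto simp: b_def nonneg_poly_def coeff_X_poly_mult coeff_poly_shift)
    have cb: "coeff b k = coeff f (Suc k)" if "k \<ge> 1" for k
      using that by (simp add: b_def coeff_X_poly_mult coeff_poly_shift numeral_2_eq_2)
    have "coeff b (degree f - 1) \<noteq> 0" using cb[of "degree f - 1"] f(3) by (auto simp: Suc_diff_Suc)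
    hence b0: "b \<noteq> 0" by auto
    have "degree b \<le> degree f - 1"
    proof (rule degree_le, intro allI impI)
      fix k assume "degree f - 1 < k"
      thus "coeff b k = 0" using cb[of k] f(3) by (simp add: coeff_eq_0)
    qed
    hence db: "degree b - 1 < degree f - 1" using f(3) by simp
    define m1 where "m1 = (\<lambda>i j. if i = i0 \<and> j = j0 then monom (coeff f 1) 1 else m i j)"
    define c where "c = (\<lambda>i. if i = i0 then b else 0)"
    define r where "r = (\<lambda>j. if j = j0 then X_poly else 0)"
    have X: "X_poly \<noteq> 0" by (simp add: X_poly_def)
    have mm: "poly (m i j) t = poly (m1 i j) t + poly (c i) t * poly (r j) t / (1 - poly 0 t)" for i j t
    proof (cases "i = i0 \<and> j = j0")
      case True
      hence "poly (m i j) t = poly f t" by (simp add: f_def)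
      also have "\<dots> = poly (monom (coeff f 1) 1) t + poly b t * t" by (subst fb) simp
      finally show ?thesis using True by (simp add: m1_def c_def r_def)
    qed (auto simp: m1_def c_def r_def)
    \<comment> \<open>The new vertex has loop 0, so the factor \<open>1 - q\<close> is 1 and the
      determinant stays \<open>F\<close>.\<close>
    have "poly_realizable (Suc s) (border s m1 c r 0) (\<lambda>t. (1 - poly 0 t) * F t)"
    proof (rule border_poly_realizable[OF _ _ _ _ _ _ ij(1) _ ij(2)])
      show "det (one_minus_mat s (\<lambda>i j. poly (m1 i j) t + poly (c i) t * poly (r j) t / (1 - poly 0 t))) = F t"
        if "0 \<le> t" "t \<le> 1" for t
        unfolding mm[symmetric] using real that by blast
      show "positive_fixed s (\<lambda>i j. poly (m1 i j) 1 + poly (c i) 1 * poly (r j) 1 / (1 - poly 0 1))"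
        unfolding mm[symmetric] using real by blast
    qed (use real b b0 X f in \<open>auto simp: m1_def c_def r_def X_poly_def nonneg_poly_def\<close>)
    hence real': "poly_realizable (Suc s) (border s m1 c r 0) F" by simp
    have "(\<Sum>i<Suc s. \<Sum>j<Suc s. degree (border s m1 c r 0 i j) - 1)
      = (\<Sum>i<s. (\<Sum>j<s. degree (m1 i j) - 1) + (degree (c i) - 1)) + (\<Sum>j<s. degree (r j) - 1)"
      by (simp add: border_def)
    also have "(\<Sum>j<s. degree (r j) - 1) = 0"
      by (rule sum.neutral) (auto simp: r_def X_poly_def degree_monom_eq)
    also have "(\<Sum>i<s. (\<Sum>j<s. degree (m1 i j) - 1) + (degree (c i) - 1)) + 0
      = (\<Sum>i<s. (\<Sum>j<s. degree (m1 i j) - 1) + (degree (c i) - 1))" by simp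
    also have "\<dots> < (\<Sum>i<s. \<Sum>j<s. degree (m i j) - 1)"
    proof (rule sum_strict_mono_ex1)
      have le: "degree (m1 i j) \<le> degree (m i j)" for i j
        using f(3) by (auto simp: m1_def f_def[symmetric] intro: order_trans[OF degree_monom_le])
      have row: "(\<Sum>j<s. degree (m1 i0 j) - 1) + (degree b - 1) < (\<Sum>j<s. degree (m i0 j) - 1)"
      proof -
        have d: "degree (m1 i0 j0) - 1 = 0"
          using degree_monom_le[of "coeff f 1" 1] by (simp add: m1_def)
        have "(\<Sum>j<s. degree (m1 i0 j) - 1) = (\<Sum>j\<in>{..<s} - {j0}. degree (m1 i0 j) - 1)"
          using ij(2) d by (subst sum.remove[of _ j0]) auto
        also have "\<dots> = (\<Sum>j\<in>{..<s} - {j0}. degree (m i0 j) - 1)"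
          by (rule sum.cong) (auto simp: m1_def)
        finally have "(\<Sum>j<s. degree (m1 i0 j) - 1) + (degree b - 1) < (degree f - 1) + (\<Sum>j\<in>{..<s} - {j0}. degree (m i0 j) - 1)"
          using db by simp
        also have "\<dots> = (\<Sum>j<s. degree (m i0 j) - 1)" unfolding f_def using ij(2) by (subst (2) sum.remove[of _ j0]) auto
        finally show ?thesis .
      qed
      show "\<forall>i\<in>{..<s}. (\<Sum>j<s. degree (m1 i j) - 1) + (degree (c i) - 1) \<le> (\<Sum>j<s. degree (m i j) - 1)"
        using row by (auto simp: c_def intro!: sum_mono diff_le_mono le)
      show "\<exists>i\<in>{..<s}. (\<Sum>j<s. degree (m1 i j) - 1) + (degree (c i) - 1) < (\<Sum>j<s. degree (m i j) - 1)"
        using row ij by (intro bexI[of _ i0]) (auto simp: c_def)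
    qed simp
    finally show ?thesis using less.hyps real' by blast
  qed
qed

section \<open>Moments of completely positive maps\<close>

lemma quadratic_form:
  fixes A :: "complex mat"
  assumes "A \<in> carrier_mat n n" "v \<in> carrier_vec n"
  shows "conjugate v \<bullet> (A *\<^sub>v v) = (\<Sum>i<n. cnj (v $ i) * (\<Sum>j<n. A $$ (i, j) * v $ j))"
  using assms by (auto simp: scalar_prod_def atLeast0LessThan conjugate_complex_def intro!: sum.cong)

lemma mtrace_mult_commute:
  assumes "A \<in> carrier_mat n m" "B \<in> carrier_mat m n"
  shows "mtrace (A * B) = mtrace (B * A)"
proof -
  have "mtrace (A * B) = (\<Sum>i<n. \<Sum>j<m. A $$ (i, j) * B $$ (j, i))"
    using assms by (auto simp: mtrace_def scalar_prod_def atLeast0LessThan intro!: sum.cong)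
  also have "\<dots> = (\<Sum>j<m. \<Sum>i<n. B $$ (j, i) * A $$ (i, j))"
    by (subst sum.swap) (simp add: mult.commute)
  also have "\<dots> = mtrace (B * A)"
    using assms by (auto simp: mtrace_def scalar_prod_def atLeast0LessThan intro!: sum.cong)
  finally show ?thesis .
qed

lemma mtrace_similar:
  assumes "similar_mat_wit A B P Q"
  shows "mtrace A = mtrace B"
proof -
  define n where "n = dim_row A"
  have *: "P \<in> carrier_mat n n" "B \<in> carrier_mat n n" "Q \<in> carrier_mat n n" "Q * P = 1\<^sub>m n" "A = P * B * Q"
    using similar_mat_witD[OF n_def assms] by auto
  have "mtrace A = mtrace (Q * (P * B))"
    unfolding *(5) by (rule mtrace_mult_commute[of _ n n]) (use * in auto)
  also have "Q * (P * B) = Q * P * B" using * by (intro assoc_mult_mat[symmetric]) auto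
  also have "\<dots> = B" using * by simp
  finally show ?thesis .
qed

lemma upper_triangular_pow_mat:
  fixes B :: "complex mat"
  assumes B: "B \<in> carrier_mat n n" "upper_triangular B"
  shows "upper_triangular (B ^\<^sub>m k) \<and> (\<forall>i<n. (B ^\<^sub>m k) $$ (i, i) = B $$ (i, i) ^ k)"
proof (induction k)
  case 0
  show ?case using B by simp
next
  case (Suc k)
  have C: "B ^\<^sub>m k \<in> carrier_mat n n" using B by simp
  have e: "(B ^\<^sub>m Suc k) $$ (i, j) = (\<Sum>l<n. (B ^\<^sub>m k) $$ (i, l) * B $$ (l, j))" if "i < n" "j < n" for i j
    using B C that by (simp add: scalar_prod_def atLeast0LessThan)
  have z: "(B ^\<^sub>m k) $$ (i, l) = 0" if "l < i" "i < n" for i l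
    using Suc that B by (auto elim: upper_triangularD)
  have zB: "B $$ (i, l) = 0" if "l < i" "i < n" for i l
    using that B by (auto elim: upper_triangularD)
  have "upper_triangular (B ^\<^sub>m Suc k)"
  proof (rule upper_triangularI)
    fix i j assume ij: "j < i" "i < dim_row (B ^\<^sub>m Suc k)"
    hence i: "i < n" "j < n" using B by auto
    show "(B ^\<^sub>m Suc k) $$ (i, j) = 0"
      unfolding e[OF i] using z zB ij i by (intro sum.neutral) (metis lessThan_iff linorder_neqE_nat mult_eq_0_iff order.strict_trans)
  qed
  moreover have "(B ^\<^sub>m Suc k) $$ (i, i) = B $$ (i, i) ^ Suc k" if i: "i < n" for i
  proof -
    have "(B ^\<^sub>m Suc k) $$ (i, i) = (\<Sum>l\<in>{i}. (B ^\<^sub>m k) $$ (i, l) * B $$ (l, i))"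
      unfolding e[OF i i]
      by (rule sum.mono_neutral_right) (use i z zB in \<open>auto, metis linorder_neqE_nat\<close>)
    thus ?thesis using Suc i by simp
  qed
  ultimately show ?case by blast
qed

lemma proots_prod_linear: "proots (\<Prod>a\<leftarrow>as. [:- a, 1 :: 'a :: idom:]) = mset as"
proof (induction as)
  case (Cons a as)
  have "(\<Prod>a\<leftarrow>as. [:- a, 1:]) \<noteq> (0 :: 'a poly)" by (auto simp: prod_list_zero_iff)
  hence "proots ([:- a, 1:] * (\<Prod>a\<leftarrow>as. [:- a, 1:])) = proots [:- a, 1:] + mset as"
    using Cons proots_mult[of "[:- a, 1:]" "\<Prod>a\<leftarrow>as. [:- a, 1:]"] by (simp only: pCons_eq_0_iff) simp
  also have "\<dots> = mset (a # as)" by simp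
  finally show ?case by (simp only: list.map prod_list.Cons)
qed simp

text \<open>By Schur decomposition the matrix may be taken upper triangular, and then the diagonal
  of a power consists of the powers of the eigenvalues.\<close>

lemma mtrace_pow_mat:
  assumes A: "A \<in> carrier_mat n n"
  shows "mtrace (A ^\<^sub>m k) = moment k (proots (char_poly A))"
proof -
  obtain as where "char_poly A = (\<Prod>a\<leftarrow>as. [:- a, 1:])" using char_poly_factorized[OF A] by blast
  then obtain B where B: "B \<in> carrier_mat n n" "upper_triangular B" "similar_mat A B"
    using schur_decomposition_exists[OF A] by blast
  then obtain P Q where PQ: "similar_mat_wit A B P Q" by (auto simp: similar_mat_def)
  have "mtrace (A ^\<^sub>m k) = mtrace (B ^\<^sub>m k)" by (rule mtrace_similar[OF similar_mat_wit_pow[OF PQ]])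
  also have "\<dots> = (\<Sum>i<n. B $$ (i, i) ^ k)"
    using upper_triangular_pow_mat[OF B(1,2), of k] B(1) by (auto simp: mtrace_def intro!: sum.cong)
  also have "\<dots> = sum_list (map (\<lambda>x. x ^ k) (diag_mat B))"
    using B(1) by (simp add: diag_mat_def sum_list_sum_nth atLeast0LessThan)
  also have "\<dots> = moment k (mset (diag_mat B))" by (simp add: moment_def sum_mset_sum_list flip: mset_map)
  also have "mset (diag_mat B) = proots (char_poly A)"
    unfolding char_poly_similar[OF B(3)] char_poly_upper_triangular[OF B(1,2)] proots_prod_linear ..
  finally show ?thesis .
qed

section \<open>Kronecker indices and the expansion in matrix units\<close>

lemma index_less:
  fixes a b d :: nat
  assumes "a < m" "b < d"
  shows "a * d + b < m * d"
proof -
  have "a * d + b < (a + 1) * d" using assms by simp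
  also have "\<dots> \<le> m * d" using assms by (intro mult_le_mono1) simp
  finally show ?thesis .
qed

lemma index_eq_iff:
  fixes a b d :: nat
  assumes "b < d" "b' < d"
  shows "a * d + b = a' * d + b' \<longleftrightarrow> a = a' \<and> b = b'"
proof
  assume e: "a * d + b = a' * d + b'"
  have "(a * d + b) div d = (a' * d + b') div d" "(a * d + b) mod d = (a' * d + b') mod d" unfolding e by rule+
  thus "a = a' \<and> b = b'" using assms by simp
qed auto

lemma sum_index:
  fixes g :: "nat \<Rightarrow> 'a::comm_monoid_add"
  shows "(\<Sum>l<m * d. g l) = (\<Sum>a<m. \<Sum>b<d. g (a * d + b))"
proof -
  have "(\<Sum>l<m * d. g l) = (\<Sum>(a, b)\<in>{..<m} \<times> {..<d}. g (a * d + b))"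
    by (rule sum.reindex_bij_witness[of _ "\<lambda>(a, b). a * d + b" "\<lambda>l. (l div d, l mod d)"])
       (auto simp: index_less less_mult_imp_div_less intro!: mod_less_divisor gr0I)
  thus ?thesis by (simp add: sum.cartesian_product)
qed

text \<open>\<open>linear_map_on\<close> gives additivity for two summands only, so \<open>Y\<close>
  is built up entry by entry: \<open>Z l\<close> carries its first \<open>l\<close> entries in the
  row-major order of \<open>op_matrix\<close>.\<close>

lemma linear_map_expansion:
  assumes T: "linear_map_on d T" and Y: "Y \<in> carrier_mat d d" and xy: "x < d" "y < d"
  shows "T Y $$ (x, y) = (\<Sum>l<d * d. Y $$ (l div d, l mod d) * T (mat_unit d (l div d) (l mod d)) $$ (x, y))"
proof -
  define Z where "Z = (\<lambda>l. mat d d (\<lambda>(a, b). if a * d + b < l then Y $$ (a, b) else 0))"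
  have Zc: "Z l \<in> carrier_mat d d" for l by (simp add: Z_def)
  have E: "mat_unit d a b \<in> carrier_mat d d" for a b by (simp add: mat_unit_def)
  have Tc: "T X \<in> carrier_mat d d" if "X \<in> carrier_mat d d" for X using T that by (auto simp: linear_map_on_def)
  have main: "T (Z l) $$ (x, y) = (\<Sum>l<l. Y $$ (l div d, l mod d) * T (mat_unit d (l div d) (l mod d)) $$ (x, y))" if "l \<le> d * d" for l
    using that
  proof (induction l)
    case 0
    have "Z 0 = 0 \<cdot>\<^sub>m 0\<^sub>m d d" by (rule eq_matI) (auto simp: Z_def)
    moreover have "T (0 \<cdot>\<^sub>m 0\<^sub>m d d) = 0 \<cdot>\<^sub>m T (0\<^sub>m d d)"
      using T zero_carrier_mat unfolding linear_map_on_def by blast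
    ultimately have "T (Z 0) = 0 \<cdot>\<^sub>m T (0\<^sub>m d d)" by (simp only:)
    thus ?case using Tc[of "0\<^sub>m d d"] xy by simp
  next
    case (Suc l)
    have d: "d > 0" using xy by simp
    have l: "l div d < d" "l mod d < d" using Suc.prems d by (auto simp: less_mult_imp_div_less)
    have "Z (Suc l) = Z l + Y $$ (l div d, l mod d) \<cdot>\<^sub>m mat_unit d (l div d) (l mod d)"
    proof (rule eq_matI)
      fix a b assume "a < dim_row (Z l + Y $$ (l div d, l mod d) \<cdot>\<^sub>m mat_unit d (l div d) (l mod d))"
        "b < dim_col (Z l + Y $$ (l div d, l mod d) \<cdot>\<^sub>m mat_unit d (l div d) (l mod d))"
      hence ab: "a < d" "b < d" by (auto simp: mat_unit_def)
      have "a * d + b = l \<longleftrightarrow> a = l div d \<and> b = l mod d" using ab by (auto simp: div_mult_mod_eq)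
      thus "Z (Suc l) $$ (a, b) = (Z l + Y $$ (l div d, l mod d) \<cdot>\<^sub>m mat_unit d (l div d) (l mod d)) $$ (a, b)"
        using ab by (auto simp: Z_def mat_unit_def less_Suc_eq)
    qed (auto simp: Z_def mat_unit_def)
    also have "T \<dots> = T (Z l) + Y $$ (l div d, l mod d) \<cdot>\<^sub>m T (mat_unit d (l div d) (l mod d))"
      using T Zc E by (simp add: linear_map_on_def)
    finally show ?case using Suc Tc[OF Zc[of l]] Tc[OF E[of "l div d" "l mod d"]] xy by simp
  qed
  have "Z (d * d) = Y"
  proof (rule eq_matI)
    fix a b assume "a < dim_row Y" "b < dim_col Y"
    hence ab: "a < d" "b < d" using Y by auto
    have "a * d + b < a * d + d" using ab by simp
    also have "\<dots> = (a + 1) * d" by simp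
    also have "\<dots> \<le> d * d" using ab by (intro mult_le_mono1) simp
    finally show "Z (d * d) $$ (a, b) = Y $$ (a, b)" using ab by (simp add: Z_def)
  qed (use Y in \<open>auto simp: Z_def\<close>)
  thus ?thesis using main[of "d * d"] by simp
qed

section \<open>The maximally entangled state and traces of powers\<close>

definition max_entangled :: "nat \<Rightarrow> complex mat" where
  "max_entangled d = mat (d * d) (d * d) (\<lambda>(i, j). if i div d = i mod d \<and> j div d = j mod d then 1 else 0)"

text \<open>The quadratic form at \<open>v\<close> is \<open>|S|^2\<close>, where \<open>S\<close>
  sums the entries of \<open>v\<close> at the doubled indices \<open>(a, a)\<close>.\<close>

lemma psd_max_entangled: "psd_mat (d * d) (max_entangled d)"
  unfolding psd_mat_def
proof (intro conjI ballI)
  show M: "max_entangled d \<in> carrier_mat (d * d) (d * d)" by (simp add: max_entangled_def)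
  fix v :: "complex vec" assume v: "v \<in> carrier_vec (d * d)"
  define S where "S = (\<Sum>j<d * d. if j div d = j mod d then v $ j else 0)"
  have "conjugate v \<bullet> (max_entangled d *\<^sub>v v) = (\<Sum>i<d * d. cnj (if i div d = i mod d then v $ i else 0) * S)"
    unfolding quadratic_form[OF M v] S_def sum_distrib_left
    by (intro sum.cong refl) (auto simp: max_entangled_def sum_distrib_left intro!: sum.cong)
  also have "\<dots> = cnj S * S" by (simp add: S_def sum_distrib_right)
  also have "\<dots> = of_real ((cmod S)\<^sup>2)" by (metis complex_norm_square mult.commute)
  finally show "Im (conjugate v \<bullet> (max_entangled d *\<^sub>v v)) = 0" "0 \<le> Re (conjugate v \<bullet> (max_entangled d *\<^sub>v v))" by simp_all
qed

lemma pow_mat_Suc_left: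
  assumes "A \<in> carrier_mat n n"
  shows "A ^\<^sub>m Suc k = A * A ^\<^sub>m k"
proof (induction k)
  case (Suc k)
  have "A ^\<^sub>m Suc (Suc k) = A * A ^\<^sub>m k * A" using Suc by simp
  also have "\<dots> = A * A ^\<^sub>m Suc k" using assms by (simp add: assoc_mult_mat[of _ n n _ n _ n])
  finally show ?case .
qed (use assms in simp)

text \<open>At row \<open>(a, b)\<close> and column \<open>(a', b')\<close> the map
  \<open>T \<otimes> id\<close> acts on the pair \<open>(a, a')\<close> only. Regrouping the indices
  into row \<open>(a, a')\<close> and column \<open>(b, b')\<close> turns it into left
  multiplication by \<open>op_matrix\<close>, and \<open>max_entangled\<close> into the
  identity.\<close>

lemma tensor_power_entries:
  assumes T: "linear_map_on d T" and ij: "i < d * d" "j < d * d"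
  shows "((tensor_id d d T ^^ k) (max_entangled d)) $$ (i, j)
       = (op_matrix d T ^\<^sub>m k) $$ ((i div d) * d + j div d, (i mod d) * d + j mod d)"
  using ij
proof (induction k arbitrary: i j)
  case 0
  have d: "d > 0" using 0 by (cases d) auto
  have "i div d < d" "j div d < d" using 0 by (auto simp: less_mult_imp_div_less)
  moreover have "i mod d < d" "j mod d < d" using d by auto
  moreover have "(i div d) * d + j div d = (i mod d) * d + j mod d \<longleftrightarrow> i div d = i mod d \<and> j div d = j mod d"
    using calculation by (intro index_eq_iff)
  ultimately show ?case
    using 0 index_less[of "i div d" d "j div d" d] index_less[of "i mod d" d "j mod d" d]
    by (simp add: max_entangled_def op_matrix_def)
next
  case (Suc k)
  have d: "d > 0" using Suc.prems by (cases d) auto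
  have b: "i div d < d" "j div d < d" "i mod d < d" "j mod d < d"
    using Suc.prems d by (auto simp: less_mult_imp_div_less)
  let ?X = "(tensor_id d d T ^^ k) (max_entangled d)"
  let ?O = "op_matrix d T"
  have O: "?O \<in> carrier_mat (d * d) (d * d)" by (simp add: op_matrix_def)
  hence Ok: "?O ^\<^sub>m k \<in> carrier_mat (d * d) (d * d)" by simp
  let ?Y = "mat d d (\<lambda>(a, a'). ?X $$ (a * d + i mod d, a' * d + j mod d))"
  let ?r = "(i div d) * d + j div d" and ?c = "(i mod d) * d + j mod d"
  have rc: "?r < d * d" "?c < d * d" using b by (auto intro: index_less)
  have "((tensor_id d d T ^^ Suc k) (max_entangled d)) $$ (i, j) = T ?Y $$ (i div d, j div d)"
    using Suc.prems by (simp add: tensor_id_def)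
  also have "\<dots> = (\<Sum>l<d * d. ?Y $$ (l div d, l mod d) * T (mat_unit d (l div d) (l mod d)) $$ (i div d, j div d))"
    by (rule linear_map_expansion[OF T]) (use b in auto)
  also have "\<dots> = (\<Sum>l<d * d. ?O $$ (?r, l) * (?O ^\<^sub>m k) $$ (l, ?c))"
  proof (intro sum.cong refl)
    fix l assume l: "l \<in> {..<d * d}"
    have l': "l div d < d" "l mod d < d" using l d by (auto simp: less_mult_imp_div_less)
    have "?Y $$ (l div d, l mod d) = ?X $$ ((l div d) * d + i mod d, (l mod d) * d + j mod d)" using l' by simp
    also have "\<dots> = (?O ^\<^sub>m k) $$ (l, ?c)"
      using l' b by (subst Suc.IH) (auto intro: index_less)
    finally have 1: "?Y $$ (l div d, l mod d) = (?O ^\<^sub>m k) $$ (l, ?c)" .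
    have 2: "?O $$ (?r, l) = T (mat_unit d (l div d) (l mod d)) $$ (i div d, j div d)"
      using rc l b by (simp add: op_matrix_def)
    show "?Y $$ (l div d, l mod d) * T (mat_unit d (l div d) (l mod d)) $$ (i div d, j div d) = ?O $$ (?r, l) * (?O ^\<^sub>m k) $$ (l, ?c)"
      unfolding 1 2 by (rule mult.commute)
  qed
  also have "\<dots> = (?O * ?O ^\<^sub>m k) $$ (?r, ?c)"
    using O Ok rc by (simp add: scalar_prod_def atLeast0LessThan)
  finally show ?case unfolding pow_mat_Suc_left[OF O] .
qed

theorem moment_spec_nonneg:
  assumes T: "linear_map_on d T" and cp: "completely_positive d T"
  shows "Im (moment k (spec d T)) = 0 \<and> 0 \<le> Re (moment k (spec d T))"
proof -
  let ?X = "(tensor_id d d T ^^ k) (max_entangled d)"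
  let ?O = "op_matrix d T"
  have O: "?O \<in> carrier_mat (d * d) (d * d)" by (simp add: op_matrix_def)
  have X: "psd_mat (d * d) ?X"
    using cp psd_max_entangled by (induction k) (auto simp: completely_positive_def)
  \<comment> \<open>The maximally entangled vector. It selects rows \<open>(a, a)\<close> and
    columns \<open>(b, b)\<close>, which realignment moves to the diagonal position
    \<open>(a, b)\<close> of the power, so the quadratic form is a trace.\<close>
  define v :: "complex vec" where "v = vec (d * d) (\<lambda>i. if i div d = i mod d then 1 else 0)"
  have v: "v \<in> carrier_vec (d * d)" by (simp add: v_def)
  have Xc: "?X \<in> carrier_mat (d * d) (d * d)" using X by (simp add: psd_mat_def)
  have diag: "(\<Sum>i<d * d. if i div d = i mod d then g i else 0) = (\<Sum>a<d. g (a * d + a))" for g :: "nat \<Rightarrow> complex"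
  proof -
    have "(\<Sum>i<d * d. if i div d = i mod d then g i else 0) = (\<Sum>a<d. \<Sum>b<d. if a = b then g (a * d + b) else 0)"
      unfolding sum_index by (intro sum.cong refl) auto
    also have "\<dots> = (\<Sum>a<d. g (a * d + a))" by simp
    finally show ?thesis .
  qed
  have "conjugate v \<bullet> (?X *\<^sub>v v) = (\<Sum>i<d * d. if i div d = i mod d then
     (\<Sum>j<d * d. if j div d = j mod d then ?X $$ (i, j) else 0) else 0)"
    unfolding quadratic_form[OF Xc v] by (intro sum.cong refl) (auto simp: v_def intro!: sum.cong)
  also have "\<dots> = (\<Sum>a<d. \<Sum>b<d. ?X $$ (a * d + a, b * d + b))" unfolding diag ..
  also have "\<dots> = (\<Sum>a<d. \<Sum>b<d. (?O ^\<^sub>m k) $$ (a * d + b, a * d + b))"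
    by (intro sum.cong refl, subst tensor_power_entries[OF T]) (auto intro: index_less)
  also have "\<dots> = mtrace (?O ^\<^sub>m k)"
    using O by (simp add: mtrace_def sum_index)
  also have "\<dots> = moment k (spec d T)" unfolding spec_def by (rule mtrace_pow_mat[OF O])
  finally have "moment k (spec d T) = conjugate v \<bullet> (?X *\<^sub>v v)" by simp
  thus ?thesis using X v by (simp add: psd_mat_def)
qed

section \<open>Stochastic matrices as channels\<close>

lemma det_four_block_upper_one:
  fixes B :: "'a::field mat"
  assumes B: "B \<in> carrier_mat m n" and C: "C \<in> carrier_mat n m" and D: "D \<in> carrier_mat n n"
  shows "det (four_block_mat (1\<^sub>m m) B C D) = det (D - C * B)"
proof -
  let ?M = "four_block_mat (1\<^sub>m m) B C D"
  let ?E = "four_block_mat (1\<^sub>m m) (0\<^sub>m m n) (- C) (1\<^sub>m n)"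
  have E: "?E \<in> carrier_mat (m + n) (m + n)" and M: "?M \<in> carrier_mat (m + n) (m + n)"
    using D by (auto intro!: four_block_carrier_mat)
  have "?E * ?M = four_block_mat (1\<^sub>m m * 1\<^sub>m m + 0\<^sub>m m n * C) (1\<^sub>m m * B + 0\<^sub>m m n * D)
      (- C * 1\<^sub>m m + 1\<^sub>m n * C) (- C * B + 1\<^sub>m n * D)"
    by (rule mult_four_block_mat) (use B C D in auto)
  also have "1\<^sub>m m * 1\<^sub>m m + 0\<^sub>m m n * C = 1\<^sub>m m" using C by (auto intro!: eq_matI)
  also have "1\<^sub>m m * B + 0\<^sub>m m n * D = B" using B D by (auto intro!: eq_matI)
  also have "- C * 1\<^sub>m m + 1\<^sub>m n * C = 0\<^sub>m n m" using C by (auto intro!: eq_matI)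
  also have "- C * B + 1\<^sub>m n * D = D - C * B" using B C D by (auto intro!: eq_matI)
  also have "det (four_block_mat (1\<^sub>m m) B (0\<^sub>m n m) (D - C * B)) = det (1\<^sub>m m) * det (D - C * B)"
    by (rule det_four_block_mat_lower_left_zero) (use B C D in auto)
  finally have "det (?E * ?M) = det (D - C * B)" by simp
  moreover have "det ?E = 1"
    by (subst det_four_block_mat_upper_right_zero[of _ m _ n]) (use C in auto)
  ultimately show ?thesis using det_mult[OF E M] by simp
qed

text \<open>Both sides are the determinant of the block matrix with rows \<open>(1, V)\<close> and
  \<open>(U, x 1)\<close>, once with the first and once with the second diagonal block
  eliminated.\<close>

lemma det_sylvester:
  fixes U :: "'a::field mat"
  assumes U: "U \<in> carrier_mat n m" and V: "V \<in> carrier_mat m n" and x: "x \<noteq> 0"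
  shows "det (x \<cdot>\<^sub>m 1\<^sub>m n - U * V) = x ^ n * det (1\<^sub>m m - inverse x \<cdot>\<^sub>m (V * U))"
  using det_four_block_upper_one[OF V U, of "x \<cdot>\<^sub>m 1\<^sub>m n"] det_four_block_scalar[OF _ V U x, of "1\<^sub>m m"] by simp

lemma mult_mat_nth:
  assumes "A \<in> carrier_mat n m" "B \<in> carrier_mat m l" "i < n" "j < l"
  shows "(A * B) $$ (i, j) = (\<Sum>k<m. A $$ (i, k) * B $$ (k, j))"
  using assms by (simp add: scalar_prod_def atLeast0LessThan)

section \<open>Transition matrices acting on diagonals, as measure-and-prepare maps\<close>

definition classical_channel :: "nat \<Rightarrow> (nat \<Rightarrow> nat \<Rightarrow> real) \<Rightarrow> complex mat \<Rightarrow> complex mat" where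
  "classical_channel N S X = mat N N (\<lambda>(i, j). if i = j then \<Sum>k<N. of_real (S i k) * X $$ (k, k) else 0)"

lemma classical_channel_linear: "linear_map_on N (classical_channel N S)"
  unfolding linear_map_on_def
  by (auto simp: classical_channel_def algebra_simps sum.distrib sum_distrib_left intro!: eq_matI)

lemma classical_channel_trace_preserving:
  assumes "\<And>j. j < N \<Longrightarrow> (\<Sum>i<N. S i j) = 1"
  shows "trace_preserving N (classical_channel N S)"
  unfolding trace_preserving_def
proof
  fix X :: "complex mat" assume X: "X \<in> carrier_mat N N"
  have "mtrace (classical_channel N S X) = (\<Sum>i<N. \<Sum>k<N. of_real (S i k) * X $$ (k, k))"
    by (simp add: mtrace_def classical_channel_def)
  also have "\<dots> = (\<Sum>k<N. of_real (\<Sum>i<N. S i k) * X $$ (k, k))"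
    by (subst sum.swap) (simp add: sum_distrib_right)
  also have "\<dots> = mtrace X" using assms X by (simp add: mtrace_def)
  finally show "mtrace (classical_channel N S X) = mtrace X" .
qed

text \<open>The output is block diagonal, and its block \<open>a\<close> is the sum of the diagonal
  blocks \<open>l\<close> of \<open>X\<close> with weights \<open>S a l\<close>. So its quadratic
  form at \<open>v\<close> is the same combination of quadratic forms of \<open>X\<close>, at the
  vectors \<open>u a l\<close> that carry block \<open>a\<close> of \<open>v\<close> in position
  \<open>l\<close>.\<close>

lemma classical_channel_completely_positive:
  assumes S: "\<And>i j. i < N \<Longrightarrow> j < N \<Longrightarrow> 0 \<le> S i j"
  shows "completely_positive N (classical_channel N S)"
  unfolding completely_positive_def
proof (intro allI impI)
  fix k X assume X: "psd_mat (N * k) X"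
  let ?Y = "tensor_id N k (classical_channel N S) X"
  have Xc: "X \<in> carrier_mat (N * k) (N * k)" using X by (simp add: psd_mat_def)
  have Yc: "?Y \<in> carrier_mat (N * k) (N * k)" by (simp add: tensor_id_def)
  have Y: "?Y $$ (a * k + b, a' * k + b') =
      (if a = a' then \<Sum>l<N. of_real (S a l) * X $$ (l * k + b, l * k + b') else 0)"
    if "a < N" "a' < N" "b < k" "b' < k" for a a' b b'
    using that by (simp add: tensor_id_def classical_channel_def index_less)
  have main: "Im (conjugate v \<bullet> (?Y *\<^sub>v v)) = 0 \<and> 0 \<le> Re (conjugate v \<bullet> (?Y *\<^sub>v v))"
    if v: "v \<in> carrier_vec (N * k)" for v
  proof -
    define u where "u = (\<lambda>a l. vec (N * k) (\<lambda>i. if i div k = l then v $ (a * k + i mod k) else 0))"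
    define G where "G = (\<lambda>a l. conjugate (u a l) \<bullet> (X *\<^sub>v u a l))"
    have uc: "u a l \<in> carrier_vec (N * k)" for a l by (simp add: u_def)
    have ui: "u a l $ (c * k + b) = (if c = l then v $ (a * k + b) else 0)" if "c < N" "b < k" for a l b c
      using that by (simp add: u_def index_less)
    have G: "G a l = (\<Sum>b<k. cnj (v $ (a * k + b)) * (\<Sum>b'<k. X $$ (l * k + b, l * k + b') * v $ (a * k + b')))"
      if "l < N" for a l
    proof -
      have inner: "(\<Sum>c'<N. \<Sum>b'<k. X $$ (l * k + b, c' * k + b') * u a l $ (c' * k + b'))
         = (\<Sum>b'<k. X $$ (l * k + b, l * k + b') * v $ (a * k + b'))" for b
      proof -
        have "(\<Sum>c'<N. \<Sum>b'<k. X $$ (l * k + b, c' * k + b') * u a l $ (c' * k + b'))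
          = (\<Sum>c'<N. if c' = l then \<Sum>b'<k. X $$ (l * k + b, c' * k + b') * v $ (a * k + b') else 0)"
          by (intro sum.cong refl) (simp add: ui)
        thus ?thesis using that by simp
      qed
      have "G a l = (\<Sum>c<N. \<Sum>b<k. cnj (u a l $ (c * k + b)) * (\<Sum>c'<N. \<Sum>b'<k. X $$ (c * k + b, c' * k + b') * u a l $ (c' * k + b')))"
        unfolding G_def quadratic_form[OF Xc uc] sum_index ..
      also have "\<dots> = (\<Sum>c<N. if c = l then (\<Sum>b<k. cnj (v $ (a * k + b)) * (\<Sum>c'<N. \<Sum>b'<k. X $$ (c * k + b, c' * k + b') * u a l $ (c' * k + b'))) else 0)"
        by (intro sum.cong refl) (simp add: ui[of _ _ a l] cong: sum.cong_simp)
      also have "\<dots> = (\<Sum>b<k. cnj (v $ (a * k + b)) * (\<Sum>b'<k. X $$ (l * k + b, l * k + b') * v $ (a * k + b')))"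
        using that by (simp add: inner)
      finally show ?thesis .
    qed
    have "conjugate v \<bullet> (?Y *\<^sub>v v) = (\<Sum>a<N. \<Sum>b<k. cnj (v $ (a * k + b)) * (\<Sum>a'<N. \<Sum>b'<k. ?Y $$ (a * k + b, a' * k + b') * v $ (a' * k + b')))"
      unfolding quadratic_form[OF Yc v] sum_index ..
    also have "\<dots> = (\<Sum>a<N. \<Sum>b<k. cnj (v $ (a * k + b)) * (\<Sum>a'<N. if a' = a then \<Sum>b'<k. (\<Sum>l<N. of_real (S a l) * X $$ (l * k + b, l * k + b')) * v $ (a * k + b') else 0))"
      by (intro sum.cong refl arg_cong2[of _ _ _ _ "(*)"]) (auto simp: Y intro!: sum.cong)
    also have "\<dots> = (\<Sum>a<N. \<Sum>b<k. cnj (v $ (a * k + b)) * (\<Sum>b'<k. (\<Sum>l<N. of_real (S a l) * X $$ (l * k + b, l * k + b')) * v $ (a * k + b')))"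
      by simp
    also have "\<dots> = (\<Sum>a<N. \<Sum>l<N. of_real (S a l) * G a l)"
    proof (rule sum.cong[OF refl])
      fix a
      have "(\<Sum>b<k. cnj (v $ (a * k + b)) * (\<Sum>b'<k. (\<Sum>l<N. of_real (S a l) * X $$ (l * k + b, l * k + b')) * v $ (a * k + b')))
        = (\<Sum>b<k. \<Sum>b'<k. \<Sum>l<N. of_real (S a l) * (cnj (v $ (a * k + b)) * (X $$ (l * k + b, l * k + b') * v $ (a * k + b'))))"
        by (simp add: sum_distrib_left sum_distrib_right mult_ac)
      also have "\<dots> = (\<Sum>b<k. \<Sum>l<N. \<Sum>b'<k. of_real (S a l) * (cnj (v $ (a * k + b)) * (X $$ (l * k + b, l * k + b') * v $ (a * k + b'))))"
        by (intro sum.cong refl sum.swap)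
      also have "\<dots> = (\<Sum>l<N. \<Sum>b<k. \<Sum>b'<k. of_real (S a l) * (cnj (v $ (a * k + b)) * (X $$ (l * k + b, l * k + b') * v $ (a * k + b'))))"
        by (rule sum.swap)
      also have "\<dots> = (\<Sum>l<N. of_real (S a l) * G a l)"
        by (intro sum.cong refl) (simp add: G sum_distrib_left)
      finally show "(\<Sum>b<k. cnj (v $ (a * k + b)) * (\<Sum>b'<k. (\<Sum>l<N. of_real (S a l) * X $$ (l * k + b, l * k + b')) * v $ (a * k + b')))
        = (\<Sum>l<N. of_real (S a l) * G a l)" .
    qed
    finally have e: "conjugate v \<bullet> (?Y *\<^sub>v v) = (\<Sum>a<N. \<Sum>l<N. of_real (S a l) * G a l)" .
    have G0: "Im (G a l) = 0" "0 \<le> Re (G a l)" for a l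
      using X uc by (simp_all add: psd_mat_def G_def)
    show ?thesis unfolding e using G0 S by (auto intro!: sum_nonneg)
  qed
  show "psd_mat (N * k) ?Y" unfolding psd_mat_def using Yc main by blast
qed

lemma completely_positive_imp_positive:
  assumes T: "linear_map_on d T" and cp: "completely_positive d T"
  shows "positive_map d T"
  unfolding positive_map_def
proof (intro allI impI)
  fix X assume X: "psd_mat d X"
  hence Xc: "X \<in> carrier_mat d d" by (simp add: psd_mat_def)
  hence TX: "T X \<in> carrier_mat d d" using T by (simp add: linear_map_on_def)
  have "mat d d (\<lambda>(a, a'). X $$ (a, a')) = X" using Xc by (auto intro!: eq_matI)
  hence "tensor_id d 1 T X = T X" using TX by (auto simp: tensor_id_def intro!: eq_matI)
  thus "psd_mat d (T X)" using cp X by (metis completely_positive_def mult.right_neutral)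
qed

text \<open>The operator matrix factors as \<open>U V\<close>: \<open>V\<close> applies
  \<open>S\<close> to the diagonal and \<open>U\<close> embeds the result as a diagonal. Since
  \<open>V U\<close> is \<open>S\<close>, Sylvester's identity reduces the determinant from size
  \<open>N^2\<close> to \<open>N\<close>; the other eigenvalues are 0.\<close>

lemma poly_char_poly_op_matrix_classical:
  assumes x: "x \<noteq> 0"
  shows "poly (char_poly (op_matrix N (classical_channel N S))) (of_real x)
       = of_real (x ^ (N * N) * det (one_minus_mat N (\<lambda>i j. S i j * inverse x)))"
proof -
  define U :: "complex mat" where "U = mat (N * N) N (\<lambda>(i, c). if i div N = c \<and> i mod N = c then 1 else 0)"
  define V :: "complex mat" where "V = mat N (N * N) (\<lambda>(a, i). if i div N = i mod N then of_real (S a (i div N)) else 0)"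
  let ?O = "op_matrix N (classical_channel N S)"
  have O: "?O \<in> carrier_mat (N * N) (N * N)" by (simp add: op_matrix_def)
  have U: "U \<in> carrier_mat (N * N) N" and V: "V \<in> carrier_mat N (N * N)" by (simp_all add: U_def V_def)
  have UV: "?O = U * V"
  proof (rule eq_matI)
    fix i j assume "i < dim_row (U * V)" "j < dim_col (U * V)"
    hence ij: "i < N * N" "j < N * N" by (auto simp: U_def V_def)
    have N: "N > 0" using ij by (cases N) auto
    have b: "i div N < N" "j div N < N" "i mod N < N" "j mod N < N"
      using ij N by (auto simp: less_mult_imp_div_less)
    have "?O $$ (i, j) = (if i div N = i mod N then \<Sum>k<N. of_real (S (i div N) k) * (if k = j div N \<and> k = j mod N then 1 else 0) else 0)"
      using ij b by (auto simp: op_matrix_def classical_channel_def mat_unit_def intro!: sum.cong)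
    also have "(\<Sum>k<N. of_real (S (i div N) k) * (if k = j div N \<and> k = j mod N then 1 else 0 :: complex))
       = (\<Sum>k<N. if k = j div N then (if j div N = j mod N then of_real (S (i div N) k) else 0) else 0)"
      by (intro sum.cong) auto
    also have "\<dots> = (if j div N = j mod N then of_real (S (i div N) (j div N)) else 0)" using b by simp
    also have "(if i div N = i mod N then (if j div N = j mod N then of_real (S (i div N) (j div N)) else 0) else 0)
       = (\<Sum>c<N. if c = i div N then (if c = i mod N then V $$ (c, j) else 0) else 0)"
      using b ij by (auto simp: V_def)
    also have "\<dots> = (U * V) $$ (i, j)"
      unfolding mult_mat_nth[OF U V ij] using ij by (intro sum.cong refl) (auto simp: U_def)
    finally show "?O $$ (i, j) = (U * V) $$ (i, j)" .
  qed (auto simp: op_matrix_def U_def V_def)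
  have VU: "V * U = mat N N (\<lambda>(a, c). of_real (S a c))"
  proof (rule eq_matI)
    fix a c assume "a < dim_row (mat N N (\<lambda>(a, c). of_real (S a c) :: complex))" "c < dim_col (mat N N (\<lambda>(a, c). of_real (S a c) :: complex))"
    hence ac: "a < N" "c < N" by auto
    have "(V * U) $$ (a, c) = (\<Sum>i<N * N. V $$ (a, i) * U $$ (i, c))"
      by (rule mult_mat_nth[OF V U ac])
    also have "\<dots> = (\<Sum>b<N. \<Sum>b'<N. V $$ (a, b * N + b') * U $$ (b * N + b', c))" by (rule sum_index)
    also have "\<dots> = (\<Sum>b<N. \<Sum>b'<N. if b' = c then (if b = c then of_real (S a b) else 0) else 0)"
      using ac by (intro sum.cong refl) (auto simp: U_def V_def index_less)
    also have "\<dots> = of_real (S a c)" using ac by simp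
    finally show "(V * U) $$ (a, c) = mat N N (\<lambda>(a, c). of_real (S a c)) $$ (a, c)" using ac by simp
  qed (auto simp: U_def V_def)
  have "poly (char_poly ?O) (of_real x) = det (of_real x \<cdot>\<^sub>m 1\<^sub>m (N * N) - ?O)"
    unfolding char_poly_def
    by (rule poly_det_cong) (use O in \<open>auto simp: char_poly_matrix_def\<close>)
  also have "\<dots> = of_real x ^ (N * N) * det (1\<^sub>m N - inverse (of_real x) \<cdot>\<^sub>m (V * U))"
    unfolding UV by (rule det_sylvester[OF U V]) (use x in simp)
  also have "1\<^sub>m N - inverse (of_real x) \<cdot>\<^sub>m (V * U) = map_mat of_real (one_minus_mat N (\<lambda>i j. S i j * inverse x))"
    unfolding VU by (rule eq_matI) (auto simp: one_minus_mat_def)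
  also have "det \<dots> = of_real (det (one_minus_mat N (\<lambda>i j. S i j * inverse x)))"
    by (simp add: of_real_hom.hom_det)
  finally show ?thesis by simp
qed

lemma det_one_minus_mat_diag_similar:
  assumes z: "\<And>i. i < N \<Longrightarrow> 0 < z i"
  shows "det (one_minus_mat N (\<lambda>i j. z i * A i j / z j * t)) = det (one_minus_mat N (\<lambda>i j. A i j * t))"
proof -
  let ?L = "one_minus_mat N (\<lambda>i j. z i * A i j / z j * t)" and ?R = "one_minus_mat N (\<lambda>i j. A i j * t)"
  define D where "D = mat N N (\<lambda>(i, j). if i = j then z i else 0)"
  have c: "?L \<in> carrier_mat N N" "?R \<in> carrier_mat N N" "D \<in> carrier_mat N N"
    by (simp_all add: one_minus_mat_def D_def)
  have "det D = prod_list (diag_mat D)"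
    by (rule det_upper_triangular[OF _ c(3)]) (auto simp: D_def)
  also have "\<dots> = (\<Prod>i<N. z i)" by (simp add: diag_mat_def D_def prod.list_conv_set_nth atLeast0LessThan)
  finally have D: "det D \<noteq> 0" using z by (auto simp: prod_zero_iff) (metis less_irrefl)
  have "?L * D = D * ?R"
  proof (rule eq_matI)
    fix i j assume "i < dim_row (D * ?R)" "j < dim_col (D * ?R)"
    hence ij: "i < N" "j < N" by (auto simp: one_minus_mat_def D_def)
    have "(?L * D) $$ (i, j) = (\<Sum>k<N. if k = j then ?L $$ (i, k) * z k else 0)"
      unfolding mult_mat_nth[OF c(1,3) ij] using ij by (intro sum.cong refl) (auto simp: D_def)
    also have "\<dots> = (\<Sum>k<N. if k = i then z i * ?R $$ (k, j) else 0)"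
      using ij z[OF ij(2)] by (simp add: one_minus_mat_def algebra_simps)
    also have "\<dots> = (D * ?R) $$ (i, j)"
      unfolding mult_mat_nth[OF c(3,2) ij] using ij by (intro sum.cong refl) (auto simp: D_def)
    finally show "(?L * D) $$ (i, j) = (D * ?R) $$ (i, j)" .
  qed (auto simp: one_minus_mat_def D_def)
  hence "det ?L * det D = det D * det ?R" unfolding det_mult[OF c(1,3), symmetric] det_mult[OF c(3,2), symmetric] by (rule arg_cong)
  thus ?thesis using D by simp
qed

section \<open>The polynomial of the prescribed spectrum and its dominant element\<close>

definition reciprocal_poly :: "complex multiset \<Rightarrow> complex poly" where
  "reciprocal_poly \<Lambda> = (\<Prod>x\<in>#\<Lambda>. [:1, - x:])"

lemma has_moments_reciprocal_poly:
  "has_moments (fps_of_poly (reciprocal_poly \<Lambda>)) (Abs_fps (\<lambda>k. if k = 0 then 0 else moment k \<Lambda>))"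
proof (induction \<Lambda>)
  case empty
  have "Abs_fps (\<lambda>k. if k = 0 then 0 else moment k {#}) = 0" by (rule fps_ext) (simp add: moment_def)
  thus ?case by (simp only: reciprocal_poly_def image_mset_empty prod_mset_empty fps_of_poly_1 has_moments_one)
next
  case (add x \<Lambda>)
  have 1: "fps_of_poly [:1, - x:] = 1 - fps_const x * fps_X"
    by (rule fps_ext) (auto simp: coeff_pCons split: nat.splits)
  have "has_moments (fps_of_poly (reciprocal_poly (add_mset x \<Lambda>)))
      (Abs_fps (\<lambda>k. if k > 0 then x ^ k else 0) + Abs_fps (\<lambda>k. if k = 0 then 0 else moment k \<Lambda>))"
    unfolding reciprocal_poly_def image_mset_add_mset prod_mset.add_mset fps_of_poly_mult 1
    by (rule has_moments_mult[OF has_moments_one_minus_X add[unfolded reciprocal_poly_def]])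
  also have "Abs_fps (\<lambda>k. if k > 0 then x ^ k else 0) + Abs_fps (\<lambda>k. if k = 0 then 0 else moment k \<Lambda>)
      = Abs_fps (\<lambda>k. if k = 0 then 0 else moment k (add_mset x \<Lambda>))"
    by (rule fps_ext) (simp add: moment_def)
  finally show ?case .
qed

text \<open>Newton's identities express the coefficients rationally through the moments, so real
  moments force real coefficients.\<close>

lemma real_reciprocal_poly:
  assumes im: "\<And>k. Im (moment k \<Lambda>) = 0"
  shows "\<exists>f. reciprocal_poly \<Lambda> = map_poly of_real f \<and>
     has_moments (fps_of_poly f) (Abs_fps (\<lambda>k. if k = 0 then 0 else Re (moment k \<Lambda>)))"
proof -
  let ?F = "reciprocal_poly \<Lambda>"
  note mom = has_moments_reciprocal_poly[of \<Lambda>]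
  have F0: "coeff ?F 0 = 1" using mom by (simp add: has_moments_def)
  have rec: "of_nat k * coeff ?F k = - (\<Sum>j=1..k. moment j \<Lambda> * coeff ?F (k - j))" for k
    using has_moments_nth'[OF mom, of k] by simp
  have real: "Im (coeff ?F k) = 0" for k
  proof (induction k rule: less_induct)
    case (less k)
    show ?case
    proof (cases "k = 0")
      case False
      have "Im (of_nat k * coeff ?F k) = 0"
        unfolding rec using less by (auto simp: im intro!: sum.neutral)
      thus ?thesis using False by simp
    qed (use F0 in simp)
  qed
  define f where "f = map_poly Re ?F"
  have f: "coeff f k = Re (coeff ?F k)" for k by (simp add: f_def coeff_map_poly)
  have "?F = map_poly of_real f"
    by (rule poly_eqI) (simp add: coeff_map_poly f real complex_eq_iff)
  moreover have "has_moments (fps_of_poly f) (Abs_fps (\<lambda>k. if k = 0 then 0 else Re (moment k \<Lambda>)))"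
  proof (rule has_momentsI)
    fix k :: nat assume "k \<ge> 1"
    have "Re (of_nat k * coeff ?F k) = - (\<Sum>j=1..k. Re (moment j \<Lambda> * coeff ?F (k - j)))"
      unfolding rec by simp
    thus "of_nat k * fps_nth (fps_of_poly f) k = - (\<Sum>j=1..k. fps_nth (Abs_fps (\<lambda>k. if k = 0 then 0 else Re (moment k \<Lambda>))) j * fps_nth (fps_of_poly f) (k - j))"
      by (simp add: f real)
  qed (simp_all add: f F0)
  ultimately show ?thesis by blast
qed

lemma moment_perron_bound:
  assumes p: "count \<Lambda> p = 1" "cmod p = 1" and le: "\<And>x. x \<in># \<Lambda> \<Longrightarrow> cmod x \<le> 1 \<and> (cmod x = 1 \<longrightarrow> x = p)"
  shows "\<exists>\<rho> n. 0 < \<rho> \<and> \<rho> < 1 \<and> 0 \<le> n \<and> (\<forall>k. cmod (moment k \<Lambda> - p ^ k) \<le> n * \<rho> ^ k)"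
proof -
  define M where "M = \<Lambda> - {#p#}"
  have L: "\<Lambda> = add_mset p M" using p(1) unfolding M_def
    by (metis count_eq_zero_iff insert_DiffM zero_neq_one)
  have pM: "p \<notin># M" using p(1) unfolding L by (simp add: count_eq_zero_iff)
  \<comment> \<open>The value \<open>1 / 2\<close> keeps \<open>\<rho>\<close> positive and covers
    the case that \<open>p\<close> is the only element.\<close>
  define \<rho> where "\<rho> = Max (insert (1 / 2) (cmod ` set_mset M))"
  have "cmod x < 1" if "x \<in># M" for x
    using le[of x] pM that by (auto simp: L order_less_le)
  hence r1: "\<rho> < 1" unfolding \<rho>_def by (subst Max_less_iff) auto
  have r2: "1 / 2 \<le> \<rho>" unfolding \<rho>_def by (rule Max_ge) auto
  have r: "cmod x \<le> \<rho>" if "x \<in># M" for x unfolding \<rho>_def by (rule Max_ge) (use that in auto)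
  have "cmod (moment k M) \<le> real (size M) * \<rho> ^ k" for k
    using r
  proof (induction M)
    case (add x M)
    have "cmod (moment k (add_mset x M)) \<le> cmod (x ^ k) + cmod (moment k M)"
      unfolding moment_def by (simp add: norm_triangle_ineq)
    also have "\<dots> \<le> \<rho> ^ k + real (size M) * \<rho> ^ k"
      using add by (intro add_mono) (auto simp: norm_power intro!: power_mono)
    finally show ?case by (simp add: algebra_simps)
  qed (simp add: moment_def)
  moreover have "moment k \<Lambda> - p ^ k = moment k M" for k by (simp add: L moment_def)
  ultimately show ?thesis using r1 r2
    by (intro exI[of _ \<rho>] exI[of _ "real (size M)"]) auto
qed

text \<open>\<open>c k\<close> equals its own modulus and approaches \<open>p^k\<close>, which has
  modulus 1, so \<open>c k\<close> tends to 1. Hence \<open>p^k\<close> tends to 1 as well, and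
  comparison with \<open>p^(k+1)\<close> gives \<open>p = 1\<close>.\<close>

lemma perron_root_eq_one:
  fixes p :: complex
  assumes rho: "0 < \<rho>" "\<rho> < 1" and p: "cmod p = 1"
    and b: "\<And>k. cmod (c k - p ^ k) \<le> n * \<rho> ^ k" and c: "\<And>k. Im (c k) = 0 \<and> 0 \<le> Re (c k)"
  shows "p = 1"
proof -
  have lim: "(\<lambda>k. n * \<rho> ^ k) \<longlonglongrightarrow> 0"
  proof -
    have "(\<lambda>k. n * \<rho> ^ k) \<longlonglongrightarrow> n * 0" using rho by (intro tendsto_intros LIMSEQ_realpow_zero) auto
    thus ?thesis by simp
  qed
  have d: "(\<lambda>k. c k - p ^ k) \<longlonglongrightarrow> 0"
  proof (rule tendsto_0_le[OF lim, of _ 1], intro always_eventually allI)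
    show "norm (c k - p ^ k) \<le> norm (n * \<rho> ^ k) * 1" for k
      using b[of k] by simp
  qed
  have ck: "of_real (cmod (c k)) = c k" for k
    using c[of k] by (auto simp: complex_eq_iff cmod_eq_Re)
  have "(\<lambda>k. cmod (c k)) \<longlonglongrightarrow> 1"
  proof -
    have "(\<lambda>k. cmod (c k) - 1) \<longlonglongrightarrow> 0"
    proof (rule tendsto_0_le[OF lim, of _ 1], intro always_eventually allI)
      fix k
      have "\<bar>cmod (c k) - cmod (p ^ k)\<bar> \<le> cmod (c k - p ^ k)" by (rule norm_triangle_ineq3)
      hence "norm (cmod (c k) - 1) \<le> n * \<rho> ^ k" using b[of k] p by (simp add: norm_power)
      also have "\<dots> \<le> norm (n * \<rho> ^ k) * 1" by simp
      finally show "norm (cmod (c k) - 1) \<le> norm (n * \<rho> ^ k) * 1" .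
    qed
    thus ?thesis by (simp add: LIM_zero_iff)
  qed
  hence "(\<lambda>k. of_real (cmod (c k)) :: complex) \<longlonglongrightarrow> of_real 1" by (rule tendsto_of_real)
  hence "c \<longlonglongrightarrow> 1" unfolding ck by simp
  from tendsto_diff[OF this d] have pk: "(\<lambda>k. p ^ k) \<longlonglongrightarrow> 1" by simp
  have "(\<lambda>k. p ^ Suc k) \<longlonglongrightarrow> 1" using pk by (rule LIMSEQ_Suc)
  moreover have "(\<lambda>k. p ^ Suc k) \<longlonglongrightarrow> p * 1" using tendsto_mult_left[OF pk, of p] by simp
  ultimately show ?thesis using LIMSEQ_unique by fastforce
qed

lemma proots_prod_mset_linear: "proots (\<Prod>x\<in>#\<Lambda>. [:- x, 1 :: 'a :: idom:]) = \<Lambda>"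
proof -
  obtain as where as: "\<Lambda> = mset as" by (metis ex_mset)
  have "(\<Prod>x\<in>#\<Lambda>. [:- x, 1:]) = (\<Prod>a\<leftarrow>as. [:- a, 1:])"
    unfolding as by (metis mset_map prod_mset_prod_list)
  thus ?thesis by (simp add: proots_prod_linear as)
qed

lemma proots_monom_mult:
  fixes q :: "'a::idom poly"
  assumes "q \<noteq> 0"
  shows "filter_mset (\<lambda>x. x \<noteq> 0) (proots (monom 1 n * q)) = filter_mset (\<lambda>x. x \<noteq> 0) (proots q)"
proof -
  have "monom 1 n = ([:0, 1:] :: 'a poly) ^ n" by (simp add: monom_altdef)
  moreover have "proots (([:0, 1:] :: 'a poly) ^ n) = repeat_mset n {#0#}"
    unfolding proots_power by simp
  ultimately have "proots (monom 1 n * q) = repeat_mset n {#0#} + proots q"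
    using assms by (subst proots_mult) auto
  moreover have "filter_mset (\<lambda>x. x \<noteq> 0) (repeat_mset n {#0 :: 'a#}) = {#}" by (induction n) auto
  ultimately show ?thesis by simp
qed

lemma poly_prod_linear_reciprocal:
  fixes x :: complex
  assumes "x \<noteq> 0"
  shows "poly (\<Prod>a\<in>#\<Lambda>. [:- a, 1:]) x = x ^ size \<Lambda> * poly (reciprocal_poly \<Lambda>) (inverse x)"
proof (induction \<Lambda>)
  case (add a \<Lambda>)
  have R: "poly (reciprocal_poly (add_mset a \<Lambda>)) (inverse x) = (1 - inverse x * a) * poly (reciprocal_poly \<Lambda>) (inverse x)"
    by (simp add: reciprocal_poly_def algebra_simps)
  have x: "x - a = x * (1 - inverse x * a)" using assms by (simp add: right_diff_distrib)
  have "x ^ size (add_mset a \<Lambda>) * poly (reciprocal_poly (add_mset a \<Lambda>)) (inverse x)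
      = (x - a) * (x ^ size \<Lambda> * poly (reciprocal_poly \<Lambda>) (inverse x))"
    unfolding R x by (simp only: size_add_mset power_Suc ac_simps)
  thus ?case unfolding add[symmetric] by (simp add: left_diff_distrib)
qed (simp add: reciprocal_poly_def)

text \<open>The determinant identity of the network matrix \<open>A\<close> fixes the nonzero
  spectrum of the channel; the left eigenvector of \<open>A\<close> yields trace preservation, and
  both eigenvectors together the positive definite fixed point.\<close>

lemma primitive_channel_exists:
  fixes \<Lambda> :: "complex multiset"
  assumes nz: "\<And>x. x \<in># \<Lambda> \<Longrightarrow> x \<noteq> 0" and p: "count \<Lambda> p = 1" "cmod p = 1"
    and le: "\<And>x. x \<in># \<Lambda> \<Longrightarrow> cmod x \<le> 1 \<and> (cmod x = 1 \<longrightarrow> x = p)"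
    and mom: "\<And>k. Im (moment k \<Lambda>) = 0 \<and> 0 \<le> Re (moment k \<Lambda>)"
    and mult: "\<And>k m. 0 < Re (moment m \<Lambda>) \<Longrightarrow> 0 < Re (moment (k * m) \<Lambda>)"
  shows "\<exists>N T. linear_map_on N T \<and> positive_map N T \<and> completely_positive N T \<and> trace_preserving N T \<and>
     primitive_map N T \<and> filter_mset (\<lambda>x. x \<noteq> 0) (spec N T) = \<Lambda>"
proof -
  obtain \<rho> n where rho: "0 < \<rho>" "\<rho> < 1" "0 \<le> n" and b: "\<And>k. cmod (moment k \<Lambda> - p ^ k) \<le> n * \<rho> ^ k"
    using moment_perron_bound[OF p le] by blast
  have p1: "p = 1" by (rule perron_root_eq_one[OF rho(1,2) p(2) b mom])
  obtain f where F: "reciprocal_poly \<Lambda> = map_poly of_real f"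
    and f: "has_moments (fps_of_poly f) (Abs_fps (\<lambda>k. if k = 0 then 0 else Re (moment k \<Lambda>)))"
    using real_reciprocal_poly[of \<Lambda>] mom by blast
  have pf: "of_real (poly f t) = poly (reciprocal_poly \<Lambda>) (of_real t)" for t
    unfolding F by (simp add: of_real_hom.poly_map_poly)
  have one: "1 \<in># \<Lambda>" using p(1) p1 by (metis count_eq_zero_iff zero_neq_one)
  have "poly (reciprocal_poly \<Lambda>) 1 = 0"
    using one unfolding reciprocal_poly_def by (auto dest!: multi_member_split)
  hence f1: "poly f 1 = 0" using pf[of 1] by simp
  have sb: "\<bar>Re (moment k \<Lambda>) - 1\<bar> \<le> n * \<rho> ^ k" for k
    using b[of k] abs_Re_le_cmod[of "moment k \<Lambda> - 1"] p1 by simp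
  have mult': "0 < Re (moment k \<Lambda>)" if "j dvd k" "0 < Re (moment j \<Lambda>)" for j k
    using mult[OF that(2), of "k div j"] that(1) by simp
  obtain pp qs w \<nu> where net: "nonneg_poly pp" "coeff pp 0 = 0" "poly pp 1 < 1"
     "\<forall>(c, j)\<in>set qs. 0 < c \<and> c < 1 \<and> 1 \<le> j" "w \<noteq> 0" "cone pp qs w \<nu>" "f = (1 - pp) * monom_prod qs - \<nu>"
  proof -
    have "0 \<le> Re (moment k \<Lambda>)" for k using mom by blast
    from network_decomposition[OF f rho(1,2,3) sb this]
    have "\<exists>p qs w \<nu>. nonneg_poly p \<and> coeff p 0 = 0 \<and> poly p 1 < 1 \<and> (\<forall>(c, j)\<in>set qs. 0 < c \<and> c < 1 \<and> 1 \<le> j) \<and>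
       w \<noteq> 0 \<and> cone p qs w \<nu> \<and> f = (1 - p) * monom_prod qs - \<nu>"
      using mult' by (simp only:)
    thus ?thesis using that by (elim exE conjE)
  qed
  obtain s m where "poly_realizable s m (poly f)"
    using network_realizable[OF net(1-3,5,4,6,7) f1] by (elim exE)
  then obtain N A where A0: "\<And>i j. i < N \<Longrightarrow> j < N \<Longrightarrow> 0 \<le> A i j"
    and Adet: "\<And>t. 0 \<le> t \<Longrightarrow> t \<le> 1 \<Longrightarrow> det (one_minus_mat N (\<lambda>i j. A i j * t)) = poly f t"
    and Afix: "positive_fixed N A"
    using poly_realizable_linear[of s m "poly f"] by blast
  obtain y z where yz: "\<And>i. i < N \<Longrightarrow> 0 < y i" "\<And>i. i < N \<Longrightarrow> 0 < z i"
    and y: "\<And>i. i < N \<Longrightarrow> (\<Sum>j<N. A i j * y j) = y i" and z: "\<And>j. j < N \<Longrightarrow> (\<Sum>i<N. z i * A i j) = z j"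
    using Afix unfolding positive_fixed_def by blast
  \<comment> \<open>Conjugation by the left eigenvector makes all columns sum to 1 and leaves the
    determinant unchanged.\<close>
  define S where "S = (\<lambda>i j. z i * A i j / z j)"
  define T where "T = classical_channel N S"
  have S0: "0 \<le> S i j" if "i < N" "j < N" for i j
    using A0[OF that] yz(2)[OF that(1)] yz(2)[OF that(2)] by (simp add: S_def)
  have S1: "(\<Sum>i<N. S i j) = 1" if "j < N" for j
    using z[OF that] yz(2)[OF that] by (simp add: S_def sum_divide_distrib[symmetric])
  have lin: "linear_map_on N T" unfolding T_def by (rule classical_channel_linear)
  have tp: "trace_preserving N T" unfolding T_def by (rule classical_channel_trace_preserving) (rule S1)
  have cp: "completely_positive N T" unfolding T_def by (rule classical_channel_completely_positive) (rule S0)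
  define C where "C = char_poly (op_matrix N T)"
  define G where "G = (\<Prod>x\<in>#\<Lambda>. [:- x, 1:])"
  have O: "op_matrix N T \<in> carrier_mat (N * N) (N * N)" by (simp add: op_matrix_def)
  have C0: "C \<noteq> 0" using degree_monic_char_poly[OF O] unfolding C_def by (metis coeff_0 zero_neq_one)
  have G0: "G \<noteq> 0" unfolding G_def by (auto simp: prod_mset_zero_iff)
  \<comment> \<open>For \<open>x \<ge> 1\<close> the inverse lies in \<open>(0, 1]\<close>, where
    the determinant of \<open>A\<close> is known. The monomials balance the degrees
    \<open>N^2\<close> and \<open>size \<Lambda>\<close>, and infinitely many such \<open>x\<close>
    force equality of the polynomials.\<close>
  have eq: "poly (monom 1 (size \<Lambda>) * C) (of_real x) = poly (monom 1 (N * N) * G) (of_real x)" if x: "x \<ge> 1" for x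
  proof -
    have "poly C (of_real x) = of_real (x ^ (N * N) * det (one_minus_mat N (\<lambda>i j. S i j * inverse x)))"
      unfolding C_def T_def by (rule poly_char_poly_op_matrix_classical) (use x in simp)
    also have "det (one_minus_mat N (\<lambda>i j. S i j * inverse x)) = det (one_minus_mat N (\<lambda>i j. A i j * inverse x))"
      unfolding S_def by (rule det_one_minus_mat_diag_similar) (rule yz)
    also have "\<dots> = poly f (inverse x)" using x by (intro Adet) (auto simp: inverse_le_1_iff)
    finally have "poly C (of_real x) = of_real x ^ (N * N) * poly (reciprocal_poly \<Lambda>) (inverse (of_real x))"
      using pf[of "inverse x"] by simp
    moreover have "poly G (of_real x) = of_real x ^ size \<Lambda> * poly (reciprocal_poly \<Lambda>) (inverse (of_real x))"
      unfolding G_def by (rule poly_prod_linear_reciprocal) (use x in simp)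
    ultimately show ?thesis by (simp add: poly_monom)
  qed
  have "monom 1 (size \<Lambda>) * C = monom 1 (N * N) * G"
  proof (rule ccontr)
    assume "monom 1 (size \<Lambda>) * C \<noteq> monom 1 (N * N) * G"
    hence "finite {x. poly (monom 1 (size \<Lambda>) * C - monom 1 (N * N) * G) x = 0}"
      by (intro poly_roots_finite) simp
    moreover have "of_real ` {1::real..} \<subseteq> {x. poly (monom 1 (size \<Lambda>) * C - monom 1 (N * N) * G) x = 0}"
      using eq by auto
    ultimately have "finite ((of_real :: real \<Rightarrow> complex) ` {1::real..})" by (rule finite_subset[rotated])
    hence "finite {1::real..}" by (rule finite_imageD) (auto simp: inj_on_def)
    thus False by (simp add: infinite_Ici)
  qed
  hence "filter_mset (\<lambda>x. x \<noteq> 0) (proots C) = filter_mset (\<lambda>x. x \<noteq> 0) (proots G)"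
    using proots_monom_mult[OF C0] proots_monom_mult[OF G0] by metis
  also have "proots G = \<Lambda>" unfolding G_def by (rule proots_prod_mset_linear)
  also have "filter_mset (\<lambda>x. x \<noteq> 0) \<Lambda> = \<Lambda>" using nz by (simp add: filter_mset_eq_conv)
  finally have spec: "filter_mset (\<lambda>x. x \<noteq> 0) (spec N T) = \<Lambda>" by (simp add: spec_def C_def)
  have in_spec: "x \<in># \<Lambda>" if "x \<in># spec N T" "x \<noteq> 0" for x
    using that by (subst spec[symmetric]) simp
  have one_spec: "1 \<in># spec N T" using one by (subst (asm) spec[symmetric]) simp
  have radius: "spectral_radius_map N T = 1"
    unfolding spectral_radius_map_def
  proof (rule Max_eqI)
    show "r \<le> 1" if r: "r \<in> insert 0 (cmod ` set_mset (spec N T))" for r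
    proof (cases "r = 0")
      case False
      then obtain x where x: "x \<in># spec N T" "r = cmod x" using r by auto
      with False have "x \<noteq> 0" by auto
      thus ?thesis using le[OF in_spec[OF x(1)]] x(2) by simp
    qed simp
    show "1 \<in> insert 0 (cmod ` set_mset (spec N T))" using one_spec by (auto intro!: image_eqI[of _ _ 1])
  qed simp
  have "count (spec N T) 1 = 1"
  proof -
    have "count (filter_mset (\<lambda>x. x \<noteq> 0) (spec N T)) 1 = 1" unfolding spec using p(1) p1 by simp
    thus ?thesis by simp
  qed
  moreover have "\<exists>X. pd_mat N X \<and> T X = complex_of_real 1 \<cdot>\<^sub>m X"
  proof -
    \<comment> \<open>The entrywise product of \<open>z\<close> and \<open>y\<close> is fixed by
      \<open>S\<close>, because the rescaling by \<open>z\<close> cancels and leaves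
      \<open>z\<close> times \<open>A y = y\<close>.\<close>
    define W :: "complex mat" where "W = mat N N (\<lambda>(i, j). if i = j then of_real (z i * y i) else 0)"
    have Wc: "W \<in> carrier_mat N N" by (simp add: W_def)
    have "T W = W"
    proof (rule eq_matI)
      fix i j assume "i < dim_row W" "j < dim_col W"
      hence ij: "i < N" "j < N" by (auto simp: W_def)
      have "(\<Sum>k<N. S i k * (z k * y k)) = z i * (\<Sum>k<N. A i k * y k)"
        unfolding sum_distrib_left using yz(2) by (intro sum.cong refl) (auto simp: S_def less_imp_neq[symmetric])
      hence "(\<Sum>k<N. S i k * (z k * y k)) = z i * y i" using y[OF ij(1)] by simp
      hence "(\<Sum>k<N. of_real (S i k) * of_real (z k * y k)) = (of_real (z i * y i) :: complex)"
        by (metis (mono_tags, lifting) of_real_mult of_real_sum sum.cong)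
      thus "T W $$ (i, j) = W $$ (i, j)" using ij by (cases "i = j") (simp_all add: T_def classical_channel_def W_def)
    qed (auto simp: T_def classical_channel_def W_def)
    moreover have "pd_mat N W"
      unfolding pd_mat_def
    proof (intro conjI ballI impI)
      show "W \<in> carrier_mat N N" by (rule Wc)
      fix v :: "complex vec" assume v: "v \<in> carrier_vec N" "v \<noteq> 0\<^sub>v N"
      have "conjugate v \<bullet> (W *\<^sub>v v) = (\<Sum>i<N. cnj (v $ i) * (\<Sum>j<N. if j = i then of_real (z i * y i) * v $ j else 0))"
        unfolding quadratic_form[OF Wc v(1)] by (intro sum.cong refl arg_cong2[of _ _ _ _ "(*)"]) (auto simp: W_def)
      also have "\<dots> = (\<Sum>i<N. of_real (z i * y i * (cmod (v $ i))\<^sup>2))"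
        by (intro sum.cong refl)
           (simp del: of_real_power add: complex_norm_square mult.commute mult.left_commute)
      finally have e: "conjugate v \<bullet> (W *\<^sub>v v) = of_real (\<Sum>i<N. z i * y i * (cmod (v $ i))\<^sup>2)" by simp
      obtain i where i: "i < N" "v $ i \<noteq> 0" using v by (metis carrier_vecD eq_vecI index_zero_vec)
      have "0 < (\<Sum>i<N. z i * y i * (cmod (v $ i))\<^sup>2)"
        by (rule sum_pos2[of _ i]) (use i yz in \<open>auto simp: less_imp_le\<close>)
      thus "Im (conjugate v \<bullet> (W *\<^sub>v v)) = 0" "0 < Re (conjugate v \<bullet> (W *\<^sub>v v))" unfolding e by simp_all
    qed
    moreover have "complex_of_real 1 \<cdot>\<^sub>m W = W" by (rule eq_matI) auto
    ultimately show ?thesis by (intro exI[of _ W]) (simp only: simp_thms)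
  qed
  ultimately have "irreducible_map N T" by (simp add: irreducible_map_def radius)
  moreover have "\<forall>x\<in>#spec N T. cmod x = 1 \<longrightarrow> x = 1" using in_spec le p1 by fastforce
  ultimately have "primitive_map N T" by (simp add: primitive_map_def radius)
  thus ?thesis using lin cp tp completely_positive_imp_positive[OF lin cp] spec by blast
qed

theorem theorem4:
  shows "(\<forall>d T k. linear_map_on d T \<and> completely_positive d T \<and> trace_preserving d T \<longrightarrow>
            Im (moment k (spec d T)) = 0 \<and> Re (moment k (spec d T)) \<ge> 0)
       \<and> (\<forall>\<Lambda> :: complex multiset.
            (\<forall>x \<in># \<Lambda>. x \<noteq> 0) \<and>
            (\<exists>p. count \<Lambda> p = 1 \<and> cmod p = 1 \<and>
                 (\<forall>x \<in># \<Lambda>. cmod x \<le> 1 \<and> (cmod x = 1 \<longrightarrow> x = p))) \<and>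
            (\<forall>k m. Im (moment k \<Lambda>) = 0 \<and> Re (moment k \<Lambda>) \<ge> 0 \<and>
                   (Re (moment m \<Lambda>) > 0 \<longrightarrow> Re (moment (k * m) \<Lambda>) > 0))
            \<longrightarrow> (\<exists>N T. linear_map_on N T \<and> positive_map N T \<and> completely_positive N T \<and>
                       trace_preserving N T \<and> primitive_map N T \<and>
                       filter_mset (\<lambda>x. x \<noteq> 0) (spec N T) = \<Lambda>))"
proof (intro conjI allI impI)
  fix d T k assume "linear_map_on d T \<and> completely_positive d T \<and> trace_preserving d T"
  thus "Im (moment k (spec d T)) = 0" "0 \<le> Re (moment k (spec d T))"
    using moment_spec_nonneg by blast+
next
  fix \<Lambda> :: "complex multiset"
  assume H: "(\<forall>x \<in># \<Lambda>. x \<noteq> 0) \<and>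
            (\<exists>p. count \<Lambda> p = 1 \<and> cmod p = 1 \<and>
                 (\<forall>x \<in># \<Lambda>. cmod x \<le> 1 \<and> (cmod x = 1 \<longrightarrow> x = p))) \<and>
            (\<forall>k m. Im (moment k \<Lambda>) = 0 \<and> Re (moment k \<Lambda>) \<ge> 0 \<and>
                   (Re (moment m \<Lambda>) > 0 \<longrightarrow> Re (moment (k * m) \<Lambda>) > 0))"
  then obtain p where "count \<Lambda> p = 1" "cmod p = 1"
    "\<And>x. x \<in># \<Lambda> \<Longrightarrow> cmod x \<le> 1 \<and> (cmod x = 1 \<longrightarrow> x = p)" by blast
  thus "\<exists>N T. linear_map_on N T \<and> positive_map N T \<and> completely_positive N T \<and>
                       trace_preserving N T \<and> primitive_map N T \<and>
                       filter_mset (\<lambda>x. x \<noteq> 0) (spec N T) = \<Lambda>"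
    using H by (intro primitive_channel_exists[of \<Lambda> p]) auto
qed

end
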